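(* Let $\Sigma=\bigcup_{j=1}^{g+1}[a_j,b_j]\subset\mathbb{R}$ be a union of pairwise disjoint compact intervals and $w$ a weight on $\Sigma$ of the form \[ w(x)=\sum_{j=1}^{g+1}\mathbb{1}_{[a_j,b_j]}(x)\,h_j(x)\left(\sqrt{x-a_j}\right)^{\alpha_j}\left(\sqrt{b_j-x}\right)^{\beta_j},\qquad \alpha_j,\beta_j\in\{-1,1\}, \] with $h_j$ positive on $[a_j,b_j]$ and analytic in a neighborhood of it, $\int_\Sigma w=1$; let $p_0,p_1,\dots$ be its orthonormal polynomials. Let $\varrho>1$, let $\Gamma_\varrho=\{z:e^{\operatorname{Re}\mathfrak{g}(z)}=\varrho\}$, and let $f$ be analytic in the interior $\{z:e^{\operatorname{Re}\mathfrak{g}(z)}<\varrho\}$ of $\Gamma_\varrho$ with $|f(z)|\le M$ there. Let $\mathbf{A}\in\mathbb{C}^{n\times n}$, $\mathbf{b}\in\mathbb{C}^n$, let $\Gamma$ be a counterclockwise contour in the interior of $\Gamma_\varrho$ enclosing $\Sigma$ and the spectrum of $\mathbf{A}$, and let $z_1,\dots,z_m\in\Gamma\setminus\Sigma$ be quadrature nodes with weights $\omega_1,\dots,\omega_m$. Define \[ f_{k,m}(\mathbf{A})\mathbf{b}=-\sum_{\ell=0}^{k-1}\left(\sum_{j=1}^m f(z_j)\,\omega_j\,\mathcal{C}_\Sigma[p_\ell w](z_j)\right)p_\ell(\mathbf{A})\mathbf{b},\qquad \rho_m(x)=\int_\Gamma\frac{f(z)}{z-x}\,dz-\sum_{j=1}^m\frac{f(z_j)}{z_j-x}\,\omega_j,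 \] and $\|\rho_m\|_\infty=\max_{x\in\Sigma}|\rho_m(x)|$. Suppose $\sum_{\ell=0}^\infty\varrho^{-\ell}\|p_\ell(\mathbf{A})\mathbf{b}\|_2<\infty$. Then there exist numbers $\varepsilon_{m,\ell}$ with $|\varepsilon_{m,\ell}|\le\|\rho_m\|_\infty$ and a constant $C>0$ such that, in any norm $\|\cdot\|$ on $\mathbb{C}^n$, for all $k$, \[ \left\|f(\mathbf{A})\mathbf{b}-f_{k,m}(\mathbf{A})\mathbf{b}+\sum_{\ell=0}^{k-1}\varepsilon_{m,\ell}\,p_\ell(\mathbf{A})\mathbf{b}\right\|\le CM\sum_{\ell=k}^\infty\varrho^{-\ell}\|p_\ell(\mathbf{A})\mathbf{b}\|. \]
   Context: $f(\mathbf{A})\mathbf{b}=\frac{1}{2\pi i}\int_\Gamma f(z)(z\mathbf{I}-\mathbf{A})^{-1}\mathbf{b}\,dz$ is the usual matrix function. For $z\notin\Sigma$, $\mathcal{C}_\Sigma[p_\ell w](z)=\frac{1}{2\pi i}\int_\Sigma\frac{p_\ell(s)w(s)}{s-z}ds$. $\mathfrak{g}$ is the exterior Green's function of $\Sigma$ with pole at infinity: $\operatorname{Re}\mathfrak{g}$ is harmonic on $\mathbb{C}\setminus\Sigma$, continuous, zero on $\Sigma$, and $\operatorname{Re}\mathfrak{g}(z)=\log|z|+O(1)$ as $z\to\infty$. *)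

theory Defs
  imports "HOL-Complex_Analysis.Complex_Analysis" "HOL-Computational_Algebra.Polynomial"
begin

definition harmonic_on :: "(complex \<Rightarrow> real) \<Rightarrow> complex set \<Rightarrow> bool" where
  "harmonic_on u S \<longleftrightarrow> (\<forall>z\<in>S. \<exists>r>0. \<exists>F. F holomorphic_on ball z r \<and>
      (\<forall>w\<in>ball z r. u w = Re (F w)))"

text \<open>Real part of the exterior Green's function of the compact set K with pole at infinity.\<close>
definition is_green_function :: "complex set \<Rightarrow> (complex \<Rightarrow> real) \<Rightarrow> bool" where
  "is_green_function K G \<longleftrightarrow> harmonic_on G (- K) \<and> continuous_on UNIV G \<and>
      (\<forall>z\<in>K. G z = 0) \<and>
      (\<exists>B R. \<forall>z. R \<le> norm z \<longrightarrow> \<bar>G z - ln (norm z)\<bar> \<le> B)"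

primrec mat_pow :: "complex^'n^'n \<Rightarrow> nat \<Rightarrow> complex^'n^'n" where
  "mat_pow A 0 = mat 1"
| "mat_pow A (Suc k) = A ** mat_pow A k"

definition poly_mat :: "real poly \<Rightarrow> complex^'n^'n \<Rightarrow> complex^'n^'n" where
  "poly_mat p A = (\<Sum>i\<le>degree p. mat (complex_of_real (coeff p i)) ** mat_pow A i)"

definition mat_spectrum :: "complex^'n^'n \<Rightarrow> complex set" where
  "mat_spectrum A = {c. \<not> invertible (mat c - A)}"

text \<open>A contour given as a finite family of closed paths (the interior of a Green level
  curve may be disconnected, so the contour may consist of several closed curves).\<close>
definition contour_int :: "(real \<Rightarrow> complex) list \<Rightarrow> (complex \<Rightarrow> complex) \<Rightarrow> complex" where
  "contour_int gs f = (\<Sum>\<gamma>\<leftarrow>gs. contour_integral \<gamma> f)"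

definition contour_image :: "(real \<Rightarrow> complex) list \<Rightarrow> complex set" where
  "contour_image gs = (\<Union>\<gamma>\<in>set gs. path_image \<gamma>)"

definition contour_winding :: "(real \<Rightarrow> complex) list \<Rightarrow> complex \<Rightarrow> complex" where
  "contour_winding gs z = (\<Sum>\<gamma>\<leftarrow>gs. winding_number \<gamma> z)"

definition matfun_apply :: "(real \<Rightarrow> complex) list \<Rightarrow> (complex \<Rightarrow> complex) \<Rightarrow>
    complex^'n^'n \<Rightarrow> complex^'n \<Rightarrow> complex^'n" where
  "matfun_apply gs f A b = (\<chi> i. (1 / (2 * pi * \<i>)) *
      contour_int gs (\<lambda>z. f z * ((matrix_inv (mat z - A) *v b) $ i)))"

definition cauchy_transform :: "real set \<Rightarrow> (real \<Rightarrow> real) \<Rightarrow> complex \<Rightarrow> complex" where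
  "cauchy_transform S q z = (1 / (2 * pi * \<i>)) *
      integral S (\<lambda>s. complex_of_real (q s) / (complex_of_real s - z))"

definition is_norm_on :: "('a::real_vector \<Rightarrow> real) \<Rightarrow> bool" where
  "is_norm_on N \<longleftrightarrow> (\<forall>x. 0 \<le> N x) \<and> (\<forall>x. N x = 0 \<longleftrightarrow> x = 0) \<and>
      (\<forall>x y. N (x + y) \<le> N x + N y)"

definition is_complex_norm :: "(complex^'n \<Rightarrow> real) \<Rightarrow> bool" where
  "is_complex_norm N \<longleftrightarrow> is_norm_on N \<and> (\<forall>c x. N (c *s x) = norm c * N x)"

end

(* Write f_l = \<integral> f p_l w and let Q_l(z) = \<integral> p_l(s) w(s) / (z - s) ds be the functions of the second kind.
   The quadrature only perturbs f_l by the l-th Fourier coefficient of \<rho>_m, so everything reduces to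
   f(A) b = \<Sum> f_l p_l(A) b together with the sharp estimate |f_l| \<le> C M \<varrho>^(-l).

   The estimate has two ingredients. First, |Q_l| \<le> C e^(-l Re g) uniformly in l away from \<Sigma>:
   multiplied by the polynomial vanishing at the b_j, each Cauchy integral of a positive density
   on [a_j, b_j] omits a half-line, so (as in Kolmogorov's theorem) the fourth root of its modulus
   has a harmonic majorant up to \<Sigma>, and since Q_l = O(z^(-l-1)) the maximum principle in
   {Re g > \<delta>}, \<delta> of order 1/l, applies. Second, f_l is expressed through f Q_l on a thin layer just
   inside \<Gamma>_\<varrho> by an area form of Cauchy's formula; the total variation of the cutoffs stays
   bounded as the layer shrinks, even at critical points of the Green's function, because the
   unit gradient field has locally integrable divergence.

   The expansion of f(A) b follows by peeling off spectral values c one at a time: both sides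
   turn f = f(c) + (x - c) h into f(c) b plus the same expression for h and (A - c) b. *)
theory Submission
  imports Defs "HOL-Computational_Algebra.Fundamental_Theorem_Algebra"
begin

section \<open>The maximum principle via touching minorants\<close>

text \<open>The rate rho^(-l), with no loss in l, forces this shape. Near the intervals Q_l has no
  bound uniform in l, since the density p_l w is controlled only in L1; a harmonic majorant built
  from its mass replaces a boundary estimate. The exponent must be below 1/2: such a power of a
  function omitting a half-line stays in a sector strictly inside the right half-plane, where
  modulus and real part are comparable, and 1/4 is reached by two principal square roots. Near the
  outer level f has no boundary values, and the level set may cross itself at critical points of G,
  so an integral over it is replaced by an average over the levels between t - 2s and t - s. Moving
  by d in G costs a factor exp(l d); hence both the excluded neighbourhood of the intervals and the
  layer have width of order 1/l and cost bounded factors. Only the summability assumption controls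
  p_l(A) b; it also kills the Christoffel-Darboux boundary terms that appear when a spectral value
  is peeled off.\<close>

definition harmonic_minorant_at :: "(complex \<Rightarrow> real) \<Rightarrow> complex \<Rightarrow> bool" where
  "harmonic_minorant_at W z \<longleftrightarrow> (\<exists>r>0. \<exists>F. F holomorphic_on ball z r \<and> Re (F z) = W z \<and>
      (\<forall>x\<in>ball z r. Re (F x) \<le> W x))"

text \<open>At a local maximum Re F <= W <= W z = Re (F z), so the modulus of exp F peaks at z and
  exp F is constant; W is then squeezed between two equal bounds.\<close>

lemma harmonic_minorant_at_max:
  assumes "harmonic_minorant_at W z" and "open X" "z \<in> X" and "\<And>x. x \<in> X \<Longrightarrow> W x \<le> W z"
  shows "\<exists>r>0. \<forall>x\<in>ball z r. W x = W z"
proof -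
  obtain r F where r: "r > 0" "F holomorphic_on ball z r" "Re (F z) = W z"
    "\<And>x. x \<in> ball z r \<Longrightarrow> Re (F x) \<le> W x"
    using assms(1) unfolding harmonic_minorant_at_def by blast
  obtain e where e: "e > 0" "ball z e \<subseteq> X"
    using assms(2,3) open_contains_ball by blast
  define d where "d = min r e"
  have d: "d > 0" "ball z d \<subseteq> X" "ball z d \<subseteq> ball z r"
    using r(1) e unfolding d_def by auto
  have "(\<lambda>x. exp (F x)) constant_on ball z d"
  proof (rule maximum_modulus_principle[where U = "ball z d" and \<xi> = z])
    show "(\<lambda>x. exp (F x)) holomorphic_on ball z d"
      using holomorphic_on_subset[OF r(2) d(3)] by (intro holomorphic_intros)
    show "cmod (exp (F x)) \<le> cmod (exp (F z))" if "x \<in> ball z d" for x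
    proof -
      have "x \<in> ball z r" "x \<in> X" using that d by blast+
      then show ?thesis using r(3) r(4)[of x] assms(4)[of x] by simp
    qed
  qed (use d in auto)
  then obtain c where c: "\<And>x. x \<in> ball z d \<Longrightarrow> exp (F x) = c"
    unfolding constant_on_def by blast
  have "W x = W z" if x: "x \<in> ball z d" for x
  proof -
    have "exp (F x) = exp (F z)" using c x d(1) by simp
    then have "exp (Re (F x)) = exp (Re (F z))"
      by (metis norm_exp_eq_Re)
    then have "Re (F x) = Re (F z)" by simp
    moreover have "Re (F x) \<le> W x" "W x \<le> W z" using r(4) d x assms(4) by auto
    ultimately show ?thesis using r(3) by linarith
  qed
  then show ?thesis using d(1) by blast
qed

text \<open>The points where the maximum is attained form a closed set, open by the touching
  minorants, hence empty or the whole plane. Touching is asked only above the level c because the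
  functions compared later have no holomorphic branch at their zeros, where they lie below
  c.\<close>

lemma maximum_principle_minorant:
  assumes X: "open X" "bounded X" and W: "continuous_on (closure X) W"
    and fr: "\<And>z. z \<in> frontier X \<Longrightarrow> W z \<le> c"
    and touch: "\<And>z. z \<in> X \<Longrightarrow> W z > c \<Longrightarrow> harmonic_minorant_at W z"
    and z: "z \<in> X"
  shows "W z \<le> c"
proof (rule ccontr)
  assume "\<not> W z \<le> c"
  have comp: "compact (closure X)" using X(2) by simp
  have "closure X \<noteq> {}" using z by auto
  then obtain y where y: "y \<in> closure X" "\<And>x. x \<in> closure X \<Longrightarrow> W x \<le> W y"
    using continuous_attains_sup[OF comp _ W] by blast
  have Wy: "W y > c" using y(2)[of z] z \<open>\<not> W z \<le> c\<close> closure_subset[of X] by auto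
  define K where "K = {x \<in> closure X. W x = W y}"
  have KX: "K \<subseteq> X"
    using fr Wy X(1) interior_open[OF X(1)] unfolding K_def frontier_def by force
  have "closed K"
    unfolding K_def using continuous_closed_preimage_constant[OF W] comp compact_imp_closed by blast
  moreover have "open K"
    unfolding open_contains_ball
  proof
    fix x assume x: "x \<in> K"
    then have "harmonic_minorant_at W x"
      using touch[of x] KX Wy unfolding K_def by auto
    moreover have "W x' \<le> W x" if "x' \<in> X" for x'
      using x y(2)[of x'] that closure_subset[of X] unfolding K_def by auto
    ultimately obtain r where r: "r > 0" "\<forall>x'\<in>ball x r. W x' = W x"
      using harmonic_minorant_at_max[of W x X] X(1) KX x by blast
    obtain e where e: "e > 0" "ball x e \<subseteq> X"
      using X(1) KX x open_contains_ball by blast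
    have "ball x (min r e) \<subseteq> K"
    proof
      fix y' assume "y' \<in> ball x (min r e)"
      then have "y' \<in> X" "W y' = W x" using e(2) r(2) by (auto simp: subset_eq)
      then show "y' \<in> K" using x closure_subset[of X] unfolding K_def by auto
    qed
    then show "\<exists>e>0. ball x e \<subseteq> K" using r e by (intro exI[of _ "min r e"]) auto
  qed
  ultimately have "K = {} \<or> K = UNIV" using clopen by blast
  moreover have "y \<in> K" using y unfolding K_def by simp
  moreover have "bounded K" using KX X(2) bounded_subset by blast
  ultimately show False using not_bounded_UNIV[where 'a=complex] by auto
qed

lemma harmonic_minorant_at_harmonic:
  assumes "harmonic_on G X" "z \<in> X"
  shows "harmonic_minorant_at G z"
  using assms unfolding harmonic_on_def harmonic_minorant_at_def by (metis centre_in_ball order_refl)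

lemma fourth_root_norm: "norm (csqrt (csqrt x)) = sqrt (sqrt (norm x))"
  by (simp add: norm_csqrt)

text \<open>Away from its zeros the fourth root of the modulus of a holomorphic function is the modulus
  of a local holomorphic branch, whose suitably rotated real part touches it from below.\<close>
lemma harmonic_minorant_at_fourth_root:
  assumes f: "f holomorphic_on ball z r" "r > 0" "f z \<noteq> 0"
    and F: "F holomorphic_on ball z r"
    and W: "\<And>x. x \<in> ball z r \<Longrightarrow> W x = sqrt (sqrt (norm (f x))) - Re (F x)"
  shows "harmonic_minorant_at W z"
proof -
  have "continuous_on (ball z r) f" using f(1) holomorphic_on_imp_continuous_on by blast
  then have "isCont f z" using f(2) by (simp add: continuous_on_eq_continuous_at)
  then have "((\<lambda>x. f x / f z) \<longlongrightarrow> f z / f z) (at z)"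
    using f(3) by (intro tendsto_intros) (auto simp: isCont_def)
  then have "isCont (\<lambda>x. f x / f z) z" by (simp add: isCont_def)
  then obtain e where e: "e > 0" "\<And>x. dist x z < e \<Longrightarrow> dist (f x / f z) (f z / f z) < 1"
    unfolding continuous_at_eps_delta by (metis zero_less_one)
  define d where "d = min r e"
  have d: "d > 0" "ball z d \<subseteq> ball z r" using f(2) e unfolding d_def by auto
  define q where "q x = f x / f z" for x
  have Req: "Re (q x) > 0" if "x \<in> ball z d" for x
  proof -
    have "norm (1 - q x) < 1" using e(2)[of x] that f(3) unfolding q_def d_def
      by (simp add: dist_commute dist_norm)
    then show ?thesis using abs_Re_le_cmod[of "1 - q x"] by auto
  qed
  have nn: "w \<notin> \<real>\<^sub>\<le>\<^sub>0" if "Re w > 0" for w using that by (auto simp: complex_nonpos_Reals_iff)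
  have Recs: "Re (csqrt (q x)) > 0" if "x \<in> ball z d" for x
    using Req[OF that] complex_Re_le_cmod[of "q x"] by simp
  have "q holomorphic_on ball z d"
    unfolding q_def using holomorphic_on_subset[OF f(1) d(2)] f(3) by (intro holomorphic_intros) auto
  then have hol: "(\<lambda>x. csqrt (csqrt (q x))) holomorphic_on ball z d"
    using nn Req Recs by (intro holomorphic_intros) (auto, force)
  \<comment> \<open>Dividing by \<open>f z\<close> puts q near 1, where both principal roots are
    holomorphic; k restores the size, so that the minorant meets W at z.\<close>
  define k where "k = sqrt (sqrt (norm (f z)))"
  define P where "P x = of_real k * csqrt (csqrt (q x)) - F x" for x
  have "P holomorphic_on ball z d"
    unfolding P_def
    by (intro holomorphic_on_diff holomorphic_on_mult holomorphic_on_const hol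
        holomorphic_on_subset[OF F d(2)])
  moreover have "Re (P z) = W z"
    using W[of z] f(2,3) unfolding P_def k_def q_def by simp
  moreover have "Re (P x) \<le> W x" if x: "x \<in> ball z d" for x
  proof -
    have "k * norm (csqrt (csqrt (q x))) = sqrt (sqrt (norm (f x)))"
      unfolding k_def q_def fourth_root_norm norm_divide using f(3)
      by (simp add: real_sqrt_divide)
    moreover have "k \<ge> 0" unfolding k_def by simp
    ultimately have "k * Re (csqrt (csqrt (q x))) \<le> sqrt (sqrt (norm (f x)))"
      using complex_Re_le_cmod[of "csqrt (csqrt (q x))"] mult_left_mono by metis
    then show ?thesis using W[of x] x d(2) unfolding P_def by auto
  qed
  ultimately show ?thesis unfolding harmonic_minorant_at_def using d(1) by blast
qed

section \<open>Sublevel sets of the Green's function\<close>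

locale green_function =
  fixes K :: "complex set" and G :: "complex \<Rightarrow> real"
  assumes compact_K: "compact K" and K_nonempty: "K \<noteq> {}"
    and green: "is_green_function K G"
begin

lemma harmonic: "harmonic_on G (- K)" and continuous: "continuous_on UNIV G"
  and zero: "z \<in> K \<Longrightarrow> G z = 0"
  using green unfolding is_green_function_def by auto

lemma continuous_on: "continuous_on X G"
  using continuous continuous_on_subset by blast

lemma pos_notin: "G z > 0 \<Longrightarrow> z \<notin> K"
  using zero by force

lemma growth: obtains B R where "R \<ge> 1" "B \<ge> 0" "\<And>z. R \<le> norm z \<Longrightarrow> \<bar>G z - ln (norm z)\<bar> \<le> B"
proof -
  obtain B R where *: "\<And>z. R \<le> norm z \<Longrightarrow> \<bar>G z - ln (norm z)\<bar> \<le> B"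
    using green unfolding is_green_function_def by blast
  show ?thesis
  proof (rule that[of "max R 1" "max B 0"])
    show "\<bar>G z - ln (norm z)\<bar> \<le> max B 0" if "max R 1 \<le> norm z" for z
      using *[of z] that by linarith
  qed auto
qed

lemma local_holomorphic:
  assumes "z \<notin> K"
  obtains r F where "r > 0" "ball z r \<subseteq> - K" "F holomorphic_on ball z r"
    "\<And>w. w \<in> ball z r \<Longrightarrow> G w = Re (F w)"
proof -
  obtain r F where r: "r > 0" "F holomorphic_on ball z r" "\<forall>w\<in>ball z r. G w = Re (F w)"
    using harmonic assms unfolding harmonic_on_def by blast
  have "open (- K)" using compact_K compact_imp_closed by blast
  then obtain e where e: "e > 0" "ball z e \<subseteq> - K" using assms open_contains_ball by blast
  show ?thesis
  proof (rule that[of "min r e" F])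
    have sub: "ball z (min r e) \<subseteq> ball z r" "ball z (min r e) \<subseteq> ball z e" by auto
    show "F holomorphic_on ball z (min r e)" using holomorphic_on_subset[OF r(2) sub(1)] .
    show "ball z (min r e) \<subseteq> - K" using sub(2) e(2) by blast
    show "G w = Re (F w)" if "w \<in> ball z (min r e)" for w using r(3) sub(1) that by blast
  qed (use r(1) e(1) in simp)
qed

lemma bounded_sublevel: "bounded {z. G z \<le> t}"
proof -
  obtain B R where BR: "R \<ge> 1" "B \<ge> 0" "\<And>z. R \<le> norm z \<Longrightarrow> \<bar>G z - ln (norm z)\<bar> \<le> B"
    by (rule growth) blast
  have "norm z \<le> max R (exp (t + B))" if "G z \<le> t" for z
  proof (cases "R \<le> norm z")
    case True
    then have "ln (norm z) \<le> t + B" using BR(3)[OF True] that by linarith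
    moreover have "norm z > 0" using True BR(1) by linarith
    ultimately have "norm z \<le> exp (t + B)" by (metis exp_le_cancel_iff exp_ln)
    then show ?thesis by simp
  qed auto
  then show ?thesis by (intro boundedI[of _ "max R (exp (t + B))"]) blast
qed

lemma closed_level: "closed {z. s \<le> G z \<and> G z \<le> t}" "closed {z. G z \<le> t}"
  by (intro closed_Collect_conj closed_Collect_le continuous_intros continuous)+

lemma compact_level: "compact {z. s \<le> G z \<and> G z \<le> t}"
  unfolding compact_eq_bounded_closed
  by (intro conjI closed_level bounded_subset[OF bounded_sublevel[of t]]) auto

lemma open_sublevel: "open {z. G z < t}" "open {z. t < G z}"
  by (intro open_Collect_less continuous_intros continuous)+

text \<open>By the maximum principle the complement of a sublevel set has no bounded part, so a loop in
  a sublevel set cannot wind around any of its points.\<close>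
lemma winding_number_sublevel:
  assumes t: "t > 0" and \<gamma>: "valid_path \<gamma>" "pathfinish \<gamma> = pathstart \<gamma>"
    and sub: "path_image \<gamma> \<subseteq> {z. G z < t}" and u: "G u \<ge> t"
  shows "winding_number \<gamma> u = 0"
proof -
  let ?P = "path_image \<gamma>"
  have P: "compact ?P" "?P \<noteq> {}" using compact_valid_path_image[OF \<gamma>(1)] by auto
  have uP: "u \<notin> ?P" using sub u by auto
  obtain y where y: "y \<in> ?P" "\<And>x. x \<in> ?P \<Longrightarrow> G x \<le> G y"
    using continuous_attains_sup[OF P continuous_on] by metis
  \<comment> \<open>Including 0 makes every point with G > c lie outside K, where G is
    harmonic.\<close>
  define c where "c = max 0 (G y)"
  have c: "c < t" "c \<ge> 0" using y(1) sub t unfolding c_def by auto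
  have cP: "G x \<le> c" if "x \<in> ?P" for x using y(2)[OF that] unfolding c_def by simp
  define X where "X = connected_component_set (- ?P) u"
  have "open (- ?P)" using P(1) compact_imp_closed by blast
  then have X: "open X" "u \<in> X"
    unfolding X_def using uP by (auto simp: open_connected_component connected_component_refl_eq)
  have "frontier X \<subseteq> ?P"
    using frontier_of_connected_component_subset[of "- ?P" u] compact_imp_closed[OF P(1)]
    unfolding X_def by (metis frontier_complement frontier_subset_closed order_trans)
  have "\<not> bounded X"
  proof
    assume b: "bounded X"
    have "G u \<le> c"
    proof (rule maximum_principle_minorant[OF X(1) b continuous_on _ _ X(2)])
      show "G z \<le> c" if "z \<in> frontier X" for z using cP \<open>frontier X \<subseteq> ?P\<close> that by blast
      show "harmonic_minorant_at G z" if "G z > c" for z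
        using harmonic_minorant_at_harmonic[OF harmonic] pos_notin[of z] that c(2) by auto
    qed
    then show False using c(1) u by simp
  qed
  then have "u \<in> outside ?P" unfolding outside X_def by simp
  then show ?thesis using winding_number_zero_in_outside[of \<gamma> u] \<gamma> valid_path_imp_path by blast
qed

text \<open>The global Cauchy formula applies, even if the sublevel set is disconnected, because its
  loops have winding number zero about every point of the complement.\<close>

lemma Cauchy_formula_sublevel:
  assumes t: "t > 0" and \<gamma>: "valid_path \<gamma>" "pathfinish \<gamma> = pathstart \<gamma>"
    and sub: "path_image \<gamma> \<subseteq> {z. G z < t}"
    and f: "f holomorphic_on {z. G z < t}" and x: "G x < t" "x \<notin> path_image \<gamma>"
  shows "((\<lambda>w. f w / (w - x)) has_contour_integral (2 * pi * \<i> * winding_number \<gamma> x * f x)) \<gamma>"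
  using assms winding_number_sublevel[OF t \<gamma> sub] open_sublevel
  by (intro Cauchy_integral_formula_global[where S = "{z. G z < t}"]) auto

lemma Cauchy_theorem_sublevel:
  assumes t: "t > 0" and \<gamma>: "valid_path \<gamma>" "pathfinish \<gamma> = pathstart \<gamma>"
    and sub: "path_image \<gamma> \<subseteq> {z. G z < t}"
    and f: "f holomorphic_on {z. G z < t}"
  shows "(f has_contour_integral 0) \<gamma>"
  using assms winding_number_sublevel[OF t \<gamma> sub] open_sublevel
  by (intro Cauchy_theorem_global[where S = "{z. G z < t}"]) auto

end

section \<open>Wirtinger derivatives and cutoffs\<close>

text \<open>Realising area as the image of the product measure makes Fubini available on the complex
  plane; the two measures are identified on boxes.\<close>

lemma lborel_complex: "(lborel :: complex measure) = distr lborel borel (\<lambda>(x, y). Complex x y)"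
proof (rule lborel_eqI)
  have "continuous_on UNIV (\<lambda>(x, y). Complex x y)"
    by (auto simp: Complex_eq case_prod_unfold intro!: continuous_intros)
  then have meas: "(\<lambda>(x, y). Complex x y) \<in> measurable lborel borel"
    using borel_measurable_continuous_onI by simp
  fix l u :: complex assume lu: "\<And>b. b \<in> Basis \<Longrightarrow> l \<bullet> b \<le> u \<bullet> b"
  have "(\<lambda>(x, y). Complex x y) -` box l u = box (Re l, Im l) (Re u, Im u)"
    by (auto simp: mem_box Basis_complex_def Basis_prod_def inner_complex_def)
  then have "emeasure (distr lborel borel (\<lambda>(x, y). Complex x y)) (box l u)
      = emeasure lborel (box (Re l, Im l) (Re u, Im u))"
    using meas by (subst emeasure_distr) auto
  also have "\<dots> = (\<Prod>b\<in>Basis. (u - l) \<bullet> b)"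
    using lu[of 1] lu[of \<i>]
    by (subst emeasure_lborel_box)
      (auto simp: Basis_complex_def Basis_prod_def inner_complex_def prod.insert
        card_insert_if prod.union_disjoint)
  finally show "emeasure (distr lborel borel (\<lambda>(x, y). Complex x y)) (box l u)
      = (\<Prod>b\<in>Basis. (u - l) \<bullet> b)" .
qed auto

lemma integrable_compact_support:
  fixes q :: "'a::euclidean_space \<Rightarrow> 'b::{banach, second_countable_topology}"
  assumes "continuous_on UNIV q" "\<And>z. norm z > R \<Longrightarrow> q z = 0"
  shows "integrable lborel q"
proof -
  have "integrable lborel (\<lambda>z. indicator (cball 0 R) z *\<^sub>R q z)"
    by (intro borel_integrable_compact) (auto intro: continuous_on_subset[OF assms(1)])
  also have "(\<lambda>z. indicator (cball 0 R) z *\<^sub>R q z) = q"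
    using assms(2) by (force simp: indicator_def)
  finally show ?thesis .
qed

lemma integral_line_derivative_eq_0:
  fixes h :: "real \<Rightarrow> complex"
  assumes "\<And>x. (h has_vector_derivative h' x) (at x)" "continuous_on UNIV h'"
    "\<And>x. \<bar>x\<bar> > R \<Longrightarrow> h x = 0" "\<And>x. \<bar>x\<bar> > R \<Longrightarrow> h' x = 0"
  shows "integral\<^sup>L lborel h' = 0"
proof -
  define r where "r = \<bar>R\<bar> + 1"
  have "(\<integral>x. indicator {-r..r} x *\<^sub>R h' x \<partial>lborel) = h r - h (-r)"
    using assms(1,2) unfolding r_def
    by (intro integral_FTC_Icc) (auto intro: has_vector_derivative_at_within continuous_on_subset)
  also have "(\<lambda>x. indicator {-r..r} x *\<^sub>R h' x) = h'"
    using assms(4) unfolding r_def by (force simp: indicator_def)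
  finally show ?thesis using assms(3)[of r] assms(3)[of "-r"] unfolding r_def by simp
qed

text \<open>Here \<open>p\<close> and \<open>q\<close> are the Wirtinger derivatives of \<open>h\<close> with respect to
  \<open>z\<close> and to its conjugate.\<close>
definition has_wirtinger :: "(complex \<Rightarrow> complex) \<Rightarrow> complex \<Rightarrow> complex \<Rightarrow> complex \<Rightarrow> bool" where
  "has_wirtinger h p q z \<longleftrightarrow> (h has_derivative (\<lambda>d. p * d + q * cnj d)) (at z)"

text \<open>Stokes without boundary: along horizontal lines the derivative of h is p + q, along
  vertical lines it is \<open>\<i> * (p - q)\<close>. Both integrate to zero by Fubini, and the two
  relations together annihilate the integral of q.\<close>

theorem integral_dbar_eq_0:
  assumes h: "\<And>z. has_wirtinger h (p z) (q z) z"
    and cont: "continuous_on UNIV p" "continuous_on UNIV q"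
    and supp: "\<And>z. norm z > R \<Longrightarrow> h z = 0" "\<And>z. norm z > R \<Longrightarrow> p z = 0" "\<And>z. norm z > R \<Longrightarrow> q z = 0"
  shows "integral\<^sup>L lborel q = 0"
proof -
  have iz: "norm (Complex x y) > R" if "\<bar>x\<bar> > R \<or> \<bar>y\<bar> > R" for x y
    using that abs_Re_le_cmod[of "Complex x y"] abs_Im_le_cmod[of "Complex x y"] by auto
  have cC: "continuous_on UNIV (\<lambda>(x, y). Complex x y)"
    by (auto simp: Complex_eq case_prod_unfold intro!: continuous_intros)
  have cx: "continuous_on UNIV (\<lambda>x. Complex x y)" and cy: "continuous_on UNIV (\<lambda>x. Complex y x)" for y
    by (auto simp: Complex_eq intro!: continuous_intros)
  have meas: "(\<lambda>(x, y). Complex x y) \<in> measurable lborel borel"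
    using borel_measurable_continuous_onI[OF cC] by simp
  have red: "integral\<^sup>L lborel s = integral\<^sup>L (lborel \<Otimes>\<^sub>M lborel) (\<lambda>(x, y). s (Complex x y))"
    if "continuous_on UNIV s" for s :: "complex \<Rightarrow> complex"
  proof -
    have "s \<in> borel_measurable borel" using that by (rule borel_measurable_continuous_onI)
    then show ?thesis unfolding lborel_complex lborel_prod
      by (subst integral_distr[OF meas]) (auto simp: case_prod_unfold)
  qed
  have int: "integrable (lborel \<Otimes>\<^sub>M lborel) (\<lambda>(x, y). s (Complex x y))"
    if s: "continuous_on UNIV s" "\<And>z. norm z > R \<Longrightarrow> s z = 0" for s :: "complex \<Rightarrow> complex"
  proof -
    have "integrable lborel s" using s by (rule integrable_compact_support)
    moreover have "s \<in> borel_measurable borel" using s(1) by (rule borel_measurable_continuous_onI)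
    ultimately show ?thesis unfolding lborel_complex lborel_prod
      by (subst (asm) integrable_distr_eq[OF meas]) (auto simp: case_prod_unfold)
  qed
  have 1: "integral\<^sup>L lborel (\<lambda>z. p z + q z) = 0"
  proof -
    have "(\<integral>x. p (Complex x y) + q (Complex x y) \<partial>lborel) = 0" for y
    proof (rule integral_line_derivative_eq_0[where h = "\<lambda>x. h (Complex x y)" and R = R])
      show "((\<lambda>x. h (Complex x y)) has_vector_derivative p (Complex x y) + q (Complex x y)) (at x)" for x
      proof -
        have "((\<lambda>x. Complex x y) has_derivative of_real) (at x)"
          by (auto simp: Complex_eq intro!: derivative_eq_intros)
        then have "((\<lambda>x. h (Complex x y)) has_derivative
            (\<lambda>d. p (Complex x y) * of_real d + q (Complex x y) * cnj (of_real d))) (at x)"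
          using h[of "Complex x y"] unfolding has_wirtinger_def
          by (rule has_derivative_compose)
        then show ?thesis unfolding has_vector_derivative_def
          by (simp add: scaleR_conv_of_real algebra_simps)
      qed
      show "continuous_on UNIV (\<lambda>x. p (Complex x y) + q (Complex x y))"
        by (intro continuous_intros continuous_on_compose2[OF cont(1) cx]
            continuous_on_compose2[OF cont(2) cx]) auto
    qed (use iz supp in auto)
    then show ?thesis
      using red[of "\<lambda>z. p z + q z"] int[of "\<lambda>z. p z + q z"] cont supp
        lborel_pair.integral_snd[of "\<lambda>x y. p (Complex x y) + q (Complex x y)"]
      by (auto simp: continuous_on_add)
  qed
  have 2: "integral\<^sup>L lborel (\<lambda>z. \<i> * (p z - q z)) = 0"
  proof -
    have "(\<integral>y. \<i> * (p (Complex x y) - q (Complex x y)) \<partial>lborel) = 0" for x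
    proof (rule integral_line_derivative_eq_0[where h = "\<lambda>y. h (Complex x y)" and R = R])
      show "((\<lambda>y. h (Complex x y)) has_vector_derivative \<i> * (p (Complex x y) - q (Complex x y))) (at y)" for y
      proof -
        have "((\<lambda>y. Complex x y) has_derivative (\<lambda>d. \<i> * of_real d)) (at y)"
          by (auto simp: Complex_eq intro!: derivative_eq_intros)
        then have "((\<lambda>y. h (Complex x y)) has_derivative
            (\<lambda>d. p (Complex x y) * (\<i> * of_real d) + q (Complex x y) * cnj (\<i> * of_real d))) (at y)"
          using h[of "Complex x y"] unfolding has_wirtinger_def
          by (rule has_derivative_compose)
        then show ?thesis unfolding has_vector_derivative_def
          by (simp add: scaleR_conv_of_real algebra_simps)
      qed
      show "continuous_on UNIV (\<lambda>y. \<i> * (p (Complex x y) - q (Complex x y)))"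
        by (intro continuous_intros continuous_on_compose2[OF cont(1) cy]
            continuous_on_compose2[OF cont(2) cy]) auto
    qed (use iz supp in auto)
    then show ?thesis
      using red[of "\<lambda>z. \<i> * (p z - q z)"] int[of "\<lambda>z. \<i> * (p z - q z)"] cont supp
        lborel_pair.integral_fst[of "\<lambda>x y. \<i> * (p (Complex x y) - q (Complex x y))"]
      by (auto simp: continuous_on_diff continuous_on_mult)
  qed
  have ip: "integrable lborel p" and iq: "integrable lborel q"
    using cont supp by (auto intro!: integrable_compact_support)
  have "integral\<^sup>L lborel p + integral\<^sup>L lborel q = 0" using 1 ip iq by simp
  moreover have "\<i> * (integral\<^sup>L lborel p - integral\<^sup>L lborel q) = 0" using 2 ip iq by simp
  ultimately show ?thesis by (simp add: complex_eq_iff)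
qed

section \<open>Calculus of Wirtinger derivatives\<close>

lemma has_wirtinger_holomorphic:
  "(f has_field_derivative f') (at z) \<Longrightarrow> has_wirtinger f f' 0 z"
  unfolding has_wirtinger_def has_field_derivative_def by simp

lemma has_wirtinger_mult:
  assumes "has_wirtinger f p q z" "has_wirtinger g r s z"
  shows "has_wirtinger (\<lambda>z. f z * g z) (p * g z + f z * r) (q * g z + f z * s) z"
  using has_derivative_mult[OF assms[unfolded has_wirtinger_def]] unfolding has_wirtinger_def
  by (rule has_derivative_eq_rhs) (auto simp: algebra_simps)

lemma has_wirtinger_diff:
  assumes "has_wirtinger f p q z" "has_wirtinger g r s z"
  shows "has_wirtinger (\<lambda>z. f z - g z) (p - r) (q - s) z"
  using has_derivative_diff[OF assms[unfolded has_wirtinger_def]] unfolding has_wirtinger_def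
  by (rule has_derivative_eq_rhs) (auto simp: algebra_simps)

text \<open>\<open>e\<close> is twice the z-derivative of the real function u and
  \<open>cnj e\<close> twice the derivative in the conjugate variable, whence the halves.\<close>

lemma has_wirtinger_real:
  assumes u: "(u has_derivative (\<lambda>d. Re (e * d))) (at z)"
    and k: "(k has_real_derivative k') (at (u z))"
  shows "has_wirtinger (\<lambda>z. of_real (k (u z))) (of_real k' * e / 2) (of_real k' * cnj e / 2) z"
proof -
  have "((\<lambda>z. k (u z)) has_derivative (\<lambda>d. k' * Re (e * d))) (at z)"
    using has_derivative_compose[OF u k[unfolded has_field_derivative_def]] .
  then have "((\<lambda>z. complex_of_real (k (u z))) has_derivative (\<lambda>d. of_real (k' * Re (e * d)))) (at z)"
    by (rule has_derivative_of_real)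
  then show ?thesis unfolding has_wirtinger_def
    by (rule has_derivative_eq_rhs) (rule ext, simp add: complex_eq_iff field_simps)
qed

lemma has_wirtinger_transform:
  assumes "has_wirtinger f p q z" "open X" "z \<in> X" "\<And>x. x \<in> X \<Longrightarrow> g x = f x"
  shows "has_wirtinger g p q z"
  using assms unfolding has_wirtinger_def
  by (metis (no_types, lifting) has_derivative_transform_within_open)

lemma has_wirtinger_zero: "has_wirtinger (\<lambda>_. 0) 0 0 z"
  unfolding has_wirtinger_def by simp

lemma has_derivative_norm_square_holomorphic:
  assumes "(f has_field_derivative f') (at z)"
  shows "((\<lambda>z. (norm (f z))\<^sup>2) has_derivative (\<lambda>d. Re (2 * cnj (f z) * f' * d))) (at z)"
proof -
  have "(f has_derivative (\<lambda>d. f' * d)) (at z)" using assms unfolding has_field_derivative_def .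
  then show ?thesis unfolding power2_norm_eq_inner
    by (auto intro!: derivative_eq_intros simp: inner_complex_def algebra_simps)
qed

lemma has_derivative_Re_holomorphic:
  assumes "(f has_field_derivative f') (at z)"
  shows "((\<lambda>z. Re (f z)) has_derivative (\<lambda>d. Re (f' * d))) (at z)"
  using assms unfolding has_field_derivative_def by (rule has_derivative_Re)

text \<open>The squares make this transition from \<open>0\<close> to \<open>1\<close> continuously differentiable.\<close>
definition step :: "real \<Rightarrow> real" where
  "step t = (max 0 t)\<^sup>2 / ((max 0 t)\<^sup>2 + (max 0 (1 - t))\<^sup>2)"

definition dstep :: "real \<Rightarrow> real" where
  "dstep t = (2 * max 0 t * (max 0 (1 - t))\<^sup>2 + (max 0 t)\<^sup>2 * (2 * max 0 (1 - t)))
     / ((max 0 t)\<^sup>2 + (max 0 (1 - t))\<^sup>2)\<^sup>2"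

lemma step_denominator_pos: "(max 0 t)\<^sup>2 + (max 0 (1 - t))\<^sup>2 > (0::real)"
  by (cases "t > 0") (auto simp: add_pos_nonneg)

lemma step_simps: "t \<le> 0 \<Longrightarrow> step t = 0" "t \<ge> 1 \<Longrightarrow> step t = 1" "step t \<ge> 0" "step t \<le> 1"
  "t \<le> 0 \<Longrightarrow> dstep t = 0" "t \<ge> 1 \<Longrightarrow> dstep t = 0" "dstep t \<ge> 0"
  using step_denominator_pos[of t] unfolding step_def dstep_def by (auto simp: max_def divide_simps)

lemma dstep_pos: "0 < t \<Longrightarrow> t < 1 \<Longrightarrow> dstep t > 0"
  using step_denominator_pos[of t] unfolding dstep_def
  by (intro divide_pos_pos add_pos_pos mult_pos_pos) (auto simp: max_def)

lemma max0_square_derivative: "((\<lambda>t. (max 0 t)\<^sup>2) has_real_derivative 2 * max 0 t) (at (t::real))"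
proof -
  consider "t < 0" | "t > 0" | "t = 0" by linarith
  then show ?thesis
  proof cases
    case 1
    have "((\<lambda>t::real. 0) has_real_derivative 2 * max 0 t) (at t)" using 1 by simp
    then show ?thesis
      by (rule has_field_derivative_transform_within_open[where S = "{..<0}"]) (use 1 in auto)
  next
    case 2
    have "((\<lambda>t::real. t\<^sup>2) has_real_derivative 2 * max 0 t) (at t)"
      using 2 by (auto intro!: derivative_eq_intros)
    then show ?thesis
      by (rule has_field_derivative_transform_within_open[where S = "{0<..}"]) (use 2 in auto)
  next
    case 3
    have "(\<lambda>h::real. ((max 0 (0 + h))\<^sup>2 - (max 0 0)\<^sup>2) / h) \<midarrow>0\<rightarrow> 0"
    proof (rule Lim_null_comparison)
      show "\<forall>\<^sub>F h in at 0. norm (((max 0 (0 + h))\<^sup>2 - (max 0 0)\<^sup>2) / h) \<le> \<bar>h::real\<bar>"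
        by (intro always_eventually) (auto simp: max_def power2_eq_square)
      show "(\<lambda>h. \<bar>h::real\<bar>) \<midarrow>0\<rightarrow> 0" by (rule tendsto_rabs_zero) simp
    qed
    then show ?thesis using 3 unfolding DERIV_def by simp
  qed
qed

lemma step_derivative: "(step has_real_derivative dstep t) (at t)"
proof -
  have 1: "((\<lambda>t. (max 0 (1 - t))\<^sup>2) has_real_derivative - (2 * max 0 (1 - t))) (at t)"
    using DERIV_chain2[where f = "\<lambda>t. (max 0 t)\<^sup>2" and g = "\<lambda>t. 1 - t" and x = t and s = UNIV and Db = "-1",
        OF max0_square_derivative] DERIV_diff[OF DERIV_const DERIV_ident, of 1 t UNIV]
    by simp
  have "((\<lambda>t. (max 0 t)\<^sup>2 / ((max 0 t)\<^sup>2 + (max 0 (1 - t))\<^sup>2)) has_real_derivative dstep t) (at t)"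
    unfolding dstep_def
    by (rule derivative_eq_intros max0_square_derivative 1 refl)+
      (use step_denominator_pos[of t] in \<open>auto simp: power2_eq_square algebra_simps\<close>)
  then show ?thesis by (simp add: step_def[abs_def])
qed

lemma continuous_dstep: "continuous_on X dstep"
proof -
  have "continuous_on X (\<lambda>t. (2 * max 0 t * (max 0 (1 - t))\<^sup>2 + (max 0 t)\<^sup>2 * (2 * max 0 (1 - t)))
     / ((max 0 t)\<^sup>2 + (max 0 (1 - t))\<^sup>2)\<^sup>2)"
    by (intro continuous_intros ballI) (use step_denominator_pos in \<open>simp add: less_imp_neq[symmetric]\<close>)
  then show ?thesis by (simp add: dstep_def[abs_def])
qed

section \<open>Cauchy integrals\<close>

definition cauchy_int :: "(real \<Rightarrow> real) \<Rightarrow> complex \<Rightarrow> complex" where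
  "cauchy_int k z = (\<integral>x. of_real (k x) / (z - of_real x) \<partial>lborel)"

lemma closed_dist_lower_bound:
  assumes "closed S" "z \<notin> complex_of_real ` S"
  obtains d where "d > 0" "\<And>x. x \<in> S \<Longrightarrow> d \<le> norm (z - of_real x)"
proof (cases "Im z = 0")
  case True
  then have "Re z \<notin> S" using assms(2) by (metis complex_is_Real_iff image_eqI of_real_Re)
  then obtain d where d: "d > 0" "\<And>x. x \<in> S \<Longrightarrow> d \<le> dist (Re z) x"
    using separate_point_closed[OF assms(1)] by blast
  show ?thesis
  proof (rule that[OF d(1)])
    fix x assume "x \<in> S"
    then show "d \<le> norm (z - of_real x)"
      using d(2)[of x] abs_Re_le_cmod[of "z - of_real x"] by (simp add: dist_real_def)
  qed
next
  case False
  show ?thesis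
  proof (rule that[of "\<bar>Im z\<bar>"])
    show "\<bar>Im z\<bar> \<le> norm (z - of_real x)" for x using abs_Im_le_cmod[of "z - of_real x"] by simp
  qed (use False in auto)
qed

context
  fixes k :: "real \<Rightarrow> real" and S :: "real set"
  assumes k: "integrable lborel k" and supp: "\<And>x. x \<notin> S \<Longrightarrow> k x = 0"
begin

lemma kernel_bound:
  fixes z :: complex
  assumes "d > 0" "\<And>x. x \<in> S \<Longrightarrow> d \<le> norm (z - of_real x)"
  shows "norm (of_real (k x) / (z - of_real x)) \<le> \<bar>k x\<bar> / d"
proof (cases "x \<in> S")
  case True
  then have "0 < norm (z - of_real x)" using assms(1) assms(2)[of x] by linarith
  then show ?thesis using assms(1) assms(2)[OF True]
    by (auto simp: norm_divide intro!: divide_left_mono mult_pos_pos)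
qed (use supp in simp)

lemma cauchy_int_integrable:
  assumes "closed S" "z \<notin> complex_of_real ` S"
  shows "integrable lborel (\<lambda>x. of_real (k x) / (z - of_real x))"
proof -
  obtain d where d: "d > 0" "\<And>x. x \<in> S \<Longrightarrow> d \<le> norm (z - of_real x)"
    using closed_dist_lower_bound[OF assms] by metis
  have [measurable]: "k \<in> borel_measurable borel" using k by simp
  show ?thesis
  proof (rule Bochner_Integration.integrable_bound)
    show "integrable lborel (\<lambda>x. k x / d)" using k by simp
    show "AE x in lborel. norm (complex_of_real (k x) / (z - of_real x)) \<le> norm (k x / d)"
      using kernel_bound[OF d] d(1) by simp
  qed measurable
qed

lemma cauchy_int_norm_le:
  assumes "d > 0" "\<And>x. x \<in> S \<Longrightarrow> d \<le> norm (z - of_real x)"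
  shows "norm (cauchy_int k z) \<le> (\<integral>x. \<bar>k x\<bar> \<partial>lborel) / d"
proof -
  have "norm (cauchy_int k z) \<le> (\<integral>x. \<bar>k x\<bar> / d \<partial>lborel)"
    unfolding cauchy_int_def
  proof (rule order_trans[OF Bochner_Integration.integral_norm_bound integral_mono'])
    show "integrable lborel (\<lambda>x. \<bar>k x\<bar> / d)" using k by simp
  qed (use kernel_bound[OF assms] assms(1) in auto)
  then show ?thesis by simp
qed

text \<open>The difference quotient minus the candidate derivative is exactly y - z times one
  integral, which is at most the mass of k times 2 / d^3; the limit follows directly.\<close>

lemma cauchy_int_derivative:
  assumes S: "closed S" and z: "z \<notin> complex_of_real ` S"
  shows "\<exists>D. (cauchy_int k has_field_derivative D) (at z)"
proof -
  obtain d where d: "d > 0" "\<And>x. x \<in> S \<Longrightarrow> d \<le> norm (z - of_real x)"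
    using closed_dist_lower_bound[OF S z] by metis
  have [measurable]: "k \<in> borel_measurable borel" using k by simp
  let ?D = "\<integral>x. - (of_real (k x) / (z - of_real x)\<^sup>2) \<partial>lborel"
  let ?e = "\<lambda>y x. complex_of_real (k x) / ((y - of_real x) * (z - of_real x)\<^sup>2)"
  have iD: "integrable lborel (\<lambda>x. - (complex_of_real (k x) / (z - of_real x)\<^sup>2))"
  proof (rule Bochner_Integration.integrable_bound)
    show "integrable lborel (\<lambda>x. k x / d\<^sup>2)" using k by simp
    have "norm (complex_of_real (k x) / (z - of_real x)\<^sup>2) \<le> norm (k x / d\<^sup>2)" for x
    proof (cases "x \<in> S")
      case True
      have "d\<^sup>2 \<le> (norm (z - of_real x))\<^sup>2" using d True by (intro power_mono) auto
      then show ?thesis using d(1) by (auto simp: norm_divide norm_power intro!: divide_left_mono mult_pos_pos zero_less_power)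
    qed (use supp in simp)
    then show "AE x in lborel. norm (- (complex_of_real (k x) / (z - of_real x)\<^sup>2)) \<le> norm (k x / d\<^sup>2)"
      by simp
  qed measurable
  \<comment> \<open>Half of d is given up so that y may move; this is the source of the 2 in
    \<open>2 / d ^ 3\<close>.\<close>
  have dy: "d / 2 \<le> norm (y - of_real x)" if "x \<in> S" "norm (y - z) < d / 2" for x y
  proof -
    have "norm (z - of_real x) \<le> norm (y - of_real x) + norm (y - z)"
      using norm_triangle_ineq[of "y - of_real x" "z - y"] by (simp add: norm_minus_commute)
    then show ?thesis using d(2)[OF that(1)] that(2) by linarith
  qed
  have bound: "norm ((cauchy_int k y - cauchy_int k z) / (y - z) - ?D)
      \<le> norm (y - z) * ((\<integral>x. \<bar>k x\<bar> \<partial>lborel) * (2 / d ^ 3))"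
    if y: "y \<noteq> z" "norm (y - z) < d / 2" for y
  proof -
    have yS: "y \<notin> complex_of_real ` S" using dy[OF _ y(2)] d(1) by force
    have ne: "y - of_real x \<noteq> 0" "z - of_real x \<noteq> 0" if "x \<in> S" for x
      using that yS z by auto
    have pt: "(of_real (k x) / (y - of_real x) - of_real (k x) / (z - of_real x)) / (y - z)
        - (- (of_real (k x) / (z - of_real x)\<^sup>2)) = (y - z) * ?e y x" for x
    proof (cases "x \<in> S")
      case True
      have *: "(K / a - K / b) / (a - b) - (- (K / b\<^sup>2)) = (a - b) * (K / (a * b\<^sup>2))"
        if "a \<noteq> 0" "b \<noteq> 0" "a \<noteq> b" for a b K :: complex
        using that by (simp add: divide_simps power2_eq_square) (simp add: algebra_simps)
      show ?thesis
        using *[OF ne[OF True], of "of_real (k x)"] y(1) by simp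
    qed (use supp in simp)
    have "(cauchy_int k y - cauchy_int k z) / (y - z) - ?D = (\<integral>x. (y - z) * ?e y x \<partial>lborel)"
      unfolding cauchy_int_def pt[symmetric]
      using cauchy_int_integrable[OF S yS] cauchy_int_integrable[OF S z] iD by simp
    also have "norm \<dots> \<le> (\<integral>x. \<bar>k x\<bar> * (norm (y - z) * (2 / d ^ 3)) \<partial>lborel)"
    proof (rule Bochner_Integration.integral_norm_bound_integral)
      have *: "norm ((y - z) * ?e y x) \<le> \<bar>k x\<bar> * (norm (y - z) * (2 / d ^ 3))" for x
      proof (cases "x \<in> S")
        case True
        have "d / 2 * d\<^sup>2 \<le> norm (y - of_real x) * (norm (z - of_real x))\<^sup>2"
          using d(1) d(2)[OF True] dy[OF True y(2)] by (intro mult_mono power_mono) auto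
        then have "d ^ 3 / 2 \<le> norm (y - of_real x) * (norm (z - of_real x))\<^sup>2"
          by (simp add: power2_eq_square power3_eq_cube)
        then have "\<bar>k x\<bar> / (norm (y - of_real x) * (norm (z - of_real x))\<^sup>2) \<le> \<bar>k x\<bar> / (d ^ 3 / 2)"
          using d(1) ne[OF True] by (intro divide_left_mono) (auto intro!: mult_pos_pos)
        then have "norm (y - z) * (\<bar>k x\<bar> / (norm (y - of_real x) * (norm (z - of_real x))\<^sup>2))
            \<le> norm (y - z) * (\<bar>k x\<bar> / (d ^ 3 / 2))"
          by (rule mult_left_mono) simp
        then show ?thesis by (simp add: norm_mult norm_divide norm_power mult_ac)
      qed (use supp in simp)
      show "integrable lborel (\<lambda>x. \<bar>k x\<bar> * (norm (y - z) * (2 / d ^ 3)))" using k by simp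
      show "integrable lborel (\<lambda>x. (y - z) * ?e y x)"
        by (rule Bochner_Integration.integrable_bound[OF
              \<open>integrable lborel (\<lambda>x. \<bar>k x\<bar> * (norm (y - z) * (2 / d ^ 3)))\<close>])
          (measurable, use * d(1) in \<open>simp add: abs_mult\<close>)
      show "norm ((y - z) * ?e y x) \<le> \<bar>k x\<bar> * (norm (y - z) * (2 / d ^ 3))" for x by (rule *)
    qed
    finally show ?thesis by (simp add: mult_ac)
  qed
  have "((\<lambda>y. (cauchy_int k y - cauchy_int k z) / (y - z) - ?D) \<longlongrightarrow> 0) (at z)"
  proof (rule Lim_null_comparison)
    show "\<forall>\<^sub>F y in at z. norm ((cauchy_int k y - cauchy_int k z) / (y - z) - ?D)
        \<le> norm (y - z) * ((\<integral>x. \<bar>k x\<bar> \<partial>lborel) * (2 / d ^ 3))"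
      unfolding eventually_at using bound d(1)
      by (intro exI[of _ "d / 2"]) (auto simp: dist_norm)
    have "((\<lambda>y. norm (y - z)) \<longlongrightarrow> norm (z - z)) (at z)" by (intro tendsto_intros)
    then show "((\<lambda>y. norm (y - z) * ((\<integral>x. \<bar>k x\<bar> \<partial>lborel) * (2 / d ^ 3))) \<longlongrightarrow> 0) (at z)"
      by (intro tendsto_mult_left_zero) simp
  qed
  then have "((\<lambda>y. (cauchy_int k y - cauchy_int k z) / (y - z)) \<longlongrightarrow> ?D) (at z)"
    by (rule LIM_zero_cancel)
  then have "(cauchy_int k has_field_derivative ?D) (at z)"
    by (simp add: has_field_derivative_iff)
  then show ?thesis by blast
qed

lemma cauchy_int_holomorphic:
  assumes "closed S"
  shows "cauchy_int k holomorphic_on - (complex_of_real ` S)"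
  unfolding holomorphic_on_def field_differentiable_def
  using cauchy_int_derivative[OF assms] by (metis ComplD has_field_derivative_at_within)

text \<open>Orthogonality to the powers below \<open>l\<close> removes the first \<open>l\<close> terms of the expansion at
  infinity.\<close>
lemma cauchy_int_decay:
  assumes S: "closed S" and R: "R > 0" "\<And>x. x \<in> S \<Longrightarrow> \<bar>x\<bar> \<le> R" and z: "norm z \<ge> 2 * R"
    and orth: "\<And>i. i < l \<Longrightarrow> (\<integral>x. k x * x ^ i \<partial>lborel) = 0"
  shows "norm (cauchy_int k z) \<le> (\<integral>x. \<bar>k x\<bar> \<partial>lborel) * (2 * R ^ l) / norm z ^ (l + 1)"
proof -
  have [measurable]: "k \<in> borel_measurable borel" using k by simp
  have z0: "z \<noteq> 0" using z R(1) by auto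
  \<comment> \<open>The condition norm z >= 2 R keeps z at distance at least norm z / 2 from S;
    hence the 2 in the remainder bound.\<close>
  have lower: "norm z / 2 \<le> norm (z - of_real x)" if "x \<in> S" for x
    using R(2)[OF that] z norm_triangle_ineq2[of z "of_real x"] by simp
  have pow_int: "integrable lborel (\<lambda>x. k x * x ^ i)" for i
  proof (rule Bochner_Integration.integrable_bound)
    show "integrable lborel (\<lambda>x. k x * R ^ i)" using k by simp
    have "norm (k x * x ^ i) \<le> norm (k x * R ^ i)" for x
      using R supp[of x] by (cases "x \<in> S")
        (auto simp: abs_mult power_abs intro!: mult_left_mono power_mono)
    then show "AE x in lborel. norm (k x * x ^ i) \<le> norm (k x * R ^ i)" by simp
  qed measurable
  have zS: "z \<notin> complex_of_real ` S" using lower z0 by force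
  have id: "of_real (k x) / (z - of_real x) =
      (\<Sum>i<l. complex_of_real (k x * x ^ i) / z ^ (i + 1)) + of_real (k x * x ^ l) / (z ^ l * (z - of_real x))" for x
  proof (cases "x \<in> S")
    case True
    then have ne: "z - of_real x \<noteq> 0" using zS by auto
    \<comment> \<open>Finite geometric expansion at infinity with exact remainder; after integration
      against k the finite sum vanishes by orthogonality.\<close>
    have "1 / (z - of_real x) = (\<Sum>i<l. of_real x ^ i / z ^ (i + 1))
        + of_real x ^ l / (z ^ l * (z - of_real x))"
    proof (induction l)
      case (Suc l)
      have "of_real x ^ l / (z ^ l * (z - of_real x))
          = of_real x ^ l / z ^ (l + 1) + of_real x ^ Suc l / (z ^ Suc l * (z - of_real x))"
        using ne z0 by (simp add: divide_simps) (simp add: algebra_simps)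
      then show ?case using Suc by simp
    qed simp
    then have "of_real (k x) * (1 / (z - of_real x)) = of_real (k x) * ((\<Sum>i<l. of_real x ^ i / z ^ (i + 1))
        + of_real x ^ l / (z ^ l * (z - of_real x)))" by simp
    then show ?thesis by (simp add: algebra_simps sum_distrib_left)
  qed (use supp in simp)
  have rem_bound: "norm (complex_of_real (k x * x ^ l) / (z ^ l * (z - of_real x)))
      \<le> \<bar>k x\<bar> * (2 * R ^ l / norm z ^ (l + 1))" for x
  proof (cases "x \<in> S")
    case True
    have "\<bar>x\<bar> ^ l / (norm z ^ l * norm (z - of_real x)) \<le> R ^ l / (norm z ^ l * (norm z / 2))"
      using True R z0 lower[OF True] by (intro frac_le power_mono mult_left_mono) auto
    then have "\<bar>k x\<bar> * (\<bar>x\<bar> ^ l / (norm z ^ l * norm (z - of_real x)))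
        \<le> \<bar>k x\<bar> * (R ^ l / (norm z ^ l * (norm z / 2)))" by (intro mult_left_mono) auto
    then show ?thesis by (simp add: norm_mult norm_divide norm_power power_abs mult_ac)
  qed (use supp in simp)
  have ii: "integrable lborel (\<lambda>x. \<bar>k x\<bar> * (2 * R ^ l / norm z ^ (l + 1)))" using k by simp
  have irem: "integrable lborel (\<lambda>x. complex_of_real (k x * x ^ l) / (z ^ l * (z - of_real x)))"
    by (rule Bochner_Integration.integrable_bound[OF ii]) (measurable, use rem_bound R(1) in \<open>simp add: abs_mult\<close>)
  have isum: "integrable lborel (\<lambda>x. complex_of_real (k x * x ^ i) / z ^ (i + 1))" for i
    using pow_int[of i] by (intro integrable_divide integrable_of_real) auto
  have "(\<integral>x. complex_of_real (k x * x ^ i) / z ^ (i + 1) \<partial>lborel) = 0" if "i < l" for i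
    using orth[OF that] by (simp only: integral_divide_zero integral_complex_of_real) simp
  then have "cauchy_int k z = (\<integral>x. of_real (k x * x ^ l) / (z ^ l * (z - of_real x)) \<partial>lborel)"
    unfolding cauchy_int_def id using isum irem
    by (subst Bochner_Integration.integral_add)
      (auto simp: Bochner_Integration.integral_sum orth simp del: of_real_mult of_real_power intro!: sum.neutral)
  also have "norm \<dots> \<le> (\<integral>x. \<bar>k x\<bar> * (2 * R ^ l / norm z ^ (l + 1)) \<partial>lborel)"
    using irem ii rem_bound by (intro Bochner_Integration.integral_norm_bound_integral) auto
  finally show ?thesis by simp
qed

end

section \<open>Fourth roots and domination by the real part\<close>

definition root4 :: "real \<Rightarrow> real" where "root4 x = sqrt (sqrt x)"

lemma root4_simps: "x \<ge> 0 \<Longrightarrow> root4 x \<ge> 0" "root4 (x * y) = root4 x * root4 y" "root4 1 = 1" "root4 0 = 0"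
  unfolding root4_def by (simp_all add: real_sqrt_mult)

lemma root4_mono: "x \<le> y \<Longrightarrow> root4 x \<le> root4 y"
  unfolding root4_def by simp

lemma root4_add_le:
  assumes "x \<ge> 0" "y \<ge> 0"
  shows "root4 (x + y) \<le> root4 x + root4 y"
proof -
  have "sqrt (sqrt (x + y)) \<le> sqrt (sqrt x + sqrt y)"
    using sqrt_add_le_add_sqrt[OF assms] by simp
  also have "\<dots> \<le> sqrt (sqrt x) + sqrt (sqrt y)"
    using assms by (intro sqrt_add_le_add_sqrt) auto
  finally show ?thesis unfolding root4_def .
qed

lemma root4_power: "x \<ge> 0 \<Longrightarrow> root4 x ^ 4 = x"
proof -
  assume "x \<ge> 0"
  have "root4 x ^ 4 = ((sqrt (sqrt x))\<^sup>2)\<^sup>2" unfolding root4_def by (simp flip: power_mult)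
  then show ?thesis using \<open>x \<ge> 0\<close> by simp
qed

lemma root4_sum_le:
  assumes "finite I" "\<And>i. i \<in> I \<Longrightarrow> x i \<ge> 0"
  shows "root4 (\<Sum>i\<in>I. x i) \<le> (\<Sum>i\<in>I. root4 (x i))"
  using assms
proof (induction rule: finite_induct)
  case (insert i I)
  have "root4 (\<Sum>j\<in>insert i I. x j) \<le> root4 (x i) + root4 (\<Sum>j\<in>I. x j)"
    using insert by (simp add: root4_add_le sum_nonneg)
  then show ?case using insert by force
qed (simp add: root4_simps)

text \<open>The first root lands in the right half-plane, so the second lies where the modulus is at
  most sqrt 2 times the real part. Reading \<open>Re (csqrt s)\<close> as the square root of (norm s
  + Re s) / 2 gives this with the rounder constant 2.\<close>

lemma Re_csqrt_csqrt:
  assumes "w \<notin> \<real>\<^sub>\<le>\<^sub>0"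
  shows "root4 (norm w) \<le> 2 * Re (csqrt (csqrt w))" "csqrt w \<notin> \<real>\<^sub>\<le>\<^sub>0"
proof -
  let ?s = "csqrt w"
  have Re: "Re ?s \<ge> 0" using csqrt_principal[of w] by auto
  have "root4 (norm w) = sqrt (norm ?s)" unfolding root4_def by simp
  also have "\<dots> \<le> sqrt (4 * ((norm ?s + Re ?s) / 2))" using Re by (intro real_sqrt_le_mono) auto
  also have "\<dots> = 2 * sqrt ((norm ?s + Re ?s) / 2)" by (subst real_sqrt_mult) simp
  also have "\<dots> = 2 * Re (csqrt ?s)" by simp
  finally show "root4 (norm w) \<le> 2 * Re (csqrt (csqrt w))" .
  show "csqrt w \<notin> \<real>\<^sub>\<le>\<^sub>0" using assms by auto
qed

text \<open>For a positive density \<open>k\<close> on \<open>[a, b]\<close> the factor \<open>z - b\<close> turns the Cauchy integral into a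
  function omitting the negative real axis, so that its fourth root has dominating real part.\<close>
lemma one_plus_cauchy_int_slit:
  assumes k: "integrable lborel k" "\<And>x. k x \<ge> 0" and supp: "\<And>x. x \<notin> {a..b} \<Longrightarrow> k x = 0"
    and z: "z \<notin> complex_of_real ` {a..b}"
  shows "1 + (z - of_real b) * cauchy_int k z \<notin> \<real>\<^sub>\<le>\<^sub>0"
proof -
  \<comment> \<open>Since (z - b) / (z - x) = 1 - (b - x) / (z - x), the product of z - b with the
    Cauchy integral is the mass of k minus the Cauchy integral of the nonnegative density m.\<close>
  define m where "m x = k x * (b - x)" for x
  have [measurable]: "k \<in> borel_measurable borel" using k by simp
  have m: "integrable lborel m"
  proof (rule Bochner_Integration.integrable_bound)
    show "integrable lborel (\<lambda>x. k x * (b - a))" using k by simp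
    have "norm (m x) \<le> norm (k x * (b - a))" for x
      using supp[of x] by (cases "x \<in> {a..b}") (auto simp: m_def abs_mult intro!: mult_left_mono)
    then show "AE x in lborel. norm (m x) \<le> norm (k x * (b - a))" by simp
  qed (simp add: m_def[abs_def])
  have m0: "m x \<ge> 0" for x using k(2)[of x] supp[of x] unfolding m_def
    by (cases "x \<in> {a..b}") auto
  have msupp: "m x = 0" if "x \<notin> {a..b}" for x using supp[OF that] unfolding m_def by simp
  have ne: "z - of_real x \<noteq> 0" if "x \<in> {a..b}" for x using z that by auto
  define I where "I = (\<integral>x. k x \<partial>lborel)"
  have I0: "I \<ge> 0" unfolding I_def using k by simp
  have ik: "integrable lborel (\<lambda>x. of_real (k x) / (z - of_real x))"
    using cauchy_int_integrable[OF k(1) supp _ z] by simp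
  have im: "integrable lborel (\<lambda>x. of_real (m x) / (z - of_real x))"
    using cauchy_int_integrable[OF m msupp _ z] by simp
  have "(z - of_real b) * cauchy_int k z = (\<integral>x. (z - of_real b) * (of_real (k x) / (z - of_real x)) \<partial>lborel)"
    unfolding cauchy_int_def by (simp only: integral_mult_right_zero)
  also have "\<dots> = (\<integral>x. of_real (k x) - of_real (m x) / (z - of_real x) \<partial>lborel)"
  proof (rule Bochner_Integration.integral_cong[OF refl])
    fix x
    show "(z - of_real b) * (of_real (k x) / (z - of_real x)) = of_real (k x) - of_real (m x) / (z - of_real x)"
      using ne[of x] supp[of x] unfolding m_def
      by (cases "x \<in> {a..b}") (auto simp: divide_simps, auto simp: algebra_simps)
  qed
  also have "\<dots> = of_real I - cauchy_int m z"
    unfolding cauchy_int_def I_def using k im by simp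
  finally have eta: "1 + (z - of_real b) * cauchy_int k z = 1 + of_real I - cauchy_int m z" by simp
  show ?thesis
  proof
    assume neg: "1 + (z - of_real b) * cauchy_int k z \<in> \<real>\<^sub>\<le>\<^sub>0"
    show False
    proof (cases "Im z = 0")
      case True
      \<comment> \<open>On the real axis outside [a, b] the factors y - b and y - x have the same
        sign, so the product is nonnegative and adding 1 keeps it off the half-line.\<close>
      define y where "y = Re z"
      have zy: "z = of_real y" using True unfolding y_def by (simp add: complex_eq_iff)
      have yab: "y \<notin> {a..b}" using z zy by auto
      have "Re ((z - of_real b) * cauchy_int k z)
          = Re (\<integral>x. (z - of_real b) * (of_real (k x) / (z - of_real x)) \<partial>lborel)"
        unfolding cauchy_int_def by (simp only: integral_mult_right_zero)
      also have "\<dots> = (\<integral>x. Re ((z - of_real b) * (of_real (k x) / (z - of_real x))) \<partial>lborel)"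
        by (rule integral_Re[symmetric], rule integrable_mult_right, rule ik)
      also have "\<dots> \<ge> 0"
      proof (rule integral_nonneg_AE, rule AE_I2)
        fix x
        have "(z - of_real b) * (of_real (k x) / (z - of_real x)) = of_real ((y - b) * (k x / (y - x)))"
          unfolding zy by simp
        moreover have "(y - b) * (k x / (y - x)) \<ge> 0"
        proof (cases "x \<in> {a..b}")
          case True
          then have "(y - b) / (y - x) \<ge> 0" using yab by (auto simp: divide_simps)
          then have "k x * ((y - b) / (y - x)) \<ge> 0" using k(2)[of x] by (intro mult_nonneg_nonneg)
          then show ?thesis by (simp add: mult_ac)
        qed (use supp in simp)
        ultimately show "0 \<le> Re ((z - of_real b) * (of_real (k x) / (z - of_real x)))" by simp
      qed
      finally show False using neg by (simp add: complex_nonpos_Reals_iff)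
    next
      case False
      \<comment> \<open>Off the axis the imaginary part of m / (z - x) has constant sign, so it can
        integrate to zero only if m vanishes almost everywhere; the value is then 1 + I > 0.\<close>
      have "Im (cauchy_int m z) = 0" using neg eta by (simp add: complex_nonpos_Reals_iff)
      then have "(\<integral>x. Im (of_real (m x) / (z - of_real x)) \<partial>lborel) = 0"
        unfolding cauchy_int_def using im by simp
      then have J0: "(\<integral>x. Im (of_real (m x) / (z - of_real x)) / (- Im z) \<partial>lborel) = 0" by simp
      have Imx: "Im (of_real (m x) / (z - of_real x)) / (- Im z) = m x / (norm (z - of_real x))\<^sup>2" for x
        using False by (simp add: Im_divide cmod_power2)
      have "AE x in lborel. Im (of_real (m x) / (z - of_real x)) / (- Im z) = 0"
      proof (subst integral_nonneg_eq_0_iff_AE[symmetric])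
        show "integrable lborel (\<lambda>x. Im (of_real (m x) / (z - of_real x)) / (- Im z))"
          using im by (intro integrable_divide integrable_Im) auto
        show "AE x in lborel. 0 \<le> Im (of_real (m x) / (z - of_real x)) / (- Im z)"
          unfolding Imx using m0 by simp
      qed (rule J0)
      then have "AE x in lborel. of_real (m x) / (z - of_real x) = 0"
        unfolding Imx by (auto elim!: eventually_mono)
      then have "cauchy_int m z = 0" unfolding cauchy_int_def
        by (rule integral_eq_zero_AE)
      then show False using neg eta I0 by (simp add: complex_nonpos_Reals_iff)
    qed
  qed
qed

text \<open>In T the factor 2 is the loss in \<open>Re_csqrt_csqrt\<close>, and the final 1 pays, by
  subadditivity of the fourth root, for the 1 that was added to leave the slit. Re T dominates right
  up to the cut, and at distance d from it it is bounded through |z - b| and d alone, for every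
  density of mass at most 1.\<close>

lemma cauchy_int_majorant:
  assumes k: "integrable lborel k" "\<And>x. k x \<ge> 0" and supp: "\<And>x. x \<notin> {a..b} \<Longrightarrow> k x = 0"
    and mass: "(\<integral>x. k x \<partial>lborel) \<le> 1"
  defines "T \<equiv> \<lambda>z. 2 * csqrt (csqrt (1 + (z - of_real b) * cauchy_int k z)) + 1"
  shows "T holomorphic_on - (complex_of_real ` {a..b})"
    and "z \<notin> complex_of_real ` {a..b} \<Longrightarrow> root4 (norm ((z - of_real b) * cauchy_int k z)) \<le> Re (T z)"
    and "\<lbrakk>d > 0; \<And>x. x \<in> {a..b} \<Longrightarrow> d \<le> norm (z - of_real x)\<rbrakk>
        \<Longrightarrow> Re (T z) \<le> 2 * root4 (1 + norm (z - of_real b) / d) + 1"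
proof -
  let ?e = "\<lambda>z. 1 + (z - of_real b) * cauchy_int k z"
  have slit: "?e z \<notin> \<real>\<^sub>\<le>\<^sub>0" if "z \<notin> complex_of_real ` {a..b}" for z
    using one_plus_cauchy_int_slit[OF k supp that] .
  have hol: "cauchy_int k holomorphic_on - (complex_of_real ` {a..b})"
    by (rule cauchy_int_holomorphic[OF k(1) supp]) auto
  have "?e z \<notin> \<real>\<^sub>\<le>\<^sub>0 \<and> csqrt (?e z) \<notin> \<real>\<^sub>\<le>\<^sub>0" if "z \<in> - (complex_of_real ` {a..b})" for z
    using slit[of z] Re_csqrt_csqrt(2)[of "?e z"] that by blast
  then show "T holomorphic_on - (complex_of_real ` {a..b})"
    unfolding T_def using hol by (intro holomorphic_intros) auto
  show "root4 (norm ((z - of_real b) * cauchy_int k z)) \<le> Re (T z)"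
    if z: "z \<notin> complex_of_real ` {a..b}"
  proof -
    have "norm ((z - of_real b) * cauchy_int k z) \<le> norm (?e z) + 1"
      using norm_triangle_ineq4[of "?e z" 1] by simp
    then have "root4 (norm ((z - of_real b) * cauchy_int k z)) \<le> root4 (norm (?e z)) + root4 1"
      using root4_mono root4_add_le[of "norm (?e z)" 1] by (meson norm_ge_zero order_trans zero_le_one)
    then show ?thesis
      using Re_csqrt_csqrt(1)[OF slit[OF z]] unfolding T_def by (simp add: root4_simps)
  qed
  show "Re (T z) \<le> 2 * root4 (1 + norm (z - of_real b) / d) + 1"
    if d: "d > 0" "\<And>x. x \<in> {a..b} \<Longrightarrow> d \<le> norm (z - of_real x)"
  proof -
    have "norm (cauchy_int k z) \<le> (\<integral>x. \<bar>k x\<bar> \<partial>lborel) / d"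
      by (rule cauchy_int_norm_le[OF k(1) supp d])
    also have "\<dots> \<le> 1 / d" using mass d(1) k(2) by (intro divide_right_mono) auto
    finally have "norm (z - of_real b) * norm (cauchy_int k z) \<le> norm (z - of_real b) * (1 / d)"
      by (intro mult_left_mono) auto
    then have "norm (?e z) \<le> 1 + norm (z - of_real b) / d"
      using norm_triangle_ineq[of 1 "(z - of_real b) * cauchy_int k z"] by (simp add: norm_mult)
    then have "root4 (norm (?e z)) \<le> root4 (1 + norm (z - of_real b) / d)" by (rule root4_mono)
    moreover have "Re (csqrt (csqrt (?e z))) \<le> root4 (norm (?e z))"
      using complex_Re_le_cmod[of "csqrt (csqrt (?e z))"] unfolding root4_def by simp
    ultimately show ?thesis unfolding T_def by simp
  qed
qed

section \<open>Functions of the second kind\<close>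

locale interval_green =
  fixes g :: nat and a b :: "nat \<Rightarrow> real" and S :: "real set" and G :: "complex \<Rightarrow> real"
  assumes S_def: "S = (\<Union>j\<le>g. {a j..b j})"
    and ab: "\<And>j. j \<le> g \<Longrightarrow> a j < b j"
    and disj: "\<And>i j. i \<le> g \<Longrightarrow> j \<le> g \<Longrightarrow> i \<noteq> j \<Longrightarrow> {a i..b i} \<inter> {a j..b j} = {}"
    and green: "is_green_function (complex_of_real ` S) G"
begin

lemma compact_S: "compact S" and closed_S: "closed S" and S_nonempty: "S \<noteq> {}"
proof -
  show "compact S" unfolding S_def by (intro compact_UN) auto
  then show "closed S" by (rule compact_imp_closed)
  show "S \<noteq> {}" using ab[of 0] unfolding S_def by force
qed

sublocale green_function "complex_of_real ` S" G
proof
  show "compact (complex_of_real ` S)"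
    using compact_S by (intro compact_continuous_image continuous_intros)
qed (use S_nonempty green in auto)

lemma S_bound: obtains R where "R \<ge> 1" "\<And>x. x \<in> S \<Longrightarrow> \<bar>x\<bar> \<le> R"
proof -
  obtain R where "\<And>x. x \<in> S \<Longrightarrow> norm x \<le> R"
    using compact_imp_bounded[OF compact_S] unfolding bounded_iff by auto
  then show ?thesis by (intro that[of "max R 1"]) force+
qed

lemma sum_indicator:
  assumes "x \<in> S" shows "(\<Sum>j\<le>g. indicator {a j..b j} x) = (1::real)"
proof -
  obtain i where i: "i \<le> g" "x \<in> {a i..b i}" using assms unfolding S_def by auto
  have "(\<Sum>j\<le>g. indicator {a j..b j} x) = (\<Sum>j\<le>g. if j = i then 1 else (0::real))"
  proof (intro sum.cong refl)
    fix j assume "j \<in> {..g}"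
    then show "indicator {a j..b j} x = (if j = i then 1 else (0::real))"
      using i disj[of i j] unfolding indicator_def by auto
  qed
  then show ?thesis using i by simp
qed

definition B :: "complex \<Rightarrow> complex" where "B z = (\<Prod>j\<le>g. z - of_real (b j))"

text \<open>The slit argument wants a nonnegative density on one interval, so k is split into its
  positive (\<open>s\<close> true) and negative parts on each of the g + 1 intervals.\<close>

definition part :: "(real \<Rightarrow> real) \<Rightarrow> nat \<Rightarrow> bool \<Rightarrow> real \<Rightarrow> real" where
  "part k j s x = indicator {a j..b j} x * max 0 (if s then k x else - k x)"

definition majorant :: "(real \<Rightarrow> real) \<Rightarrow> complex \<Rightarrow> complex" where
  "majorant k z = (\<Sum>(j, s)\<in>{..g} \<times> UNIV.
     2 * csqrt (csqrt (1 + (z - of_real (b j)) * cauchy_int (part k j s) z)) + 1)"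

lemma interval_subset: "j \<le> g \<Longrightarrow> x \<in> {a j..b j} \<Longrightarrow> x \<in> S"
  unfolding S_def by auto

context
  fixes k :: "real \<Rightarrow> real"
  assumes k: "integrable lborel k" and supp: "\<And>x. x \<notin> S \<Longrightarrow> k x = 0"
    and mass: "(\<integral>x. \<bar>k x\<bar> \<partial>lborel) \<le> 1"
begin

lemma part_props: "integrable lborel (part k j s)" "part k j s x \<ge> 0"
  "x \<notin> {a j..b j} \<Longrightarrow> part k j s x = 0" "(\<integral>x. part k j s x \<partial>lborel) \<le> 1"
proof -
  have [measurable]: "k \<in> borel_measurable borel" using k by simp
  have le: "norm (part k j s x) \<le> \<bar>k x\<bar>" for x
    unfolding part_def by (auto simp: indicator_def)
  show int: "integrable lborel (part k j s)"
  proof (rule Bochner_Integration.integrable_bound)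
    show "integrable lborel (\<lambda>x. \<bar>k x\<bar>)" using k by simp
    show "part k j s \<in> borel_measurable lborel" unfolding part_def[abs_def] by simp
  qed (use le in simp)
  show "part k j s x \<ge> 0" "x \<notin> {a j..b j} \<Longrightarrow> part k j s x = 0" unfolding part_def by auto
  have "(\<integral>x. part k j s x \<partial>lborel) \<le> (\<integral>x. \<bar>k x\<bar> \<partial>lborel)"
    using int k le by (intro integral_mono) (auto intro: order_trans[OF abs_ge_self])
  then show "(\<integral>x. part k j s x \<partial>lborel) \<le> 1" using mass by linarith
qed

lemma cauchy_int_parts:
  assumes z: "z \<notin> complex_of_real ` S"
  shows "cauchy_int k z = (\<Sum>(j, s)\<in>{..g} \<times> UNIV. (if s then 1 else - 1) * cauchy_int (part k j s) z)"
proof -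
  have zj: "z \<notin> complex_of_real ` {a j..b j}" if "j \<le> g" for j
    using z interval_subset[OF that] by auto
  have i: "integrable lborel (\<lambda>x. of_real (part k j s x) / (z - of_real x))" if "j \<le> g" for j s
    using cauchy_int_integrable[OF part_props(1) part_props(3) _ zj[OF that]] by simp
  have kx: "k x = (\<Sum>(j, s)\<in>{..g} \<times> UNIV. (if s then 1 else - 1) * part k j s x)" for x
  proof -
    have "(\<Sum>(j, s)\<in>{..g} \<times> UNIV. (if s then 1 else - 1) * part k j s x)
        = (\<Sum>j\<le>g. indicator {a j..b j} x * k x)"
      unfolding sum.cartesian_product[symmetric] part_def
      by (intro sum.cong refl) (auto simp: UNIV_bool max_def)
    also have "\<dots> = (\<Sum>j\<le>g. indicator {a j..b j} x) * k x" by (simp add: sum_distrib_right)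
    finally show ?thesis using sum_indicator[of x] supp[of x] by (cases "x \<in> S") auto
  qed
  then have "of_real (k x) / (z - of_real x) = (\<Sum>(j, s)\<in>{..g} \<times> UNIV.
      (if s then 1 else - 1) * (of_real (part k j s x) / (z - of_real x)))" for x
    by (subst kx) (auto simp: sum_divide_distrib intro!: sum.cong)
  then have "cauchy_int k z = (\<integral>x. (\<Sum>(j, s)\<in>{..g} \<times> UNIV.
      (if s then 1 else - 1) * (of_real (part k j s x) / (z - of_real x))) \<partial>lborel)"
    unfolding cauchy_int_def by simp
  also have "\<dots> = (\<Sum>(j, s)\<in>{..g} \<times> UNIV. (if s then 1 else - 1) * cauchy_int (part k j s) z)"
    unfolding cauchy_int_def case_prod_unfold
  proof (subst Bochner_Integration.integral_sum)
    show "integrable lborel (\<lambda>x. (if snd i then 1 else - 1) * (complex_of_real (part k (fst i) (snd i) x) / (z - of_real x)))"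
      if "i \<in> {..g} \<times> UNIV" for i
      using i[of "fst i" "snd i"] that by auto
  qed (auto intro!: sum.cong simp del: times_divide_eq_right)
  finally show ?thesis .
qed

text \<open>For each piece one factor z - b_j of \<open>B\<close> goes into the slit function and
  the other g are at most 2R, giving (2R)^g; the number of pieces, 2 (g + 1), appears in the last
  bound. The bounds see k only through its support and mass, hence their uniformity in the
  degree.\<close>

lemma majorant_props:
  shows "majorant k holomorphic_on - (complex_of_real ` S)"
    and "\<lbrakk>z \<notin> complex_of_real ` S; norm z \<le> R; \<And>x. x \<in> S \<Longrightarrow> \<bar>x\<bar> \<le> R; R \<ge> 1\<rbrakk>
        \<Longrightarrow> root4 (norm (B z * cauchy_int k z)) \<le> root4 ((2 * R) ^ g) * Re (majorant k z)"
    and "z \<notin> complex_of_real ` S \<Longrightarrow> Re (majorant k z) \<ge> 0"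
    and "\<lbrakk>d > 0; \<And>x. x \<in> S \<Longrightarrow> d \<le> norm (z - of_real x); norm z \<le> R; \<And>x. x \<in> S \<Longrightarrow> \<bar>x\<bar> \<le> R\<rbrakk>
        \<Longrightarrow> Re (majorant k z) \<le> (g + 1) * (2 * (2 * root4 (1 + 2 * R / d) + 1))"
proof -
  let ?J = "{..g} \<times> (UNIV :: bool set)"
  let ?T = "\<lambda>j s z. 2 * csqrt (csqrt (1 + (z - of_real (b j)) * cauchy_int (part k j s) z)) + 1"
  show "majorant k holomorphic_on - (complex_of_real ` S)"
    unfolding majorant_def[abs_def] case_prod_unfold
  proof (rule holomorphic_on_sum)
    fix i assume "i \<in> ?J"
    then have "- (complex_of_real ` S) \<subseteq> - (complex_of_real ` {a (fst i)..b (fst i)})"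
      using interval_subset by auto
    then show "?T (fst i) (snd i) holomorphic_on - (complex_of_real ` S)"
      by (rule holomorphic_on_subset[rotated])
        (rule cauchy_int_majorant(1), auto simp: part_props)
  qed
  have zj: "z \<notin> complex_of_real ` {a j..b j}" if "z \<notin> complex_of_real ` S" "j \<le> g" for j z
    using that interval_subset[OF that(2)] by auto
  have bS: "b j \<in> S" if "j \<le> g" for j using interval_subset[OF that, of "b j"] ab[OF that] by simp
  have T2: "root4 (norm ((z - of_real (b j)) * cauchy_int (part k j s) z)) \<le> Re (?T j s z)"
    if "z \<notin> complex_of_real ` S" "j \<le> g" for j s z
    by (rule cauchy_int_majorant(2)[where a = "a j"]) (use zj[OF that] in \<open>auto simp: part_props\<close>)
  then have T0: "Re (?T j s z) \<ge> 0" if "z \<notin> complex_of_real ` S" "j \<le> g" for j s z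
    using that root4_simps(1)[OF norm_ge_zero] order_trans by blast
  show "Re (majorant k z) \<ge> 0" if "z \<notin> complex_of_real ` S"
    unfolding majorant_def Re_sum case_prod_unfold using T0[OF that] by (intro sum_nonneg) auto
  show "root4 (norm (B z * cauchy_int k z)) \<le> root4 ((2 * R) ^ g) * Re (majorant k z)"
    if z: "z \<notin> complex_of_real ` S" and R: "norm z \<le> R" "\<And>x. x \<in> S \<Longrightarrow> \<bar>x\<bar> \<le> R" "R \<ge> 1"
  proof -
    have zb: "norm (z - of_real (b j)) \<le> 2 * R" if "j \<le> g" for j
      using norm_triangle_ineq4[of z "of_real (b j)"] R(1) R(2)[OF bS[OF that]] by simp
    have Bj: "norm (B z * ((if s then 1 else - 1) * cauchy_int (part k j s) z))
        \<le> (2 * R) ^ g * norm ((z - of_real (b j)) * cauchy_int (part k j s) z)" if "j \<le> g" for j s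
    proof -
      have "B z = (z - of_real (b j)) * (\<Prod>i\<in>{..g} - {j}. z - of_real (b i))"
        unfolding B_def using that by (intro prod.remove) auto
      moreover have "norm (\<Prod>i\<in>{..g} - {j}. z - of_real (b i)) \<le> (\<Prod>i\<in>{..g} - {j}. 2 * R)"
        unfolding prod_norm[symmetric] using zb by (intro prod_mono) auto
      moreover have "(\<Prod>i\<in>{..g} - {j}. 2 * R) = (2 * R) ^ g" using that by simp
      ultimately show ?thesis
        using mult_right_mono[of "norm (\<Prod>i\<in>{..g} - {j}. z - of_real (b i))" "(2 * R) ^ g"
            "norm ((z - of_real (b j)) * cauchy_int (part k j s) z)"]
        by (cases s) (simp_all add: norm_mult mult_ac)
    qed
    have "norm (B z * cauchy_int k z) \<le> (\<Sum>(j, s)\<in>?J. norm (B z * ((if s then 1 else - 1) * cauchy_int (part k j s) z)))"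
      unfolding cauchy_int_parts[OF z] sum_distrib_left case_prod_unfold by (rule norm_sum)
    also have "\<dots> \<le> (\<Sum>(j, s)\<in>?J. (2 * R) ^ g * norm ((z - of_real (b j)) * cauchy_int (part k j s) z))"
      unfolding case_prod_unfold by (intro sum_mono Bj) auto
    finally have "root4 (norm (B z * cauchy_int k z))
        \<le> root4 (\<Sum>(j, s)\<in>?J. (2 * R) ^ g * norm ((z - of_real (b j)) * cauchy_int (part k j s) z))"
      by (rule root4_mono)
    also have "\<dots> \<le> (\<Sum>i\<in>?J. root4 ((2 * R) ^ g * norm ((z - of_real (b (fst i))) * cauchy_int (part k (fst i) (snd i)) z)))"
      unfolding case_prod_unfold using R(3) by (intro root4_sum_le) auto
    also have "\<dots> \<le> (\<Sum>i\<in>?J. root4 ((2 * R) ^ g) * Re (?T (fst i) (snd i) z))"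
      unfolding root4_simps(2) root4_simps(2)[of "_ ^ _" "norm _"] using T2[OF z] R(3)
      by (intro sum_mono mult_left_mono root4_simps(1)) (auto simp: root4_simps(2)[symmetric])
    also have "\<dots> = root4 ((2 * R) ^ g) * Re (majorant k z)"
      unfolding majorant_def Re_sum case_prod_unfold sum_distrib_left by simp
    finally show ?thesis .
  qed
  show "Re (majorant k z) \<le> (g + 1) * (2 * (2 * root4 (1 + 2 * R / d) + 1))"
    if d: "d > 0" "\<And>x. x \<in> S \<Longrightarrow> d \<le> norm (z - of_real x)" and R: "norm z \<le> R" "\<And>x. x \<in> S \<Longrightarrow> \<bar>x\<bar> \<le> R"
  proof -
    have "Re (?T j s z) \<le> 2 * root4 (1 + 2 * R / d) + 1" if "j \<le> g" for j s
    proof -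
      have "norm (z - of_real (b j)) \<le> 2 * R"
        using norm_triangle_ineq4[of z "of_real (b j)"] R(1) R(2)[OF bS[OF that]] by simp
      then have "root4 (1 + norm (z - of_real (b j)) / d) \<le> root4 (1 + 2 * R / d)"
        using d(1) by (intro root4_mono) (auto intro: divide_right_mono)
      moreover have "Re (?T j s z) \<le> 2 * root4 (1 + norm (z - of_real (b j)) / d) + 1"
        by (rule cauchy_int_majorant(3)[where a = "a j"])
          (use d interval_subset[OF that] in \<open>auto simp: part_props\<close>)
      ultimately show ?thesis by linarith
    qed
    then have "Re (majorant k z) \<le> of_nat (card ?J) * (2 * root4 (1 + 2 * R / d) + 1)"
      unfolding majorant_def Re_sum case_prod_unfold by (intro sum_bounded_above) auto
    then show ?thesis by (simp add: card_cartesian_product algebra_simps)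
  qed
qed

end

end

lemma root4_exp: "root4 (exp x) = exp (x / 4)"
proof -
  have "sqrt (exp y) = exp (y / 2)" for y :: real
    by (rule real_sqrt_unique) (simp_all flip: exp_of_nat_mult)
  then show ?thesis unfolding root4_def by simp
qed

section \<open>Exponential decay of the functions of the second kind\<close>

context interval_green
begin

text \<open>The function \<open>|B Q|\<close> to the power \<open>1/4\<close>, corrected by the Green's function, is compared with
  \<open>Re (majorant k)\<close> on \<open>{G > \<delta>}\<close>; since \<open>\<delta>\<close> may be taken of order \<open>1/l\<close>, the correction costs
  only a constant factor on the inner boundary.\<close>
lemma second_kind_comparison:
  assumes k: "integrable lborel k" and supp: "\<And>x. x \<notin> S \<Longrightarrow> k x = 0"
    and mass: "(\<integral>x. \<bar>k x\<bar> \<partial>lborel) \<le> 1"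
    and orth: "\<And>i. i < l \<Longrightarrow> (\<integral>x. k x * x ^ i \<partial>lborel) = 0"
    and R: "R \<ge> 1" "\<And>x. x \<in> S \<Longrightarrow> \<bar>x\<bar> \<le> R" "\<And>z. G z \<le> 1 \<Longrightarrow> norm z \<le> R"
    and z: "G z > 0"
  defines "q \<equiv> real l - real g - 1"
  shows "root4 (norm (B z * cauchy_int k z) * exp (q * G z))
      \<le> exp 1 * root4 ((2 * R) ^ g) * Re (majorant k z) + 1"
proof -
  let ?Q = "cauchy_int k" and ?M = "majorant k" and ?K = "complex_of_real ` S"
  define P where "P = exp 1 * root4 ((2 * R) ^ g)"
  have P0: "P \<ge> 0" unfolding P_def using R(1) by (simp add: root4_simps)
  \<comment> \<open>Keeps z in {G > \<delta>} and the inner boundary in {G <= 1}, where R bounds the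
    modulus. Dividing by 1 + |q| makes |q| \<delta> at most 1, so that exp(q G) on the inner
    boundary is absorbed by the factor e in P.\<close>
  define \<delta> where "\<delta> = min 1 (G z / 2) / (1 + \<bar>q\<bar>)"
  have \<delta>: "\<delta> > 0" "\<delta> \<le> 1" "\<delta> < G z" "\<bar>q\<bar> * \<delta> \<le> 1"
  proof -
    have m: "min 1 (G z / 2) > 0" "min 1 (G z / 2) \<le> 1" "min 1 (G z / 2) < G z" using z by auto
    show "\<delta> > 0" unfolding \<delta>_def using m(1) by (intro divide_pos_pos) auto
    have "\<delta> \<le> min 1 (G z / 2) / 1" unfolding \<delta>_def using m(1) by (intro divide_left_mono) auto
    then show "\<delta> \<le> 1" "\<delta> < G z" using m by linarith+
    have "\<bar>q\<bar> * min 1 (G z / 2) \<le> \<bar>q\<bar> * 1" using m(2) by (intro mult_left_mono) auto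
    then show "\<bar>q\<bar> * \<delta> \<le> 1" unfolding \<delta>_def by (simp add: divide_le_eq)
  qed
  have holQ: "?Q holomorphic_on - ?K" by (rule cauchy_int_holomorphic[OF k supp closed_S])
  have holM: "?M holomorphic_on - ?K" by (rule majorant_props(1)[OF k supp mass])
  have holB: "B holomorphic_on X" for X unfolding B_def[abs_def] by (intro holomorphic_intros)
  obtain B0 R0 where BR: "R0 \<ge> 1" "B0 \<ge> 0" "\<And>z. R0 \<le> norm z \<Longrightarrow> \<bar>G z - ln (norm z)\<bar> \<le> B0"
    by (rule growth) blast
  \<comment> \<open>At modulus r, \<open>B\<close> is of size r^(g+1), the Cauchy integral of size
    r^(-l-1), and exp(q G) of size r^q up to exp(|q| B0). With q = l - g - 1 the powers multiply to
    1/r, so c / r bounds the product and R2 >= c makes it at most 1.\<close>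
  define c where "c = 2 ^ (g + 1) * (2 * R ^ l) * exp (\<bar>q\<bar> * B0)"
  define R2 where "R2 = Max {R0, 2 * R, c, norm z + 1}"
  have R2: "R2 \<ge> R0" "R2 \<ge> 2 * R" "R2 \<ge> c" "R2 > norm z"
    unfolding R2_def by (simp_all add: Max_ge_iff Max_gr_iff)
  define W where "W w = root4 (norm (B w * ?Q w) * exp (q * G w)) - P * Re (?M w)" for w
  define X where "X = {w. \<delta> < G w} \<inter> ball 0 R2"
  have X: "open X" "bounded X" unfolding X_def using open_sublevel(2) by (auto simp: open_Int)
  have zX: "z \<in> X" unfolding X_def using \<delta>(3) R2(4) by simp
  have clX: "closure X \<subseteq> {w. \<delta> \<le> G w} \<inter> cball 0 R2"
  proof (rule closure_minimal)
    show "closed ({w. \<delta> \<le> G w} \<inter> cball 0 R2)"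
      by (intro closed_Int closed_Collect_le continuous_intros continuous closed_cball)
  qed (auto simp: X_def)
  have clK: "closure X \<subseteq> - ?K"
  proof
    fix w assume "w \<in> closure X"
    then have "\<delta> \<le> G w" using clX by auto
    then show "w \<in> - ?K" using pos_notin[of w] \<delta>(1) by simp
  qed
  \<comment> \<open>What is subtracted is nonnegative. Zeros of the product fall under this case, so
    above the level 1 the fourth root always has a local branch.\<close>
  have W1: "W w \<le> 1" if "root4 (norm (B w * ?Q w) * exp (q * G w)) \<le> 1" "w \<notin> ?K" for w
    using majorant_props(3)[OF k supp mass that(2)] P0 that(1) mult_nonneg_nonneg[OF P0]
    unfolding W_def by (smt (verit))
  have "W z \<le> 1"
  proof (rule maximum_principle_minorant[OF X _ _ _ zX])
    have "continuous_on (closure X) ?Q" "continuous_on (closure X) ?M" "continuous_on (closure X) B"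
      using holQ holM holB clK holomorphic_on_imp_continuous_on continuous_on_subset by blast+
    then show "continuous_on (closure X) W"
      unfolding W_def root4_def by (intro continuous_intros continuous_on)
  next
    fix w assume "w \<in> frontier X"
    then have w: "w \<in> closure X" "w \<notin> X" using X(1) interior_open unfolding frontier_def by blast+
    then have wK: "w \<notin> ?K" using clK by auto
    show "W w \<le> 1"
    proof (cases "G w \<le> \<delta>")
      case True
      then have Gw: "G w = \<delta>" using clX w by auto
      then have nw: "norm w \<le> R" using R(3)[of w] \<delta>(2) by simp
      have "root4 (norm (B w * ?Q w)) \<le> root4 ((2 * R) ^ g) * Re (?M w)"
        by (rule majorant_props(2)[OF k supp mass wK nw R(2) R(1)])
      moreover have "root4 (exp (q * \<delta>)) \<le> exp 1"
      proof -
        have "q * \<delta> \<le> \<bar>q\<bar> * \<delta>" using \<delta>(1) by (intro mult_right_mono) auto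
        then have "q * \<delta> / 4 \<le> 1" using \<delta>(4) by linarith
        then show ?thesis unfolding root4_exp by simp
      qed
      ultimately have "root4 (norm (B w * ?Q w)) * root4 (exp (q * \<delta>)) \<le> (root4 ((2 * R) ^ g) * Re (?M w)) * exp 1"
        using root4_simps(1)[of "exp (q * \<delta>)"] root4_simps(1)[OF norm_ge_zero, of "B w * ?Q w"]
        by (intro mult_mono) auto
      then have "W w \<le> 0" unfolding W_def Gw P_def by (simp add: root4_simps(2) mult_ac)
      then show ?thesis by simp
    next
      case False
      then have nw: "norm w = R2" using clX w unfolding X_def by auto
      have w1: "norm w \<ge> 1" using nw R2(1) BR(1) by simp
      define y where "y = ln (norm w)"
      have ey: "norm w = exp y" unfolding y_def using w1 by (subst exp_ln) auto
      have "norm (B w) \<le> (\<Prod>j\<le>g. 2 * norm w)"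
        unfolding B_def prod_norm[symmetric]
      proof (rule prod_mono)
        fix j assume "j \<in> {..g}"
        then have "b j \<in> S" using interval_subset[of j "b j"] ab[of j] by simp
        then show "0 \<le> norm (w - of_real (b j)) \<and> norm (w - of_real (b j)) \<le> 2 * norm w"
          using norm_triangle_ineq4[of w "of_real (b j)"] R(2)[of "b j"] R(1) nw R2(2) by auto
      qed
      also have "\<dots> = 2 ^ (g + 1) * exp ((real g + 1) * y)"
        unfolding ey by (simp add: power_mult_distrib exp_add distrib_right flip: exp_of_nat_mult)
      finally have 1: "norm (B w) \<le> 2 ^ (g + 1) * exp ((real g + 1) * y)" .
      have "norm (?Q w) \<le> (\<integral>x. \<bar>k x\<bar> \<partial>lborel) * (2 * R ^ l) / norm w ^ (l + 1)"
        using cauchy_int_decay[OF k supp closed_S _ R(2) _ orth, of w] R(1) nw R2(2) by simp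
      also have "\<dots> \<le> 1 * (2 * R ^ l) / norm w ^ (l + 1)"
        using mass R(1) w1 by (intro divide_right_mono mult_right_mono) auto
      also have "\<dots> = (2 * R ^ l) * exp (- (real l + 1) * y)"
      proof -
        have "- (real l + 1) * y = - (real (l + 1) * y)" by (simp add: algebra_simps)
        then show ?thesis unfolding ey exp_of_nat_mult[symmetric] by (simp only: exp_minus) (simp add: divide_inverse)
      qed
      finally have 2: "norm (?Q w) \<le> (2 * R ^ l) * exp (- (real l + 1) * y)" .
      have "\<bar>G w - y\<bar> \<le> B0" using BR(3)[of w] nw R2(1) unfolding y_def by simp
      then have "\<bar>q\<bar> * \<bar>G w - y\<bar> \<le> \<bar>q\<bar> * B0" by (intro mult_left_mono) auto
      then have "q * (G w - y) \<le> \<bar>q\<bar> * B0" using abs_ge_self[of "q * (G w - y)"] by (simp add: abs_mult)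
      then have 3: "exp (q * G w) \<le> exp (\<bar>q\<bar> * B0 + q * y)" by (simp add: algebra_simps)
      have "norm (B w * ?Q w) * exp (q * G w)
          \<le> (2 ^ (g + 1) * exp ((real g + 1) * y)) * ((2 * R ^ l) * exp (- (real l + 1) * y)) * exp (\<bar>q\<bar> * B0 + q * y)"
        unfolding norm_mult using 1 2 3 R(1) by (intro mult_mono) auto
      also have "\<dots> = c * (exp ((real g + 1) * y) * exp (- (real l + 1) * y) * exp (q * y))"
        unfolding c_def by (simp add: exp_add)
      also have "exp ((real g + 1) * y) * exp (- (real l + 1) * y) * exp (q * y) = exp (- y)"
        unfolding q_def mult_exp_exp by (simp add: algebra_simps)
      also have "c * exp (- y) = c / R2" using nw ey by (simp add: exp_minus divide_simps)
      also have "\<dots> \<le> 1" using R2(1,3) BR(1) by (simp add: divide_le_eq)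
      finally have "root4 (norm (B w * ?Q w) * exp (q * G w)) \<le> root4 1" by (rule root4_mono)
      then show ?thesis using W1 wK by (simp add: root4_simps)
    qed
  next
    fix w assume w: "w \<in> X" "W w > 1"
    then have wK: "w \<notin> ?K" using clK closure_subset by blast
    obtain r F where r: "r > 0" "ball w r \<subseteq> - ?K" "F holomorphic_on ball w r"
      "\<And>x. x \<in> ball w r \<Longrightarrow> G x = Re (F x)"
      using local_holomorphic[OF wK] by metis
    have ne: "B w * ?Q w \<noteq> 0"
    proof
      assume "B w * ?Q w = 0"
      then show False using W1[OF _ wK] w(2) by (auto simp: root4_simps)
    qed
    show "harmonic_minorant_at W w"
    proof (rule harmonic_minorant_at_fourth_root[where r = r
          and f = "\<lambda>x. B x * ?Q x * exp (of_real q * F x)" and F = "\<lambda>x. of_real P * ?M x"])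
      show "(\<lambda>x. B x * ?Q x * exp (of_real q * F x)) holomorphic_on ball w r"
        by (intro holomorphic_intros holB r(3) holomorphic_on_subset[OF holQ r(2)])
      show "(\<lambda>x. of_real P * ?M x) holomorphic_on ball w r"
        by (intro holomorphic_intros holomorphic_on_subset[OF holM r(2)])
      show "W x = sqrt (sqrt (norm (B x * ?Q x * exp (of_real q * F x)))) - Re (of_real P * ?M x)"
        if "x \<in> ball w r" for x
        unfolding W_def root4_def using r(4)[OF that] by (simp add: norm_mult)
    qed (use ne r(1) in auto)
  qed
  then show ?thesis unfolding W_def P_def by simp
qed

text \<open>What is kept of p_l w: support, mass at most 1 and the vanishing moments. The constants
  below are chosen before l and k, so one constant serves all degrees.\<close>

definition orthogonal_density :: "nat \<Rightarrow> (real \<Rightarrow> real) \<Rightarrow> bool" where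
  "orthogonal_density l k \<longleftrightarrow> integrable lborel k \<and> (\<forall>x. x \<notin> S \<longrightarrow> k x = 0) \<and>
     (\<integral>x. \<bar>k x\<bar> \<partial>lborel) \<le> 1 \<and> (\<forall>i<l. (\<integral>x. k x * x ^ i \<partial>lborel) = 0)"

text \<open>On C the majorant is bounded through the distance d to the intervals, and |B| is at
  least d^(g+1). The fourth power undoes the root, and trading q = l - g - 1 for l costs exp((g+1)
  G), at most exp((g+1) m) on C.\<close>

theorem second_kind_bound:
  assumes C: "compact C" "\<And>z. z \<in> C \<Longrightarrow> G z > 0"
  obtains c where "c > 0" "\<And>k l z. \<lbrakk>orthogonal_density l k; z \<in> C\<rbrakk>
      \<Longrightarrow> norm (cauchy_int k z) \<le> c * exp (- (real l * G z))"
proof -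
  obtain R1 where R1: "R1 \<ge> 1" "\<And>x. x \<in> S \<Longrightarrow> \<bar>x\<bar> \<le> R1" by (rule S_bound) blast
  have "bounded ({z. G z \<le> 1} \<union> C)" using bounded_sublevel[of 1] compact_imp_bounded[OF C(1)] by simp
  then obtain R2 where R2: "\<And>z. z \<in> {z. G z \<le> 1} \<union> C \<Longrightarrow> norm z \<le> R2" unfolding bounded_iff by blast
  define R where "R = max R1 R2"
  have R: "R \<ge> 1" "\<And>x. x \<in> S \<Longrightarrow> \<bar>x\<bar> \<le> R" "\<And>z. G z \<le> 1 \<Longrightarrow> norm z \<le> R" "\<And>z. z \<in> C \<Longrightarrow> norm z \<le> R"
    using R1 R2 unfolding R_def by (auto simp: le_max_iff_disj)
  have "C \<inter> complex_of_real ` S = {}" using C(2) pos_notin by blast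
  then obtain d where d: "d > 0" "\<And>z x. z \<in> C \<Longrightarrow> x \<in> S \<Longrightarrow> d \<le> norm (z - of_real x)"
    using separate_compact_closed[OF C(1) compact_imp_closed[OF compact_K]] unfolding dist_norm by blast
  have "bounded (G ` C)" using compact_continuous_image[OF continuous_on C(1)] compact_imp_bounded by blast
  then obtain m where m: "\<And>z. z \<in> C \<Longrightarrow> G z \<le> m" unfolding bounded_iff by (auto intro: order_trans[OF abs_ge_self])
  define P where "P = exp 1 * root4 ((2 * R) ^ g)"
  define t where "t = P * ((g + 1) * (2 * (2 * root4 (1 + 2 * R / d) + 1))) + 1"
  have P0: "P \<ge> 0" unfolding P_def using R(1) by (simp add: root4_simps)
  have "0 \<le> root4 (1 + 2 * R / d)" using R(1) d(1) by (intro root4_simps) auto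
  then have t: "t \<ge> 1" unfolding t_def using P0 by simp
  define c where "c = t ^ 4 / d ^ (g + 1) * exp ((real g + 1) * m)"
  show ?thesis
  proof (rule that)
    show "c > 0" unfolding c_def using t d(1) by (intro mult_pos_pos divide_pos_pos zero_less_power) auto
    fix k l z
    assume "orthogonal_density l k" and z: "z \<in> C"
    then have k: "integrable lborel k" and supp: "\<And>x. x \<notin> S \<Longrightarrow> k x = 0"
      and mass: "(\<integral>x. \<bar>k x\<bar> \<partial>lborel) \<le> 1"
      and orth: "\<And>i. i < l \<Longrightarrow> (\<integral>x. k x * x ^ i \<partial>lborel) = 0"
      unfolding orthogonal_density_def by blast+
    define q where "q = real l - real g - 1"
    let ?Q = "cauchy_int k"
    have "root4 (norm (B z * ?Q z) * exp (q * G z)) \<le> P * Re (majorant k z) + 1"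
      unfolding P_def q_def by (rule second_kind_comparison[OF k supp mass orth R(1,2,3) C(2)[OF z]])
    also have "\<dots> \<le> t" unfolding t_def
      using majorant_props(4)[OF k supp mass d(1) d(2)[OF z] R(4)[OF z] R(2)] P0
      by (intro add_right_mono mult_left_mono) auto
    finally have "root4 (norm (B z * ?Q z) * exp (q * G z)) ^ 4 \<le> t ^ 4"
      by (intro power_mono) (auto simp: root4_simps(1))
    then have 1: "norm (B z) * norm (?Q z) * exp (q * G z) \<le> t ^ 4"
      by (simp add: root4_power norm_mult)
    have "d ^ (g + 1) = (\<Prod>j\<le>g. d)" by simp
    also have "\<dots> \<le> norm (B z)" unfolding B_def prod_norm[symmetric]
    proof (rule prod_mono)
      fix j assume "j \<in> {..g}"
      then have "b j \<in> S" using interval_subset[of j "b j"] ab[of j] by simp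
      then show "0 \<le> d \<and> d \<le> norm (z - of_real (b j))" using d z by auto
    qed
    finally have "d ^ (g + 1) * (norm (?Q z) * exp (q * G z)) \<le> norm (B z) * (norm (?Q z) * exp (q * G z))"
      by (intro mult_right_mono) auto
    then have "norm (?Q z) * exp (q * G z) \<le> t ^ 4 / d ^ (g + 1)"
      using 1 d(1) by (simp add: le_divide_eq mult_ac)
    then have "norm (?Q z) * exp (q * G z) * exp (- (q * G z)) \<le> t ^ 4 / d ^ (g + 1) * exp (- (q * G z))"
      by (intro mult_right_mono) auto
    moreover have "norm (?Q z) * exp (q * G z) * exp (- (q * G z)) = norm (?Q z)"
      by (simp add: mult.assoc flip: exp_add)
    ultimately have "norm (?Q z) \<le> t ^ 4 / d ^ (g + 1) * exp (- (q * G z))" by simp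
    also have "exp (- (q * G z)) = exp ((real g + 1) * G z) * exp (- (real l * G z))"
      unfolding q_def mult_exp_exp by (simp add: algebra_simps)
    also have "t ^ 4 / d ^ (g + 1) * \<dots> \<le> t ^ 4 / d ^ (g + 1) * (exp ((real g + 1) * m) * exp (- (real l * G z)))"
      using m[OF z] d(1) t by (intro mult_left_mono mult_right_mono) (auto intro!: mult_left_mono)
    finally show "norm (?Q z) \<le> c * exp (- (real l * G z))" unfolding c_def by (simp add: mult_ac)
  qed
qed

end

section \<open>Logarithmic derivatives\<close>

text \<open>Supplies the one-variable factor whose product in Re z and Im z will dominate the
  inverse modulus.\<close>

lemma integrable_inverse_sqrt_abs:
  obtains \<phi> :: "real \<Rightarrow> real" where "integrable lborel \<phi>" "\<And>x. \<phi> x \<ge> 0"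
    "\<And>x. x \<noteq> 0 \<Longrightarrow> \<bar>x\<bar> \<le> R \<Longrightarrow> 1 / sqrt \<bar>x\<bar> \<le> \<phi> x"
proof -
  define f where "f x = indicator {0..\<bar>R\<bar>} x * x powr (-1/2)" for x :: real
  have [measurable]: "f \<in> borel_measurable borel" unfolding f_def by measurable
  have f0: "f x \<ge> 0" for x unfolding f_def by simp
  have "((\<lambda>x. x powr (-1/2)) has_integral (\<bar>R\<bar> powr (-1/2 + 1) / (-1/2 + 1))) {0..\<bar>R\<bar>}"
    by (rule has_integral_powr_from_0) auto
  then have "integral\<^sup>N lborel (\<lambda>x. indicator {0..\<bar>R\<bar>} x * x powr (-1/2)) = ennreal (\<bar>R\<bar> powr (-1/2 + 1) / (-1/2 + 1))"
    by (rule nn_integral_has_integral_lebesgue[rotated]) simp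
  then have "integral\<^sup>N lborel f < \<infinity>" unfolding f_def by simp
  then have f: "integrable lborel f" using f0 by (intro integrableI_bounded) auto
  have f': "integrable lborel (\<lambda>x. f (- x))"
    using lborel_integrable_real_affine[OF f, of "-1" 0] by simp
  show ?thesis
  proof (rule that[of "\<lambda>x. f x + f (- x)"])
    show "integrable lborel (\<lambda>x. f x + f (- x))" using f f' by simp
    show "1 / sqrt \<bar>x\<bar> \<le> f x + f (- x)" if x: "x \<noteq> 0" "\<bar>x\<bar> \<le> R" for x
    proof -
      have "1 / sqrt \<bar>x\<bar> = \<bar>x\<bar> powr (-1/2)"
        using x by (simp add: powr_minus_divide powr_half_sqrt)
      also have "\<dots> \<le> f x + f (- x)"
        using x f0[of x] f0[of "-x"] unfolding f_def by (cases "x > 0") auto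
      finally show ?thesis .
    qed
  qed (use f0 in auto)
qed

lemma AE_Re_Im_nonzero: "AE z in (lborel :: complex measure). Re z \<noteq> 0 \<and> Im z \<noteq> 0"
proof -
  have "{z::complex. z \<bullet> k = 0} \<in> null_sets lborel" if "k \<in> Basis" for k
  proof -
    have "negligible {z::complex. z \<bullet> k = 0}" using negligible_standard_hyperplane[OF that] .
    moreover have "closed {z::complex. z \<bullet> k = 0}" by (intro closed_Collect_eq continuous_intros)
    ultimately show ?thesis
      unfolding negligible_iff_null_sets by (subst (asm) null_sets_completion_iff) auto
  qed
  from this[of 1] this[of \<i>] have "{z. Re z = 0} \<in> null_sets lborel" "{z. Im z = 0} \<in> null_sets lborel"
    by (auto simp: inner_complex_def)
  then show ?thesis by (auto dest!: AE_not_in elim!: eventually_elim2)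
qed

text \<open>Since |Re z| |Im z| <= |z|^2, off the axes 1/|z| is at most |Re z|^(-1/2) |Im z|^(-1/2),
  and Fubini applies to the product. Translation moves the pole to \<xi>.\<close>

lemma integrable_inverse_norm:
  fixes \<xi> :: complex
  shows "integrable lborel (\<lambda>z. indicator (cball 0 R) z / norm (z - \<xi>))"
proof -
  \<comment> \<open>Enlarged by norm \<xi> so that the translated ball still covers the original
    one.\<close>
  define R' where "R' = \<bar>R\<bar> + norm \<xi>"
  obtain \<phi> :: "real \<Rightarrow> real" where \<phi>: "integrable lborel \<phi>" "\<And>x. \<phi> x \<ge> 0"
    "\<And>x. x \<noteq> 0 \<Longrightarrow> \<bar>x\<bar> \<le> R' \<Longrightarrow> 1 / sqrt \<bar>x\<bar> \<le> \<phi> x"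
    by (rule integrable_inverse_sqrt_abs[of R']) blast
  have [measurable]: "\<phi> \<in> borel_measurable borel" using \<phi>(1) by simp
  have cC: "continuous_on UNIV (\<lambda>(x, y). Complex x y)"
    by (auto simp: Complex_eq case_prod_unfold intro!: continuous_intros)
  have meas: "(\<lambda>(x, y). Complex x y) \<in> measurable lborel borel"
    using borel_measurable_continuous_onI[OF cC] by simp
  have "integrable (lborel \<Otimes>\<^sub>M lborel) (\<lambda>(x, y). \<phi> x * \<phi> y)"
    using \<phi>(1,2) by (intro lborel_pair.Fubini_integrable) (auto simp: abs_mult)
  then have "integrable lborel (\<lambda>z. \<phi> (Re z) * \<phi> (Im z))"
    unfolding lborel_complex lborel_prod by (subst integrable_distr_eq[OF meas]) (auto simp: case_prod_unfold)
  then have "integrable lborel (\<lambda>z::complex. indicator (cball 0 R') z / norm z)"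
  proof (rule Bochner_Integration.integrable_bound)
    show "AE z in lborel. norm (indicator (cball 0 R') z / norm z) \<le> norm (\<phi> (Re z) * \<phi> (Im z))"
    proof (rule eventually_mono[OF AE_Re_Im_nonzero])
      fix z :: complex assume z: "Re z \<noteq> 0 \<and> Im z \<noteq> 0"
      show "norm (indicator (cball 0 R') z / norm z) \<le> norm (\<phi> (Re z) * \<phi> (Im z))"
      proof (cases "z \<in> cball 0 R'")
        case True
        then have b: "\<bar>Re z\<bar> \<le> R'" "\<bar>Im z\<bar> \<le> R'"
          using abs_Re_le_cmod[of z] abs_Im_le_cmod[of z] by auto
        have "\<bar>Re z\<bar> * \<bar>Im z\<bar> \<le> norm z * norm z"
          by (intro mult_mono abs_Re_le_cmod abs_Im_le_cmod) auto
        then have "sqrt (\<bar>Re z\<bar> * \<bar>Im z\<bar>) \<le> norm z"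
          by (simp add: real_le_lsqrt power2_eq_square)
        then have "1 / norm z \<le> 1 / sqrt (\<bar>Re z\<bar> * \<bar>Im z\<bar>)"
          using z by (intro divide_left_mono mult_pos_pos) auto
        also have "\<dots> = (1 / sqrt \<bar>Re z\<bar>) * (1 / sqrt \<bar>Im z\<bar>)" by (simp add: real_sqrt_mult)
        also have "\<dots> \<le> \<phi> (Re z) * \<phi> (Im z)"
          using \<phi>(2,3) b z by (intro mult_mono) auto
        finally show ?thesis using True by simp
      qed simp
    qed
  qed (auto intro!: borel_measurable_divide borel_measurable_indicator)
  then have "integrable lborel (\<lambda>z::complex. indicator (cball 0 R') (z - \<xi>) / norm (z - \<xi>))"
    by (subst lborel_distr_plus[of "\<xi>", symmetric]) (simp add: integrable_distr_eq)
  then show ?thesis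
  proof (rule Bochner_Integration.integrable_bound)
    have "indicator (cball 0 R) z \<le> (indicator (cball 0 R') (z - \<xi>) :: real)" for z
      using norm_triangle_ineq4[of z \<xi>] unfolding R'_def indicator_def by auto
    then show "AE z in lborel. norm (indicator (cball 0 R) z / norm (z - \<xi>))
        \<le> norm (indicator (cball 0 R') (z - \<xi>) / norm (z - \<xi>))"
      by (intro AE_I2) (simp add: divide_right_mono)
  qed (auto intro!: borel_measurable_divide borel_measurable_indicator)
qed

text \<open>Each closed half-plane minus the set lies between an open half-plane and its closure,
  hence is connected; the two meet at a real point beyond a bound of S.\<close>

lemma connected_complement_compact_real:
  assumes "bounded S"
  shows "connected (- (complex_of_real ` S))"
proof -
  let ?U = "{z. Im z > 0}" and ?L = "{z. Im z < 0}" and ?K = "complex_of_real ` S"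
  let ?U' = "{z. Im z \<ge> 0} - ?K" and ?L' = "{z. Im z \<le> 0} - ?K"
  have U: "connected ?U" and L: "connected ?L"
    using convex_halfspace_Im_gt[of 0] convex_halfspace_Im_lt[of 0] by (auto intro: convex_connected)
  have cU: "z \<in> closure ?U" if "Im z \<ge> 0" for z
  proof (rule closure_approachable[THEN iffD2], intro allI impI)
    fix e :: real assume "e > 0"
    then show "\<exists>y\<in>?U. dist y z < e"
      using that by (intro bexI[of _ "z + of_real (e / 2) * \<i>"]) (auto simp: dist_norm norm_mult)
  qed
  have cL: "z \<in> closure ?L" if "Im z \<le> 0" for z
  proof (rule closure_approachable[THEN iffD2], intro allI impI)
    fix e :: real assume "e > 0"
    then show "\<exists>y\<in>?L. dist y z < e"
      using that by (intro bexI[of _ "z - of_real (e / 2) * \<i>"]) (auto simp: dist_norm norm_mult)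
  qed
  have cU': "connected ?U'" by (rule connected_intermediate_closure[OF U]) (use cU in auto)
  have cL': "connected ?L'" by (rule connected_intermediate_closure[OF L]) (use cL in auto)
  obtain R where R: "\<And>x. x \<in> S \<Longrightarrow> norm x \<le> R" using assms unfolding bounded_iff by blast
  have "R + 1 \<notin> S" using R[of "R + 1"] by auto
  then have "complex_of_real (R + 1) \<notin> ?K" by (metis imageE of_real_eq_iff)
  moreover have "Im (complex_of_real (R + 1)) = 0" by (rule Im_complex_of_real)
  ultimately have "complex_of_real (R + 1) \<in> ?U' \<inter> ?L'" by (metis (mono_tags, lifting) DiffI IntI mem_Collect_eq order_refl)
  then have "?U' \<inter> ?L' \<noteq> {}" by blast
  then have "connected (?U' \<union> ?L')" by (intro connected_Un cU' cL')
  also have "?U' \<union> ?L' = - ?K" by auto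
  finally show ?thesis .
qed

text \<open>Writing f = (w - \<xi>)^n g with g zero-free gives f'/f = n / (w - \<xi>) + g'/g, the
  last term being bounded on a smaller disc; n = 0 covers the points where f does not
  vanish.\<close>

lemma logarithmic_derivative_bound_local:
  assumes f: "f holomorphic_on X" and X: "open X" "connected X" "\<not> (\<forall>z\<in>X. f z = 0)" and \<xi>: "\<xi> \<in> X"
  obtains r c m where "r > 0" "c \<ge> 0" "m \<ge> 0"
    "\<And>w. w \<in> ball \<xi> r \<Longrightarrow> f w \<noteq> 0 \<Longrightarrow> norm (deriv f w) \<le> (c + m / norm (w - \<xi>)) * norm (f w)"
proof -
  have "\<exists>g r n. 0 < r \<and> ball \<xi> r \<subseteq> X \<and> g holomorphic_on ball \<xi> r \<and>
      (\<forall>w\<in>ball \<xi> r. f w = (w - \<xi>) ^ n * g w) \<and> (\<forall>w\<in>ball \<xi> r. g w \<noteq> 0)"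
  proof (cases "f \<xi> = 0")
    case True
    have "\<not> f constant_on X" using True X(3) \<xi> unfolding constant_on_def by metis
    then show ?thesis
      using holomorphic_factor_zero_nonconstant[OF f X(1,2) \<xi> True] by metis
  next
    case False
    have "isCont f \<xi>" using f X(1) \<xi> holomorphic_on_imp_continuous_on continuous_on_eq_continuous_at by blast
    then obtain e where e: "e > 0" "\<And>w. dist \<xi> w < e \<Longrightarrow> f w \<noteq> 0"
      using continuous_at_avoid[of \<xi> f 0] False by blast
    obtain e' where e': "e' > 0" "ball \<xi> e' \<subseteq> X" using X(1) \<xi> open_contains_ball by blast
    show ?thesis
      using e e' by (intro exI[of _ f] exI[of _ "min e e'"] exI[of _ 0])
        (auto simp: subset_eq intro!: holomorphic_on_subset[OF f])
  qed
  then obtain g r n where gr: "0 < r" "ball \<xi> r \<subseteq> X" "g holomorphic_on ball \<xi> r"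
      "\<And>w. w \<in> ball \<xi> r \<Longrightarrow> f w = (w - \<xi>) ^ n * g w" "\<And>w. w \<in> ball \<xi> r \<Longrightarrow> g w \<noteq> 0"
    by blast
  have sub: "cball \<xi> (r / 2) \<subseteq> ball \<xi> r" using gr(1) by (simp add: cball_subset_ball_iff)
  have "(\<lambda>w. deriv g w / g w) holomorphic_on ball \<xi> r"
    using gr(3,5) by (intro holomorphic_intros) auto
  then have "continuous_on (cball \<xi> (r / 2)) (\<lambda>w. deriv g w / g w)"
    using sub holomorphic_on_imp_continuous_on continuous_on_subset by blast
  then have "bounded ((\<lambda>w. deriv g w / g w) ` cball \<xi> (r / 2))"
    using compact_continuous_image compact_cball compact_imp_bounded by blast
  then obtain c where c: "\<And>w. w \<in> cball \<xi> (r / 2) \<Longrightarrow> norm (deriv g w / g w) \<le> c"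
    unfolding bounded_iff by blast
  show ?thesis
  proof (rule that[of "r / 2" "\<bar>c\<bar>" "real n"])
    fix w assume w: "w \<in> ball \<xi> (r / 2)" "f w \<noteq> 0"
    then have wr: "w \<in> ball \<xi> r" using gr(1) by auto
    have "(g has_field_derivative deriv g w) (at w)"
      using gr(3) wr by (intro holomorphic_derivI[of _ "ball \<xi> r"]) auto
    then have "((\<lambda>w. (w - \<xi>) ^ n * g w) has_field_derivative
        of_nat n * (w - \<xi>) ^ (n - 1) * g w + (w - \<xi>) ^ n * deriv g w) (at w)"
      by (auto intro!: derivative_eq_intros)
    then have "(f has_field_derivative of_nat n * (w - \<xi>) ^ (n - 1) * g w + (w - \<xi>) ^ n * deriv g w) (at w)"
      by (rule has_field_derivative_transform_within_open[of _ _ _ "ball \<xi> r"]) (use gr(4) wr in auto)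
    then have "deriv f w = of_nat n * (w - \<xi>) ^ (n - 1) * g w + (w - \<xi>) ^ n * deriv g w"
      by (rule DERIV_imp_deriv)
    also have "\<dots> = f w * (of_nat n / (w - \<xi>) + deriv g w / g w)"
    proof -
      have "of_nat n * (w - \<xi>) ^ (n - 1) = (w - \<xi>) ^ n * (of_nat n / (w - \<xi>))"
        using w(2) gr(4)[OF wr] by (cases n) auto
      then show ?thesis using gr(4,5)[OF wr] by (simp add: algebra_simps)
    qed
    also have "norm \<dots> \<le> norm (f w) * (norm (of_nat n / (w - \<xi>)) + norm (deriv g w / g w))"
      unfolding norm_mult by (intro mult_left_mono norm_triangle_ineq) auto
    also have "\<dots> \<le> norm (f w) * (real n / norm (w - \<xi>) + \<bar>c\<bar>)"
      using c[of w] w(1) by (intro mult_left_mono add_mono) (auto simp: norm_divide)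
    finally show "norm (deriv f w) \<le> (\<bar>c\<bar> + real n / norm (w - \<xi>)) * norm (f w)"
      by (simp add: mult_ac add_ac)
  qed (use gr(1) in auto)
qed

text \<open>A logarithmic derivative has simple poles, hence is area integrable on compact sets.\<close>
lemma logarithmic_derivative_majorant:
  assumes f: "f holomorphic_on X" and X: "open X" "connected X" "\<not> (\<forall>z\<in>X. f z = 0)"
    and C: "compact C" "C \<subseteq> X"
  obtains J :: "complex \<Rightarrow> real" where "integrable lborel J" "\<And>z. J z \<ge> 0"
    "\<And>z. z \<in> C \<Longrightarrow> f z \<noteq> 0 \<Longrightarrow> norm (deriv f z) \<le> J z * norm (f z)"
proof -
  have "\<forall>\<xi>\<in>X. \<exists>r c m. r > 0 \<and> c \<ge> 0 \<and> m \<ge> 0 \<and> (\<forall>w\<in>ball \<xi> r. f w \<noteq> 0 \<longrightarrow>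
      norm (deriv f w) \<le> (c + m / norm (w - \<xi>)) * norm (f w))"
    by (metis logarithmic_derivative_bound_local[OF f X])
  then obtain r c m where rcm: "\<And>\<xi>. \<xi> \<in> X \<Longrightarrow> r \<xi> > 0" "\<And>\<xi>. \<xi> \<in> X \<Longrightarrow> c \<xi> \<ge> (0::real)"
      "\<And>\<xi>. \<xi> \<in> X \<Longrightarrow> m \<xi> \<ge> (0::real)"
      "\<And>\<xi> w. \<xi> \<in> X \<Longrightarrow> w \<in> ball \<xi> (r \<xi>) \<Longrightarrow> f w \<noteq> 0 \<Longrightarrow>
        norm (deriv f w) \<le> (c \<xi> + m \<xi> / norm (w - \<xi>)) * norm (f w)"
    by metis
  obtain I where I: "I \<subseteq> C" "finite I" "C \<subseteq> (\<Union>\<xi>\<in>I. ball \<xi> (r \<xi>))"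
  proof (rule compactE_image[OF C(1), of C "\<lambda>\<xi>. ball \<xi> (r \<xi>)"])
    show "C \<subseteq> (\<Union>\<xi>\<in>C. ball \<xi> (r \<xi>))" using rcm(1) C(2) by force
  qed auto
  obtain R where R: "\<And>z. z \<in> C \<Longrightarrow> norm z \<le> R"
    using compact_imp_bounded[OF C(1)] unfolding bounded_iff by blast
  define J where "J z = (\<Sum>\<xi>\<in>I. c \<xi> * indicator (cball 0 R) z + m \<xi> * (indicator (cball 0 R) z / norm (z - \<xi>)))" for z
  have IX: "I \<subseteq> X" using I(1) C(2) by blast
  show ?thesis
  proof (rule that)
    have "integrable lborel (\<lambda>z::complex. indicator (cball 0 R) z :: real)"
      by (intro integrable_real_indicator emeasure_bounded_finite bounded_cball) simp
    then show "integrable lborel J" unfolding J_def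
      by (intro Bochner_Integration.integrable_sum Bochner_Integration.integrable_add
          integrable_mult_right integrable_inverse_norm)
    have term0: "0 \<le> c \<xi> * indicator (cball 0 R) z + m \<xi> * (indicator (cball 0 R) z / norm (z - \<xi>))"
      if "\<xi> \<in> I" for \<xi> z using rcm(2,3) IX that by (intro add_nonneg_nonneg mult_nonneg_nonneg) auto
    then show "J z \<ge> 0" for z unfolding J_def by (intro sum_nonneg)
    fix z assume z: "z \<in> C" "f z \<noteq> 0"
    then obtain \<xi> where \<xi>: "\<xi> \<in> I" "z \<in> ball \<xi> (r \<xi>)" using I(3) by blast
    have "norm (deriv f z) \<le> (c \<xi> + m \<xi> / norm (z - \<xi>)) * norm (f z)"
      using rcm(4)[of \<xi> z] \<xi> IX z(2) by blast
    also have "c \<xi> + m \<xi> / norm (z - \<xi>) = c \<xi> * indicator (cball 0 R) z + m \<xi> * (indicator (cball 0 R) z / norm (z - \<xi>))"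
      using R[OF z(1)] by simp
    also have "\<dots> \<le> J z" unfolding J_def using term0 by (intro member_le_sum[OF \<xi>(1)] I(2)) auto
    finally show "norm (deriv f z) \<le> J z * norm (f z)" by (simp add: mult_right_mono)
  qed
qed

section \<open>Total variation of the level layers\<close>

context interval_green
begin

text \<open>Twice the z-derivative of G, so \<open>cnj (E z)\<close> is its gradient. It is defined
  pointwise because a global F with G = Re F is in general multivalued around the intervals.\<close>

definition E :: "complex \<Rightarrow> complex" where
  "E z = (SOME e. (G has_derivative (\<lambda>d. Re (e * d))) (at z))"

lemma open_complement: "open (- (complex_of_real ` S))"
  using compact_imp_closed[OF compact_K] by blast

lemma E_local:
  assumes "z \<notin> complex_of_real ` S"
  obtains r F where "r > 0" "ball z r \<subseteq> - (complex_of_real ` S)" "F holomorphic_on ball z r"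
    "\<And>w. w \<in> ball z r \<Longrightarrow> (G has_derivative (\<lambda>d. Re (E w * d))) (at w)"
    "\<And>w. w \<in> ball z r \<Longrightarrow> E w = deriv F w"
proof -
  obtain r F where r: "r > 0" "ball z r \<subseteq> - (complex_of_real ` S)" "F holomorphic_on ball z r"
      "\<And>w. w \<in> ball z r \<Longrightarrow> G w = Re (F w)"
    using local_holomorphic[OF assms] by metis
  have der: "(G has_derivative (\<lambda>d. Re (deriv F w * d))) (at w)" if w: "w \<in> ball z r" for w
  proof -
    have "(F has_field_derivative deriv F w) (at w)"
      using r(3) w by (intro holomorphic_derivI[of _ "ball z r"]) auto
    then have "((\<lambda>w. Re (F w)) has_derivative (\<lambda>d. Re (deriv F w * d))) (at w)"
      by (rule has_derivative_Re_holomorphic)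
    then show ?thesis
      by (rule has_derivative_transform_within_open[of _ _ _ _ "ball z r"]) (use r(4) w in auto)
  qed
  have derE: "(G has_derivative (\<lambda>d. Re (E w * d))) (at w)" if "w \<in> ball z r" for w
    unfolding E_def by (rule someI) (rule der[OF that])
  show ?thesis
  proof (rule that[OF r(1-3) derE])
    fix w assume w: "w \<in> ball z r"
    have "(\<lambda>d. Re (E w * d)) = (\<lambda>d. Re (deriv F w * d))"
      using has_derivative_unique[OF derE[OF w] der[OF w]] .
    from fun_cong[OF this, of 1] fun_cong[OF this, of \<i>] show "E w = deriv F w"
      by (simp add: complex_eq_iff)
  qed
qed

lemma G_derivative: "z \<notin> complex_of_real ` S \<Longrightarrow> (G has_derivative (\<lambda>d. Re (E z * d))) (at z)"
  by (metis E_local centre_in_ball)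

lemma E_holomorphic: "E holomorphic_on - (complex_of_real ` S)"
  unfolding holomorphic_on_open[OF open_complement]
proof
  fix z assume "z \<in> - (complex_of_real ` S)"
  then obtain r F where r: "r > 0" "ball z r \<subseteq> - (complex_of_real ` S)" "F holomorphic_on ball z r"
    "\<And>w. w \<in> ball z r \<Longrightarrow> E w = deriv F w"
    using E_local[of z] by (metis ComplD)
  have "deriv F holomorphic_on ball z r" using r(3) by (intro holomorphic_deriv) auto
  then have "E holomorphic_on ball z r" using r(4) holomorphic_cong[OF refl, of "ball z r" E "deriv F"] by simp
  then show "\<exists>f'. (E has_field_derivative f') (at z)"
    using r(1) holomorphic_derivI[of E "ball z r" z] by auto
qed

text \<open>Otherwise G would be constant on the connected complement, against its growth at
  infinity. Hence the zeros of \<open>E\<close> are isolated and of finite order, as the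
  integrability of its logarithmic derivative demands.\<close>

lemma E_nonzero: "\<not> (\<forall>z\<in>- (complex_of_real ` S). E z = 0)"
proof
  assume *: "\<forall>z\<in>- (complex_of_real ` S). E z = 0"
  have conn: "connected (- (complex_of_real ` S))"
    using connected_complement_compact_real compact_imp_bounded[OF compact_S] by blast
  have eq: "G x = G y" if "x \<in> - (complex_of_real ` S)" "y \<in> - (complex_of_real ` S)" for x y
  proof (rule has_derivative_zero_unique_connected[OF open_complement conn _ that])
    fix z assume "z \<in> - (complex_of_real ` S)"
    then show "(G has_derivative (\<lambda>x. 0)) (at z)" using G_derivative[of z] * by simp
  qed
  have "\<i> \<in> - (complex_of_real ` S)" by (auto simp: complex_eq_iff)
  then have "G z \<le> G \<i>" if "z \<in> - (complex_of_real ` S)" for z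
    by (rule eq_refl[OF eq[OF that]])
  then have "- (complex_of_real ` S) \<subseteq> {z. G z \<le> G \<i>}" by blast
  then have "bounded (- (complex_of_real ` S))" using bounded_sublevel bounded_subset by blast
  then have "bounded (- (complex_of_real ` S) \<union> complex_of_real ` S)"
    using compact_imp_bounded[OF compact_K] by (simp only: bounded_Un)
  moreover have "- (complex_of_real ` S) \<union> complex_of_real ` S = UNIV" by blast
  ultimately show False using not_bounded_UNIV[where 'a = complex] by metis
qed

text \<open>\<open>E\<close> carries no information on the intervals; expressions containing it
  become continuous on the plane through cutoffs that make them constant on some {G < t} around the
  intervals.\<close>

lemma continuous_glue:
  fixes q :: "complex \<Rightarrow> 'b::topological_space"
  assumes "t > 0" "continuous_on (- (complex_of_real ` S)) q" "\<And>z. G z < t \<Longrightarrow> q z = c"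
  shows "continuous_on UNIV q"
proof -
  have "continuous_on {z. G z < t} q"
    by (rule continuous_on_eq[OF continuous_on_const[of _ c]]) (use assms(3) in auto)
  then have "continuous_on (- (complex_of_real ` S) \<union> {z. G z < t}) q"
    by (intro continuous_on_open_Un assms(2) open_complement open_sublevel)
  also have "- (complex_of_real ` S) \<union> {z. G z < t} = UNIV" using zero assms(1) by auto
  finally show ?thesis .
qed

text \<open>Minus the derivative in G of the cutoff \<open>step ((t - s - G) / s)\<close>. Thus
  \<open>dlayer t s z * norm (E z)\<close> is the length of the gradient of the cutoff, and its
  integral the total variation.\<close>

definition dlayer :: "real \<Rightarrow> real \<Rightarrow> complex \<Rightarrow> real" where
  "dlayer t s z = dstep ((t - s - G z) / s) / s"

lemma dlayer_nonneg: "s > 0 \<Longrightarrow> dlayer t s z \<ge> 0"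
  unfolding dlayer_def by (simp add: step_simps)

lemma dlayer_support:
  assumes "s > 0" "dlayer t s z \<noteq> 0" shows "t - 2 * s < G z" "G z < t - s"
proof -
  have "\<not> (t - s - G z) / s \<le> 0" "\<not> (t - s - G z) / s \<ge> 1"
    using assms(2) step_simps(5,6) unfolding dlayer_def by auto
  then show "t - 2 * s < G z" "G z < t - s" using assms(1) by (auto simp: field_simps)
qed

lemma dlayer_continuous: "continuous_on X (dlayer t s)"
  unfolding dlayer_def[abs_def]
  by (cases "s = 0") (auto intro!: continuous_intros continuous_on_compose2[OF continuous_dstep[of UNIV]] continuous_on)

text \<open>The total variation of the cutoffs \<open>step ((t - s - G) / s)\<close> is bounded uniformly in \<open>s\<close>,
  even if \<open>{G = t}\<close> contains critical points: test with the (regularised) unit vector field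
  \<open>E / |E|\<close>, whose divergence is controlled by \<open>|E' / E|\<close>.\<close>
lemma layer_variation:
  assumes t: "t > 0"
  obtains V where "\<And>s. 0 < s \<Longrightarrow> s \<le> t / 4 \<Longrightarrow> (\<integral>z. dlayer t s z * norm (E z) \<partial>lborel) \<le> V"
proof -
  let ?K = "complex_of_real ` S"
  define L where "L = {z. t / 4 \<le> G z \<and> G z \<le> t}"
  have L: "compact L" unfolding L_def by (rule compact_level)
  have LK: "L \<subseteq> - ?K" unfolding L_def using zero t by force
  have conn: "connected (- ?K)"
    using connected_complement_compact_real compact_imp_bounded[OF compact_S] by blast
  obtain J where J: "integrable lborel J" "\<And>z. J z \<ge> 0"
      "\<And>z. z \<in> L \<Longrightarrow> E z \<noteq> 0 \<Longrightarrow> norm (deriv E z) \<le> J z * norm (E z)"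
    by (rule logarithmic_derivative_majorant[OF E_holomorphic open_complement conn E_nonzero L LK]) blast
  have contE: "continuous_on (- ?K) E" using E_holomorphic holomorphic_on_imp_continuous_on by blast
  have contE': "continuous_on (- ?K) (deriv E)"
    using holomorphic_deriv[OF E_holomorphic open_complement] holomorphic_on_imp_continuous_on by blast
  have "bounded (E ` L)"
    using compact_continuous_image[OF continuous_on_subset[OF contE LK] L] compact_imp_bounded by blast
  then obtain mE where mE: "\<And>z. z \<in> L \<Longrightarrow> norm (E z) \<le> mE" unfolding bounded_iff by blast
  have "bounded (dstep ` {0..1})"
    using compact_continuous_image[OF continuous_dstep] compact_imp_bounded by blast
  then obtain D where D0: "\<And>x. x \<in> {0..1} \<Longrightarrow> norm (dstep x) \<le> D" unfolding bounded_iff by blast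
  have D: "\<bar>dstep x\<bar> \<le> \<bar>D\<bar>" for x
    using D0[of x] step_simps(5,6)[of x] by (cases "x \<in> {0..1}") auto
  obtain R where R: "\<And>z. G z \<le> t \<Longrightarrow> norm z \<le> R" using bounded_sublevel[of t] unfolding bounded_iff by blast
  \<comment> \<open>A majorant independent of s and \<epsilon>: the first summand covers the inner
    cutoff, fixed at the levels t/4 to t/2, the second dominates half of |E'/E|.\<close>
  define U where "U z = indicator (cball 0 R) z * (\<bar>D\<bar> * (4 / t) * \<bar>mE\<bar> / 2) + J z / 2" for z
  have intU: "integrable lborel U" unfolding U_def using J(1)
    by (intro Bochner_Integration.integrable_add integrable_mult_left integrable_divide integrable_real_indicator
        emeasure_bounded_finite bounded_cball) simp
  define V where "V = (\<integral>z. U z \<partial>lborel)"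
  have main: "(\<integral>z. dlayer t s z * ((norm (E z))\<^sup>2 / sqrt ((norm (E z))\<^sup>2 + \<epsilon>\<^sup>2)) / 2 \<partial>lborel) \<le> V"
    if s: "0 < s" "s \<le> t / 4" and e: "\<epsilon> > 0" for s \<epsilon>
  proof -
    \<comment> \<open>\<omega>1 switches off between the levels t - 2s and t - s, and its derivative
      is the quantity to be estimated; \<omega>2 switches on between t/4 and t/2 and keeps the field
      away from the intervals.\<close>
    define \<omega>1 where "\<omega>1 x = step ((t - s - x) / s)" for x
    define \<omega>2 where "\<omega>2 x = step ((x - t / 4) * (4 / t))" for x
    define \<omega>2' where "\<omega>2' x = dstep ((x - t / 4) * (4 / t)) * (4 / t)" for x
    define \<omega>' where "\<omega>' x = - (dstep ((t - s - x) / s) / s) * \<omega>2 x + \<omega>1 x * \<omega>2' x" for x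
    have der1: "(\<omega>1 has_real_derivative - (dstep ((t - s - x) / s) / s)) (at x)" for x
    proof -
      have "((\<lambda>x. (t - s - x) / s) has_real_derivative - 1 / s) (at x)"
        using s(1) by (auto intro!: derivative_eq_intros)
      from DERIV_chain2[where f = step, OF step_derivative this] show ?thesis
        unfolding \<omega>1_def by simp
    qed
    have der2: "(\<omega>2 has_real_derivative \<omega>2' x) (at x)" for x
    proof -
      have "((\<lambda>x. (x - t / 4) * (4 / t)) has_real_derivative 4 / t) (at x)"
        using t by (auto intro!: derivative_eq_intros)
      from DERIV_chain2[where f = step, OF step_derivative this] show ?thesis
        unfolding \<omega>2_def \<omega>2'_def .
    qed
    have der: "((\<lambda>x. \<omega>1 x * \<omega>2 x) has_real_derivative \<omega>' x) (at x)" for x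
      unfolding \<omega>'_def using DERIV_mult[OF der1 der2] by (simp add: mult_ac add_ac)
    have \<omega>12_cont: "continuous_on X \<omega>1" "continuous_on X \<omega>2" for X
      using der1 der2 by (meson DERIV_isCont continuous_at_imp_continuous_on)+
    have \<omega>'_cont: "continuous_on X \<omega>'" for X
      unfolding \<omega>'_def \<omega>2'_def
      using s(1) t by (intro continuous_intros \<omega>12_cont continuous_on_compose2[OF continuous_dstep[of UNIV]]) auto
    have low: "\<omega>1 x * \<omega>2 x = 0" "\<omega>' x = 0" "\<omega>2 x = 0" "\<omega>2' x = 0" if "x \<le> t / 4" for x
    proof -
      have "(x - t / 4) * (4 / t) \<le> 0" using that t by (intro mult_nonpos_nonneg) auto
      then show "\<omega>2 x = 0" "\<omega>2' x = 0" unfolding \<omega>2_def \<omega>2'_def by (simp_all add: step_simps)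
      then show "\<omega>1 x * \<omega>2 x = 0" "\<omega>' x = 0" unfolding \<omega>'_def by simp_all
    qed
    have high: "\<omega>1 x * \<omega>2 x = 0" "\<omega>' x = 0" "\<omega>1 x = 0" if "x \<ge> t - s" for x
    proof -
      have "(t - s - x) / s \<le> 0" using that s by (intro divide_nonpos_pos) auto
      then show "\<omega>1 x * \<omega>2 x = 0" "\<omega>' x = 0" "\<omega>1 x = 0" unfolding \<omega>1_def \<omega>'_def by (simp_all add: step_simps)
    qed
    have bnd: "\<bar>\<omega>1 x\<bar> \<le> 1" "\<bar>\<omega>2 x\<bar> \<le> 1" for x unfolding \<omega>1_def \<omega>2_def
      by (simp_all add: abs_of_nonneg[OF step_simps(3)] step_simps(4))
    \<comment> \<open>The layer starts at t - 2s >= t/2, where \<omega>2 has already reached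
      1.\<close>
    have layer: "dstep ((t - s - x) / s) / s * \<omega>2 x = dstep ((t - s - x) / s) / s" for x
    proof (cases "(t - s - x) / s \<ge> 1")
      case False
      then have "x \<ge> t / 2" using s by (simp add: field_simps)
      then have "(x - t / 4) * (4 / t) \<ge> (t / 4) * (4 / t)" using t by (intro mult_right_mono) auto
      then have "\<omega>2 x = 1" unfolding \<omega>2_def using t by (simp add: step_simps)
      then show ?thesis by simp
    qed (simp add: step_simps)
    \<comment> \<open>E times \<kappa>(|E|^2) is E / |E| smoothed by \<epsilon>, continuously
      differentiable also at the zeros of E.\<close>
    define \<kappa> where "\<kappa> x = 1 / sqrt (x + \<epsilon>\<^sup>2)" for x
    define \<kappa>' where "\<kappa>' x = - (1 / (2 * (x + \<epsilon>\<^sup>2) * sqrt (x + \<epsilon>\<^sup>2)))" for x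
    have pos: "x + \<epsilon>\<^sup>2 > 0" if "x \<ge> 0" for x using that e by (simp add: add_nonneg_pos)
    have der\<kappa>: "(\<kappa> has_real_derivative \<kappa>' x) (at x)" if "x \<ge> 0" for x
    proof -
      have "((\<lambda>x. 1 / sqrt (x + \<epsilon>\<^sup>2)) has_real_derivative \<kappa>' x) (at x)"
        unfolding \<kappa>'_def using pos[OF that]
        by (auto intro!: derivative_eq_intros simp: divide_simps)
      then show ?thesis by (simp add: \<kappa>_def[abs_def])
    qed
    let ?n = "\<lambda>z. (norm (E z))\<^sup>2"
    let ?\<omega> = "\<lambda>z. \<omega>1 (G z) * \<omega>2 (G z)"
    define h where "h z = of_real (?\<omega> z) * (E z * of_real (\<kappa> (?n z)))" for z
    define p where "p z = (of_real (\<omega>' (G z)) * E z / 2) * (E z * of_real (\<kappa> (?n z)))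
        + of_real (?\<omega> z) * (deriv E z * of_real (\<kappa> (?n z)) + E z * (of_real (\<kappa>' (?n z)) * (2 * cnj (E z) * deriv E z) / 2))" for z
    define q where "q z = (of_real (\<omega>' (G z)) * cnj (E z) / 2) * (E z * of_real (\<kappa> (?n z)))
        + of_real (?\<omega> z) * (0 * of_real (\<kappa> (?n z)) + E z * (of_real (\<kappa>' (?n z)) * cnj (2 * cnj (E z) * deriv E z) / 2))" for z
    have wirt: "has_wirtinger h (p z) (q z) z" for z
    proof (cases "z \<in> ?K")
      case True
      have "has_wirtinger h 0 0 z"
        by (rule has_wirtinger_transform[OF has_wirtinger_zero open_sublevel(1)[of "t / 4"]])
          (use True zero[of z] low t in \<open>auto simp: h_def\<close>)
      moreover have "p z = 0" "q z = 0" using low[of "G z"] zero[OF True] t unfolding p_def q_def by auto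
      ultimately show ?thesis by simp
    next
      case False
      have dE: "(E has_field_derivative deriv E z) (at z)"
        using E_holomorphic open_complement False by (intro holomorphic_derivI) auto
      have "has_wirtinger (\<lambda>z. of_real (?\<omega> z)) (of_real (\<omega>' (G z)) * E z / 2) (of_real (\<omega>' (G z)) * cnj (E z) / 2) z"
        by (rule has_wirtinger_real[OF G_derivative[OF False] der])
      moreover have "has_wirtinger (\<lambda>z. of_real (\<kappa> (?n z))) (of_real (\<kappa>' (?n z)) * (2 * cnj (E z) * deriv E z) / 2)
          (of_real (\<kappa>' (?n z)) * cnj (2 * cnj (E z) * deriv E z) / 2) z"
        by (rule has_wirtinger_real[OF has_derivative_norm_square_holomorphic[OF dE] der\<kappa>]) simp
      ultimately show ?thesis
        unfolding h_def p_def q_def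
        by (intro has_wirtinger_mult has_wirtinger_holomorphic[OF dE])
    qed
    have c\<kappa>: "continuous_on (- ?K) (\<lambda>z. \<kappa> (?n z))" "continuous_on (- ?K) (\<lambda>z. \<kappa>' (?n z))"
    proof -
      have nz: "?n z + \<epsilon>\<^sup>2 \<noteq> 0" for z using pos[of "?n z"] e by auto
      have nz': "sqrt (?n z + \<epsilon>\<^sup>2) \<noteq> 0" "2 * (?n z + \<epsilon>\<^sup>2) * sqrt (?n z + \<epsilon>\<^sup>2) \<noteq> 0" for z
      proof -
        have "y \<noteq> 0 \<Longrightarrow> sqrt y \<noteq> 0" "y \<noteq> 0 \<Longrightarrow> 2 * y * sqrt y \<noteq> 0" for y :: real by simp_all
        from this[OF nz] show "sqrt (?n z + \<epsilon>\<^sup>2) \<noteq> 0" "2 * (?n z + \<epsilon>\<^sup>2) * sqrt (?n z + \<epsilon>\<^sup>2) \<noteq> 0" .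
      qed
      show "continuous_on (- ?K) (\<lambda>z. \<kappa> (?n z))" unfolding \<kappa>_def
        by (intro continuous_intros contE ballI) (rule nz')
      show "continuous_on (- ?K) (\<lambda>z. \<kappa>' (?n z))" unfolding \<kappa>'_def
        by (intro continuous_intros contE ballI) (rule nz')
    qed
    have cw: "continuous_on (- ?K) (\<lambda>z. \<omega>' (G z))" "continuous_on (- ?K) (\<lambda>z. \<omega>1 (G z))"
      "continuous_on (- ?K) (\<lambda>z. \<omega>2 (G z))"
      by (rule continuous_on_compose2[OF \<omega>'_cont[of UNIV] continuous_on[of "- ?K"]], simp)
        (rule continuous_on_compose2[OF \<omega>12_cont(1)[of UNIV] continuous_on[of "- ?K"]], simp,
          rule continuous_on_compose2[OF \<omega>12_cont(2)[of UNIV] continuous_on[of "- ?K"]], simp)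
    have contp: "continuous_on UNIV p"
    proof (rule continuous_glue[of "t / 4" _ 0])
      show "continuous_on (- ?K) p" unfolding p_def
        by (intro continuous_intros c\<kappa> cw contE contE' ballI) simp_all
    qed (use t low in \<open>auto simp: p_def\<close>)
    have contq: "continuous_on UNIV q"
    proof (rule continuous_glue[of "t / 4" _ 0])
      show "continuous_on (- ?K) q" unfolding q_def
        by (intro continuous_intros c\<kappa> cw contE contE' ballI) simp_all
    qed (use t low in \<open>auto simp: q_def\<close>)
    have supp: "h z = 0" "p z = 0" "q z = 0" if "norm z > R" for z
    proof -
      have "G z > t" using R[of z] that by force
      then show "h z = 0" "p z = 0" "q z = 0"
        using high[of "G z"] s unfolding h_def p_def q_def by auto
    qed
    have q0: "integral\<^sup>L lborel q = 0"
      by (rule integral_dbar_eq_0[OF wirt contp contq supp])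
    let ?A = "\<lambda>z. dlayer t s z * (?n z / sqrt (?n z + \<epsilon>\<^sup>2)) / 2"
    \<comment> \<open>q is u minus the layer term and has integral zero, so the layer term and u
      have the same integral; u, unlike the layer term, is dominated by U.\<close>
    define u where "u z = of_real (\<omega>1 (G z) * \<omega>2' (G z) * (?n z * \<kappa> (?n z)) / 2)
        + of_real (?\<omega> z * \<kappa>' (?n z)) * ((E z)\<^sup>2 * cnj (deriv E z))" for z
    have qu: "q z = u z - of_real (?A z)" for z
    proof -
      have n: "cnj (E z) * E z = of_real (?n z)" unfolding complex_norm_square by (rule mult.commute)
      have w: "\<omega>' (G z) = \<omega>1 (G z) * \<omega>2' (G z) - dlayer t s z"
        using layer[of "G z"] unfolding \<omega>'_def dlayer_def by simp
      have "q z = of_real (\<omega>' (G z)) * (cnj (E z) * E z) * of_real (\<kappa> (?n z)) / 2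
          + of_real (?\<omega> z * \<kappa>' (?n z)) * ((E z)\<^sup>2 * cnj (deriv E z))"
        unfolding q_def by (simp add: power2_eq_square)
      also have "\<dots> = u z - of_real (?A z)"
        unfolding n w u_def \<kappa>_def by (simp add: left_diff_distrib diff_divide_distrib)
      finally show ?thesis .
    qed
    have u_le: "norm (u z) \<le> U z" for z
    proof (cases "z \<in> L \<and> E z \<noteq> 0")
      case True
      then have z: "z \<in> L" "E z \<noteq> 0" by auto
      then have nz: "norm z \<le> R" using R unfolding L_def by auto
      have np: "?n z > 0" using z(2) by simp
      have "norm (E z) \<le> sqrt (?n z + \<epsilon>\<^sup>2)" by (rule real_le_rsqrt) simp
      then have k1: "?n z * \<kappa> (?n z) \<le> norm (E z)"
        unfolding \<kappa>_def using pos[of "?n z"] z(2) by (simp add: divide_le_eq power2_eq_square)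
      have k0: "\<kappa> (?n z) \<ge> 0" unfolding \<kappa>_def using pos[of "?n z"] by simp
      have "norm (of_real (\<omega>1 (G z) * \<omega>2' (G z) * (?n z * \<kappa> (?n z)) / 2) :: complex)
          = \<bar>\<omega>1 (G z)\<bar> * \<bar>\<omega>2' (G z)\<bar> * (?n z * \<kappa> (?n z)) / 2"
        unfolding norm_of_real using k0 by (simp add: abs_mult)
      also have "\<dots> \<le> 1 * (\<bar>D\<bar> * (4 / t)) * \<bar>mE\<bar> / 2"
        using bnd D t k0 k1 mE[OF z(1)] unfolding \<omega>2'_def
        by (intro divide_right_mono mult_mono) (auto simp: abs_mult intro!: mult_right_mono divide_right_mono)
      finally have 1: "norm (of_real (\<omega>1 (G z) * \<omega>2' (G z) * (?n z * \<kappa> (?n z)) / 2) :: complex)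
          \<le> \<bar>D\<bar> * (4 / t) * \<bar>mE\<bar> / 2" by simp
      \<comment> \<open>Dropping \<epsilon> leaves 1 / (2 |E|^3); multiplied by |E|^2 |E'| this is
        half the modulus of the logarithmic derivative.\<close>
      have "\<bar>\<kappa>' (?n z)\<bar> \<le> 1 / (2 * ?n z * norm (E z))"
        unfolding \<kappa>'_def using pos[of "?n z"] np z(2) \<open>norm (E z) \<le> sqrt (?n z + \<epsilon>\<^sup>2)\<close>
        by (auto simp: abs_mult intro!: divide_left_mono mult_mono mult_pos_pos)
      then have "\<bar>\<kappa>' (?n z)\<bar> * (?n z * norm (deriv E z)) \<le> 1 / (2 * ?n z * norm (E z)) * (?n z * (J z * norm (E z)))"
        using J(3)[OF z] J(2)[of z] np by (intro mult_mono mult_left_mono) auto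
      also have "\<dots> = J z / 2" using np z(2) by (simp add: field_simps)
      finally have k': "\<bar>\<kappa>' (?n z)\<bar> * (?n z * norm (deriv E z)) \<le> J z / 2" .
      have "norm (of_real (?\<omega> z * \<kappa>' (?n z)) * ((E z)\<^sup>2 * cnj (deriv E z)))
          = \<bar>?\<omega> z\<bar> * (\<bar>\<kappa>' (?n z)\<bar> * (?n z * norm (deriv E z)))"
        by (simp add: norm_mult abs_mult norm_power)
      also have "\<dots> \<le> 1 * (J z / 2)"
        using k' bnd mult_le_one[of "\<bar>\<omega>1 (G z)\<bar>" "\<bar>\<omega>2 (G z)\<bar>"] by (intro mult_mono) (auto simp: abs_mult)
      finally have 2: "norm (of_real (?\<omega> z * \<kappa>' (?n z)) * ((E z)\<^sup>2 * cnj (deriv E z))) \<le> J z / 2" by simp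
      have "U z = \<bar>D\<bar> * (4 / t) * \<bar>mE\<bar> / 2 + J z / 2" using nz by (simp add: U_def)
      then show ?thesis unfolding u_def using norm_triangle_mono[OF 1 2] by (simp only:)
    next
      case False
      have "u z = 0"
      proof (cases "E z = 0")
        case False
        then have "G z < t / 4 \<or> G z > t" using \<open>\<not> (z \<in> L \<and> E z \<noteq> 0)\<close> unfolding L_def by auto
        then show ?thesis using low[of "G z"] high[of "G z"] s(1) unfolding u_def by auto
      qed (simp add: u_def)
      moreover have "U z \<ge> 0" unfolding U_def using J(2)[of z] t by (intro add_nonneg_nonneg mult_nonneg_nonneg) auto
      ultimately show ?thesis by simp
    qed
    have d0: "dlayer t s z = 0" if "G z \<le> t / 4 \<or> G z > t" for z
      using dlayer_support[OF s(1), of t z] that s t by fastforce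
    have nzs: "sqrt (?n z + \<epsilon>\<^sup>2) \<noteq> 0" for z
      by (rule less_imp_neq[symmetric], rule real_sqrt_gt_zero, rule pos) simp
    have contA: "continuous_on UNIV ?A"
    proof (rule continuous_glue[of "t / 4" _ 0])
      show "continuous_on (- ?K) ?A"
        by (intro continuous_intros dlayer_continuous contE ballI; (rule nzs | simp))
    qed (use t d0 in auto)
    have intA: "integrable lborel ?A"
    proof (rule integrable_compact_support[OF contA, of R])
      fix z :: complex assume "norm z > R"
      then have "G z > t" using R[of z] by (cases "G z \<le> t") auto
      then show "?A z = 0" using d0[of z] by simp
    qed
    have intq: "integrable lborel q" by (rule integrable_compact_support[OF contq supp(3)])
    have ueq: "u = (\<lambda>z. q z + of_real (?A z))" using qu by (simp add: fun_eq_iff)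
    have intu: "integrable lborel u"
      unfolding ueq using intA intq by (intro Bochner_Integration.integrable_add integrable_of_real)
    have "integral\<^sup>L lborel u = integral\<^sup>L lborel q + (\<integral>z. complex_of_real (?A z) \<partial>lborel)"
      unfolding ueq using intA intq by (intro Bochner_Integration.integral_add integrable_of_real)
    then have "integral\<^sup>L lborel u = of_real (\<integral>z. ?A z \<partial>lborel)"
      unfolding q0 by (simp only: integral_complex_of_real add_0_left)
    moreover have "norm (integral\<^sup>L lborel u) \<le> V"
      unfolding V_def by (rule Bochner_Integration.integral_norm_bound_integral[OF intu intU u_le])
    ultimately have "\<bar>\<integral>z. ?A z \<partial>lborel\<bar> \<le> V" by simp
    then show ?thesis by linarith
  qed
  show ?thesis
  proof (rule that[of "2 * V + 1"])
    fix s assume s: "0 < s" "s \<le> t / 4"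
    have d0: "dlayer t s z = 0" if "G z \<le> t / 4 \<or> G z > t" for z
      using dlayer_support[OF s(1), of t z] that s t by fastforce
    have dR: "dlayer t s z = 0" if "norm z > R" for z
      using d0[of z] R[of z] that by (cases "G z \<le> t") auto
    define I where "I = (\<integral>z. dlayer t s z \<partial>lborel)"
    have intd: "integrable lborel (dlayer t s)"
      by (rule integrable_compact_support[OF dlayer_continuous dR])
    have I0: "I \<ge> 0" unfolding I_def using dlayer_nonneg[OF s(1)] by (intro integral_nonneg_AE) simp
    \<comment> \<open>The smoothed length falls short of |E| by at most \<epsilon>; this choice
      makes the total loss \<epsilon> I at most 1, whatever s is. Hence the bound 2 V + 1, the 2
      undoing the half in the Wirtinger derivative.\<close>
    define \<epsilon> where "\<epsilon> = 1 / (1 + I)"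
    have e: "\<epsilon> > 0" "\<epsilon> * I \<le> 1" unfolding \<epsilon>_def using I0 by (auto simp: divide_le_eq)
    let ?r = "\<lambda>z. (norm (E z))\<^sup>2 / sqrt ((norm (E z))\<^sup>2 + \<epsilon>\<^sup>2)"
    have r_ge: "norm (E z) - \<epsilon> \<le> ?r z" for z
    proof -
      have "sqrt ((norm (E z))\<^sup>2 + \<epsilon>\<^sup>2) \<le> norm (E z) + \<epsilon>"
        using e(1) by (intro real_le_lsqrt) (auto simp: power2_eq_square algebra_simps)
      moreover have "sqrt ((norm (E z))\<^sup>2 + \<epsilon>\<^sup>2) > 0" using e(1) by (simp add: add_nonneg_pos)
      moreover have "norm (E z) - \<epsilon> \<le> (norm (E z))\<^sup>2 / (norm (E z) + \<epsilon>)"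
        using e(1) by (simp add: le_divide_eq add_nonneg_pos) (simp add: power2_eq_square algebra_simps)
      moreover have "(norm (E z))\<^sup>2 / (norm (E z) + \<epsilon>) \<le> ?r z"
        using calculation(1,2) e(1) by (intro divide_left_mono mult_pos_pos) (auto simp: add_nonneg_pos)
      ultimately show ?thesis by linarith
    qed
    have cont: "continuous_on UNIV (\<lambda>z. dlayer t s z * F z)" if "continuous_on (- ?K) F" for F :: "complex \<Rightarrow> real"
      by (rule continuous_glue[of "t / 4" _ 0])
        (use t d0 that in \<open>auto intro!: continuous_intros dlayer_continuous\<close>)
    have int: "integrable lborel (\<lambda>z. dlayer t s z * F z)" if "continuous_on (- ?K) F" for F :: "complex \<Rightarrow> real"
      by (rule integrable_compact_support[OF cont[OF that]]) (use dR in auto)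
    have "sqrt ((norm (E z))\<^sup>2 + \<epsilon>\<^sup>2) \<noteq> 0" for z
      by (rule less_imp_neq[symmetric], rule real_sqrt_gt_zero) (use e(1) in \<open>simp add: add_nonneg_pos\<close>)
    then have cr: "continuous_on (- ?K) ?r" by (intro continuous_intros contE) blast
    have "(\<integral>z. dlayer t s z * norm (E z) \<partial>lborel) \<le> (\<integral>z. dlayer t s z * ?r z + \<epsilon> * dlayer t s z \<partial>lborel)"
    proof (rule integral_mono)
      show "integrable lborel (\<lambda>z. dlayer t s z * norm (E z))" by (rule int[OF continuous_on_norm[OF contE]])
      show "integrable lborel (\<lambda>z. dlayer t s z * ?r z + \<epsilon> * dlayer t s z)"
        using int[OF cr] intd by (intro Bochner_Integration.integrable_add integrable_mult_right)
      show "dlayer t s z * norm (E z) \<le> dlayer t s z * ?r z + \<epsilon> * dlayer t s z" for z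
        using mult_left_mono[OF r_ge[of z] dlayer_nonneg[OF s(1), of t z]] by (simp add: algebra_simps)
    qed
    also have "\<dots> = 2 * (\<integral>z. dlayer t s z * ?r z / 2 \<partial>lborel) + \<epsilon> * I"
      unfolding I_def using int[OF cr] intd
      by (subst Bochner_Integration.integral_add) (auto simp del: times_divide_eq_right)
    also have "\<dots> \<le> 2 * V + 1" using main[OF s e(1)] e(2) by linarith
    finally show "(\<integral>z. dlayer t s z * norm (E z) \<partial>lborel) \<le> 2 * V + 1" .
  qed
qed

end

section \<open>Cauchy's formula on a layer\<close>

text \<open>Its value is pi, by polar coordinates with |z|^2 as variable: the constant in the area
  form of Cauchy's formula. The estimates use it through its positivity.\<close>

definition area_constant :: real where
  "area_constant = (\<integral>z. dstep (2 - (norm (z::complex))\<^sup>2) \<partial>lborel)"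

lemma dstep_disc_zero: "norm (z::complex) > 2 \<Longrightarrow> dstep (2 - (norm z)\<^sup>2) = 0"
proof -
  assume "norm z > 2"
  then have "2\<^sup>2 \<le> (norm z)\<^sup>2" by (intro power_mono) auto
  then show ?thesis by (intro step_simps(5)) simp
qed

lemma continuous_dstep_disc: "continuous_on X (\<lambda>z::complex. dstep (2 - (norm (z - c))\<^sup>2))"
  by (rule continuous_on_compose2[OF continuous_dstep[of UNIV]]) (auto intro!: continuous_intros)

lemma integrable_dstep_disc: "integrable lborel (\<lambda>z::complex. dstep (2 - (norm z)\<^sup>2))"
  using integrable_compact_support[of "\<lambda>z::complex. dstep (2 - (norm z)\<^sup>2)" 2]
    continuous_dstep_disc[of UNIV 0] dstep_disc_zero by auto

lemma area_constant_pos: "area_constant > 0"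
proof -
  let ?f = "\<lambda>z::complex. dstep (2 - (norm z)\<^sup>2)"
  have "area_constant \<ge> 0" unfolding area_constant_def
    by (intro integral_nonneg_AE) (simp add: step_simps)
  moreover have "area_constant \<noteq> 0"
  proof
    assume *: "area_constant = 0"
    define a b :: complex where "a = Complex (-2) (-2)" and "b = Complex 2 2"
    have all: "(?f has_integral 0) UNIV"
      using has_integral_integral_lborel[OF integrable_dstep_disc] * unfolding area_constant_def by simp
    have out: "?f z = 0" if "z \<notin> cbox a b" for z
    proof (rule dstep_disc_zero)
      have "\<bar>Re z\<bar> > 2 \<or> \<bar>Im z\<bar> > 2" using that unfolding a_def b_def in_cbox_complex_iff by auto
      then show "norm z > 2" using abs_Re_le_cmod[of z] abs_Im_le_cmod[of z] by linarith
    qed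
    have "(\<lambda>z. if z \<in> cbox a b then ?f z else 0) = ?f" by (rule ext) (use out in auto)
    then have "((\<lambda>z. if z \<in> cbox a b then ?f z else 0) has_integral 0) UNIV" using all by (simp only:)
    then have int0: "(?f has_integral 0) (cbox a b)" by (simp only: has_integral_restrict_UNIV)
    \<comment> \<open>Here 2 - |z0|^2 = 1/2 lies strictly inside the transition of
      \<open>step\<close>, so the integrand is positive at z0.\<close>
    define z0 where "z0 = complex_of_real (sqrt (3/2))"
    have n0: "(norm z0)\<^sup>2 = 3/2" unfolding z0_def by simp
    have "?f z0 = 0"
    proof (rule has_integral_0_cbox_imp_0[OF _ _ int0])
      show "continuous_on (cbox a b) ?f" using continuous_dstep_disc[of "cbox a b" 0] by simp
      show "0 \<le> ?f z" for z by (simp add: step_simps)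
      show "box a b \<noteq> {}" unfolding a_def b_def by (simp add: box_ne_empty Basis_complex_def inner_complex_def)
      have "sqrt (3/2) \<le> sqrt 4" by (intro real_sqrt_le_mono) auto
      moreover have "sqrt 4 = (2::real)" by simp
      moreover have "- 2 \<le> sqrt (3/2 :: real)" by (rule order_trans[of _ 0]) auto
      ultimately show "z0 \<in> cbox a b" unfolding a_def b_def z0_def in_cbox_complex_iff by auto
    qed
    then show False using dstep_pos[of "1/2"] unfolding n0 by simp
  qed
  ultimately show ?thesis by linarith
qed

lemma area_constant_translate:
  fixes c :: complex
  shows "(\<integral>z. dstep (2 - (norm (z - c))\<^sup>2) \<partial>lborel) = area_constant"
proof -
  have "(\<integral>z. dstep (2 - (norm (z - c))\<^sup>2) \<partial>lborel) = (\<integral>z. dstep (2 - (norm (z - c))\<^sup>2) \<partial>distr lborel borel ((+) c))"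
    by (simp add: lborel_distr_plus)
  also have "\<dots> = (\<integral>z. dstep (2 - (norm (c + z - c))\<^sup>2) \<partial>lborel)"
    by (rule integral_distr) (auto intro!: borel_measurable_continuous_onI continuous_dstep_disc)
  finally show ?thesis unfolding area_constant_def by simp
qed

section \<open>Cutoffs at level sets of the Green's function\<close>

context interval_green
begin

text \<open>The outer counterpart of \<open>continuous_glue\<close>: f is known only in {G < t}, so
  its products must become constant before that level is reached.\<close>

lemma continuous_glue_sublevel:
  fixes q :: "complex \<Rightarrow> 'b::topological_space"
  assumes "s < t" "continuous_on {z. G z < t} q" "\<And>z. G z > s \<Longrightarrow> q z = c"
  shows "continuous_on UNIV q"
proof -
  have "continuous_on {z. s < G z} q"
    by (rule continuous_on_eq[OF continuous_on_const[of _ c]]) (use assms(3) in auto)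
  then have "continuous_on ({z. G z < t} \<union> {z. s < G z}) q"
    by (intro continuous_on_open_Un assms(2) open_sublevel)
  also have "{z. G z < t} \<union> {z. s < G z} = UNIV" using assms(1) by auto
  finally show ?thesis .
qed

definition cutoff :: "real \<Rightarrow> real \<Rightarrow> complex \<Rightarrow> complex" where
  "cutoff t s z = of_real (step ((t - s - G z) / s))"

text \<open>Minus the derivative of \<open>cutoff t s\<close> in the conjugate variable; with this
  sign the area integrals against the Cauchy kernel are positive multiples of point values.\<close>

definition dlayerE :: "real \<Rightarrow> real \<Rightarrow> complex \<Rightarrow> complex" where
  "dlayerE t s z = of_real (dlayer t s z) * cnj (E z) / 2"

context
  fixes t s :: real
  assumes t: "t > 0" and s: "0 < s" "s \<le> t / 4"
begin

lemma dlayer_zero: "G z < t / 2 \<Longrightarrow> dlayer t s z = 0" "G z > t - s \<Longrightarrow> dlayer t s z = 0"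
  "z \<in> complex_of_real ` S \<Longrightarrow> dlayer t s z = 0"
proof -
  have *: "dlayer t s z = 0" if "G z < t / 2 \<or> G z > t - s"
    using dlayer_support[OF s(1), of t z] s that by (cases "dlayer t s z = 0") auto
  show "G z < t / 2 \<Longrightarrow> dlayer t s z = 0" "G z > t - s \<Longrightarrow> dlayer t s z = 0" using * by blast+
  show "z \<in> complex_of_real ` S \<Longrightarrow> dlayer t s z = 0" using * zero[of z] t by simp
qed

lemma cutoff_simps: "G z < t / 2 \<Longrightarrow> cutoff t s z = 1" "G z > t - s \<Longrightarrow> cutoff t s z = 0"
proof -
  show "cutoff t s z = 1" if "G z < t / 2"
  proof -
    have "(t - s - G z) / s \<ge> 1" using that s by (simp add: le_divide_eq)
    then show ?thesis unfolding cutoff_def by (simp add: step_simps)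
  qed
  show "cutoff t s z = 0" if "G z > t - s"
  proof -
    have "(t - s - G z) / s \<le> 0" using that s by (simp add: divide_le_eq)
    then show ?thesis unfolding cutoff_def by (simp add: step_simps)
  qed
qed

lemma cutoff_wirtinger:
  "has_wirtinger (cutoff t s) (- (of_real (dlayer t s z) * E z / 2)) (- dlayerE t s z) z"
proof (cases "z \<in> complex_of_real ` S")
  case True
  have "has_wirtinger (\<lambda>_. 1) 0 0 z" unfolding has_wirtinger_def by simp
  then have "has_wirtinger (cutoff t s) 0 0 z"
    by (rule has_wirtinger_transform[OF _ open_sublevel(1)[of "t / 2"]])
      (use zero[OF True] t cutoff_simps(1) in auto)
  then show ?thesis using dlayer_zero(3)[OF True] unfolding dlayerE_def by simp
next
  case False
  have "((\<lambda>x. (t - s - x) / s) has_real_derivative - 1 / s) (at (G z))"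
    using s(1) by (auto intro!: derivative_eq_intros)
  from DERIV_chain2[where f = step, OF step_derivative this]
  have "((\<lambda>x. step ((t - s - x) / s)) has_real_derivative - dlayer t s z) (at (G z))"
    unfolding dlayer_def by simp
  from has_wirtinger_real[OF G_derivative[OF False] this] show ?thesis
    unfolding cutoff_def[abs_def] dlayerE_def by simp
qed

lemma continuous_E: "continuous_on (- (complex_of_real ` S)) E"
  using E_holomorphic holomorphic_on_imp_continuous_on by blast

lemma continuous_dlayerE: "continuous_on UNIV (dlayerE t s)"
  "continuous_on UNIV (\<lambda>z. of_real (dlayer t s z) * E z / 2)"
proof -
  show "continuous_on UNIV (dlayerE t s)"
  proof (rule continuous_glue[of "t / 2" _ 0])
    show "continuous_on (- (complex_of_real ` S)) (dlayerE t s)"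
      unfolding dlayerE_def[abs_def]
      by (intro continuous_intros dlayer_continuous continuous_E) simp
  qed (use t dlayer_zero(1) in \<open>auto simp: dlayerE_def\<close>)
  show "continuous_on UNIV (\<lambda>z. of_real (dlayer t s z) * E z / 2)"
  proof (rule continuous_glue[of "t / 2" _ 0])
    show "continuous_on (- (complex_of_real ` S)) (\<lambda>z. of_real (dlayer t s z) * E z / 2)"
      by (intro continuous_intros dlayer_continuous continuous_E) simp
  qed (use t dlayer_zero(1) in auto)
qed

lemma continuous_cutoff: "continuous_on X (cutoff t s)"
proof -
  have "continuous_on UNIV step" using step_derivative by (meson DERIV_isCont continuous_at_imp_continuous_on)
  then have "continuous_on X (\<lambda>z. step ((t - s - G z) / s))"
    by (rule continuous_on_compose2) (use s in \<open>auto intro!: continuous_intros continuous_on\<close>)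
  then show ?thesis unfolding cutoff_def[abs_def] by (rule continuous_on_of_real)
qed

text \<open>Boundary-free Stokes for the product of the cutoff and F: the holomorphic factor
  contributes nothing to the conjugate derivative, which is therefore
  \<open>- dlayerE t s z * F z\<close>.\<close>

lemma integral_layer_holomorphic:
  assumes F: "F holomorphic_on {z. G z < t}"
  shows "integrable lborel (\<lambda>z. dlayerE t s z * F z)" "(\<integral>z. dlayerE t s z * F z \<partial>lborel) = 0"
proof -
  obtain R where R: "\<And>z. G z \<le> t \<Longrightarrow> norm z \<le> R" using bounded_sublevel[of t] unfolding bounded_iff by blast
  have far: "G z > t" if "norm z > R" for z :: complex using R[of z] that by (cases "G z \<le> t") auto
  have cF: "continuous_on {z. G z < t} F" using F holomorphic_on_imp_continuous_on by blast
  have cF': "continuous_on {z. G z < t} (deriv F)"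
    using holomorphic_deriv[OF F open_sublevel(1)] holomorphic_on_imp_continuous_on by blast
  define p where "p z = - (of_real (dlayer t s z) * E z / 2) * F z + cutoff t s z * deriv F z" for z
  define q where "q z = - dlayerE t s z * F z + cutoff t s z * 0" for z
  have out: "p z = 0" "q z = 0" "cutoff t s z * F z = 0" if "G z > t - s" for z
    unfolding p_def q_def dlayerE_def using dlayer_zero(2) cutoff_simps(2) that by simp_all
  have contq: "continuous_on UNIV q"
  proof (rule continuous_glue_sublevel[of "t - s" t _ 0])
    show "continuous_on {z. G z < t} q" unfolding q_def
      by (intro continuous_intros cF continuous_cutoff continuous_on_subset[OF continuous_dlayerE(1)]) simp
  qed (use s out in auto)
  have contp: "continuous_on UNIV p"
  proof (rule continuous_glue_sublevel[of "t - s" t _ 0])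
    show "continuous_on {z. G z < t} p" unfolding p_def
      by (intro continuous_on_add continuous_on_mult continuous_on_minus cF cF' continuous_cutoff
          continuous_on_subset[OF continuous_dlayerE(2)]) simp
  qed (use s out in auto)
  have "has_wirtinger (\<lambda>z. cutoff t s z * F z) (p z) (q z) z" for z
  proof (cases "G z < t")
    case True
    then have "(F has_field_derivative deriv F z) (at z)"
      using F open_sublevel by (intro holomorphic_derivI[of _ "{z. G z < t}"]) auto
    then show ?thesis unfolding p_def q_def
      by (intro has_wirtinger_mult cutoff_wirtinger has_wirtinger_holomorphic)
  next
    case False
    then have z: "G z > t - s" using s by simp
    have "has_wirtinger (\<lambda>z. cutoff t s z * F z) 0 0 z"
      by (rule has_wirtinger_transform[OF has_wirtinger_zero open_sublevel(2)[of "t - s"]])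
        (use z out in auto)
    then show ?thesis using out z by simp
  qed
  note wirt = this
  have supp: "cutoff t s z * F z = 0" "p z = 0" "q z = 0" if "norm z > R" for z
    using out[of z] far[OF that] s(1) by simp_all
  have "integral\<^sup>L lborel q = 0" by (rule integral_dbar_eq_0[OF wirt contp contq supp])
  moreover have "integrable lborel q" by (rule integrable_compact_support[OF contq supp(3)])
  ultimately show "integrable lborel (\<lambda>z. dlayerE t s z * F z)" "(\<integral>z. dlayerE t s z * F z \<partial>lborel) = 0"
    unfolding q_def by simp_all
qed

text \<open>The cutoff at the Green level is compared with a radial cutoff around x. Their
  difference vanishes near x, so its quotient by z - x stays continuously differentiable, and Stokes
  moves the integral to the radial cutoff, whose conjugate derivative carries a factor z - x
  cancelling the pole.\<close>

lemma integral_layer_pole: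
  assumes x: "x \<in> S"
  shows "integrable lborel (\<lambda>z. dlayerE t s z / (z - of_real x))"
    "(\<integral>z. dlayerE t s z / (z - of_real x) \<partial>lborel) = of_real area_constant"
proof -
  let ?x = "complex_of_real x"
  let ?n = "\<lambda>z. (norm (z - ?x))\<^sup>2"
  have Gx: "G ?x = 0" using x zero by blast
  obtain R0 where R0: "\<And>z. G z \<le> t \<Longrightarrow> norm z \<le> R0" using bounded_sublevel[of t] unfolding bounded_iff by blast
  define R where "R = max R0 (norm ?x + 2)"
  have far: "G z > t" "dstep (2 - ?n z) = 0" "step (2 - ?n z) = 0" if "norm z > R" for z :: complex
  proof -
    show "G z > t" using R0[of z] that unfolding R_def by (cases "G z \<le> t") auto
    have n2: "norm (z - ?x) \<ge> 2" using that norm_triangle_ineq2[of z ?x] unfolding R_def by linarith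
    have "2\<^sup>2 \<le> ?n z" using n2 by (intro power_mono) auto
    then have "2 - ?n z \<le> 0" by simp
    then show "dstep (2 - ?n z) = 0" "step (2 - ?n z) = 0" by (simp_all only: step_simps)
  qed
  \<comment> \<open>A neighbourhood of x on which both cutoffs are 1.\<close>
  define X where "X = {z. G z < t / 2} \<inter> ball ?x 1"
  have X: "open X" "?x \<in> X" unfolding X_def by (intro open_Int open_sublevel open_ball) (use Gx t in simp)
  have inX: "cutoff t s z = 1" "step (2 - ?n z) = 1" "dlayer t s z = 0" "dstep (2 - ?n z) = 0" if "z \<in> X" for z
  proof -
    have "norm (z - ?x) < 1" using that unfolding X_def by (simp add: dist_norm norm_minus_commute)
    then have "?n z \<le> 1\<^sup>2" by (intro power_mono) auto
    then have "2 - ?n z \<ge> 1" by simp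
    then show "step (2 - ?n z) = 1" "dstep (2 - ?n z) = 0" by (simp_all only: step_simps)
    show "cutoff t s z = 1" "dlayer t s z = 0" using that cutoff_simps(1) dlayer_zero(1) unfolding X_def by auto
  qed
  define c where "c z = cutoff t s z - of_real (step (2 - ?n z))" for z
  define cp where "cp z = - (of_real (dlayer t s z) * E z / 2) - of_real (- dstep (2 - ?n z)) * (2 * cnj (z - ?x) * 1) / 2" for z
  define cq where "cq z = - dlayerE t s z - of_real (- dstep (2 - ?n z)) * cnj (2 * cnj (z - ?x) * 1) / 2" for z
  have c0: "c z = 0" "cp z = 0" "cq z = 0" if "z \<in> X" for z
    unfolding c_def cp_def cq_def dlayerE_def using inX[OF that] by simp_all
  have c_wirt: "has_wirtinger c (cp z) (cq z) z" for z
  proof -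
    have "((\<lambda>z. z - ?x) has_field_derivative 1) (at z)" by (auto intro!: derivative_eq_intros)
    from has_derivative_norm_square_holomorphic[OF this]
    have u: "(?n has_derivative (\<lambda>d. Re (2 * cnj (z - ?x) * 1 * d))) (at z)" .
    have "((\<lambda>y. 2 - y) has_real_derivative - 1) (at (?n z))" by (auto intro!: derivative_eq_intros)
    from DERIV_chain2[where f = step, OF step_derivative this]
    have "((\<lambda>y. step (2 - y)) has_real_derivative - dstep (2 - ?n z)) (at (?n z))" by simp
    from has_wirtinger_diff[OF cutoff_wirtinger has_wirtinger_real[OF u this]]
    show ?thesis unfolding c_def cp_def cq_def .
  qed
  have cont_step: "continuous_on Y (\<lambda>z. step (2 - ?n z))" for Y
  proof -
    have "continuous_on UNIV step" using step_derivative by (meson DERIV_isCont continuous_at_imp_continuous_on)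
    then show ?thesis by (rule continuous_on_compose2) (auto intro!: continuous_intros)
  qed
  have cc: "continuous_on Y c" for Y unfolding c_def
    by (intro continuous_intros continuous_cutoff cont_step)
  have ccp: "continuous_on Y cp" for Y unfolding cp_def
    by (intro continuous_on_diff continuous_on_minus continuous_on_mult continuous_on_divide continuous_on_of_real continuous_on_const
        continuous_on_cnj continuous_on_id
        continuous_dstep_disc continuous_on_subset[OF continuous_dlayerE(2)]) auto
  have ccq: "continuous_on Y cq" for Y unfolding cq_def
    by (intro continuous_on_diff continuous_on_minus continuous_on_mult continuous_on_divide continuous_on_of_real continuous_on_const
        continuous_on_cnj continuous_on_id
        continuous_dstep_disc continuous_on_subset[OF continuous_dlayerE(1)]) auto
  define p where "p z = cp z * (1 / (z - ?x)) + c z * (- (1 / (z - ?x)\<^sup>2))" for z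
  define q where "q z = cq z * (1 / (z - ?x)) + c z * 0" for z
  have glue: "continuous_on UNIV r" if "continuous_on (- {?x}) r" "\<And>z. z \<in> X \<Longrightarrow> r z = 0" for r :: "complex \<Rightarrow> complex"
  proof -
    have "continuous_on X r" by (rule continuous_on_eq[OF continuous_on_const[of _ 0]]) (use that(2) in auto)
    then have "continuous_on (X \<union> - {?x}) r" using that(1) X(1) by (intro continuous_on_open_Un) auto
    moreover have "X \<union> - {?x} = UNIV" using X(2) by auto
    ultimately show ?thesis by simp
  qed
  have contp: "continuous_on UNIV p"
  proof (rule glue)
    show "continuous_on (- {?x}) p" unfolding p_def by (intro continuous_intros cc ccp) auto
  qed (use c0 in \<open>simp add: p_def\<close>)
  have contq: "continuous_on UNIV q"
  proof (rule glue)
    show "continuous_on (- {?x}) q" unfolding q_def by (intro continuous_intros cc ccq) auto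
  qed (use c0 in \<open>simp add: q_def\<close>)
  have wirt: "has_wirtinger (\<lambda>z. c z * (1 / (z - ?x))) (p z) (q z) z" for z
  proof (cases "z = ?x")
    case True
    then have zX: "z \<in> X" using X(2) by simp
    have "has_wirtinger (\<lambda>z. c z * (1 / (z - ?x))) 0 0 z"
      by (rule has_wirtinger_transform[OF has_wirtinger_zero X(1) zX]) (use c0 in simp)
    then show ?thesis unfolding p_def q_def using c0[OF zX] by simp
  next
    case False
    then have "((\<lambda>z. 1 / (z - ?x)) has_field_derivative - (1 / (z - ?x)\<^sup>2)) (at z)"
      by (auto intro!: derivative_eq_intros simp: power2_eq_square divide_simps)
    then show ?thesis unfolding p_def q_def
      by (intro has_wirtinger_mult c_wirt has_wirtinger_holomorphic)
  qed
  have supp: "c z * (1 / (z - ?x)) = 0" "p z = 0" "q z = 0" if "norm z > R" for z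
  proof -
    have "c z = 0" "cp z = 0" "cq z = 0"
      unfolding c_def cp_def cq_def dlayerE_def
      using far[OF that] s cutoff_simps(2)[of z] dlayer_zero(2)[of z] by simp_all
    then show "c z * (1 / (z - ?x)) = 0" "p z = 0" "q z = 0" unfolding p_def q_def by simp_all
  qed
  have q0: "integral\<^sup>L lborel q = 0" by (rule integral_dbar_eq_0[OF wirt contp contq supp])
  have iq: "integrable lborel q" by (rule integrable_compact_support[OF contq supp(3)])
  have "integrable lborel (\<lambda>z. dstep (2 - ?n z))"
  proof (rule integrable_compact_support[OF continuous_dstep_disc, of R])
    show "dstep (2 - ?n z) = 0" if "norm z > R" for z using far(2)[OF that] .
  qed
  then have id: "integrable lborel (\<lambda>z. complex_of_real (dstep (2 - ?n z)))" by (rule integrable_of_real)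
  have eq: "dlayerE t s z / (z - ?x) = of_real (dstep (2 - ?n z)) - q z" for z
  proof (cases "z = ?x")
    case True
    then have "z \<in> X" using X(2) by simp
    then show ?thesis using inX(4)[of z] c0[of z] True unfolding q_def by simp
  next
    case False
    then show ?thesis unfolding q_def cq_def by (simp add: field_simps)
  qed
  show "integrable lborel (\<lambda>z. dlayerE t s z / (z - ?x))"
    unfolding eq using id iq by (rule Bochner_Integration.integrable_diff)
  have "(\<integral>z. dlayerE t s z / (z - ?x) \<partial>lborel) = (\<integral>z. complex_of_real (dstep (2 - ?n z)) \<partial>lborel) - integral\<^sup>L lborel q"
    unfolding eq by (rule Bochner_Integration.integral_diff[OF id iq])
  then show "(\<integral>z. dlayerE t s z / (z - ?x) \<partial>lborel) = of_real area_constant"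
    unfolding q0 integral_complex_of_real area_constant_translate by simp
qed

text \<open>Split f = f(x) + (z - x) F, where the difference quotient F is holomorphic across x; the
  constant meets the pole formula and F the vanishing one.\<close>

lemma Cauchy_formula_layer:
  assumes f: "f holomorphic_on {z. G z < t}" and x: "x \<in> S"
  shows "(\<integral>z. dlayerE t s z * f z / (z - of_real x) \<partial>lborel) = of_real area_constant * f (of_real x)"
proof -
  let ?x = "complex_of_real x"
  define F where "F z = (if z = ?x then deriv f ?x else (f z - f ?x) / (z - ?x))" for z
  have "F holomorphic_on {z. G z < t}"
    unfolding F_def by (rule pole_lemma_open[OF f open_sublevel(1)])
  note F = integral_layer_holomorphic[OF this]
  note P = integral_layer_pole[OF x]
  \<comment> \<open>At z = x the quotients are 0 by the convention for division; the identity
    survives there because \<open>dlayerE\<close> vanishes on the intervals.\<close>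
  have D0: "dlayerE t s ?x = 0" using dlayer_zero(3)[of ?x] x unfolding dlayerE_def by simp
  have eq: "dlayerE t s z * f z / (z - ?x) = dlayerE t s z * F z + f ?x * (dlayerE t s z / (z - ?x))" for z
    using D0 unfolding F_def by (cases "z = ?x") (simp_all add: algebra_simps flip: add_divide_distrib)
  show ?thesis unfolding eq
    by (subst Bochner_Integration.integral_add[OF F(1) integrable_mult_right[OF P(1)]])
      (simp add: F(2) P(2) del: times_divide_eq_right)
qed

end

text \<open>Cauchy's formula on the layer turns the coefficient into an area integral of f times the
  Cauchy integral of k. On the layer the latter is at most c e exp(-l t), and the weight left over
  integrates to at most the total variation V.\<close>

theorem coefficient_bound:
  assumes t: "t > 0"
  obtains C where "C > 0" "\<And>f M k l. \<lbrakk>f holomorphic_on {z. G z < t}; \<And>z. G z < t \<Longrightarrow> norm (f z) \<le> M;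
      orthogonal_density l k\<rbrakk>
      \<Longrightarrow> norm (\<integral>x. of_real (k x) * f (of_real x) \<partial>lborel) \<le> C * M * exp (- (real l * t))"
proof -
  define L where "L = {z. t / 2 \<le> G z \<and> G z \<le> t}"
  have L: "compact L" "\<And>z. z \<in> L \<Longrightarrow> G z > 0" unfolding L_def by (rule compact_level) (use t in auto)
  obtain c where c: "c > 0" "\<And>k l z. \<lbrakk>orthogonal_density l k; z \<in> L\<rbrakk>
      \<Longrightarrow> norm (cauchy_int k z) \<le> c * exp (- (real l * G z))"
    by (rule second_kind_bound[OF L]) blast+
  obtain V where V: "\<And>s. 0 < s \<Longrightarrow> s \<le> t / 4 \<Longrightarrow> (\<integral>z. dlayer t s z * norm (E z) \<partial>lborel) \<le> V"
    by (rule layer_variation[OF t]) blast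
  have "L \<inter> complex_of_real ` S = {}" using L(2) pos_notin by blast
  then obtain d where d: "d > 0" "\<And>z x. z \<in> L \<Longrightarrow> x \<in> S \<Longrightarrow> d \<le> norm (z - of_real x)"
    using separate_compact_closed[OF L(1) compact_imp_closed[OF compact_K]] unfolding dist_norm by blast
  obtain R where R: "\<And>z. G z \<le> t \<Longrightarrow> norm z \<le> R" using bounded_sublevel[of t] unfolding bounded_iff by blast
  define C where "C = c * exp 1 * (\<bar>V\<bar> + 1) / area_constant"
  show ?thesis
  proof (rule that[of C])
    show "C > 0" unfolding C_def using c(1) area_constant_pos
      by (intro divide_pos_pos mult_pos_pos) auto
    fix f M k l
    assume f: "f holomorphic_on {z. G z < t}" "\<And>z. G z < t \<Longrightarrow> norm (f z) \<le> M"
      and od: "orthogonal_density l k"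
    then have k: "integrable lborel k" and supp: "\<And>x. x \<notin> S \<Longrightarrow> k x = 0"
      unfolding orthogonal_density_def by blast+
    have [measurable]: "k \<in> borel_measurable borel" using k by simp
    obtain x0 where "x0 \<in> S" using S_nonempty by blast
    then have "G (of_real x0) < t" using zero[of "of_real x0"] t by simp
    then have M: "M \<ge> 0" using f(2) norm_ge_zero order_trans by blast
    \<comment> \<open>Ensures s <= t/4 and 2 l s <= 1: the layer lies within 2s of the level t, so
      exp(-l G) exceeds exp(-l t) there by at most the factor e.\<close>
    define s where "s = t / (4 * (1 + real l * t))"
    have s: "0 < s" "s \<le> t / 4" "real l * (2 * s) \<le> 1"
    proof -
      define r where "r = real l * t"
      have r: "r \<ge> 0" "s = t / (4 * (1 + r))" unfolding r_def s_def using t by simp_all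
      show "0 < s" unfolding r(2) using r(1) t by (intro divide_pos_pos) auto
      show "s \<le> t / 4" unfolding r(2) using r(1) t by (intro divide_left_mono) auto
      have "real l * (2 * s) = (2 * r) / (4 * (1 + r))" unfolding r(2) r_def by simp
      also have "\<dots> \<le> 1" using r(1) by (subst divide_le_eq) auto
      finally show "real l * (2 * s) \<le> 1" .
    qed
    note lay = dlayer_zero[OF t s(1,2)]
    define D where "D z = dlayerE t s z * f z" for z
    have D_out: "D z = 0" if "z \<notin> L" for z
      using lay(1,2)[of z] that s(1) unfolding D_def dlayerE_def L_def by auto
    have contD: "continuous_on UNIV D"
    proof (rule continuous_glue_sublevel[of "t - s" t _ 0])
      show "continuous_on {z. G z < t} D" unfolding D_def
        by (intro continuous_intros holomorphic_on_imp_continuous_on[OF f(1)]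
            continuous_on_subset[OF continuous_dlayerE(1)[OF t s(1,2)]]) simp
    qed (use s lay in \<open>auto simp: D_def dlayerE_def\<close>)
    have [measurable]: "D \<in> borel_measurable borel" using contD by (rule borel_measurable_continuous_onI)
    have intD: "integrable lborel D"
    proof (rule integrable_compact_support[OF contD, of R])
      fix z :: complex assume "norm z > R"
      then have "z \<notin> L" using R[of z] unfolding L_def by auto
      then show "D z = 0" by (rule D_out)
    qed
    \<comment> \<open>Where k and D are nonzero the kernel is at most 1/d, so the double integral
      converges absolutely and the order may be exchanged.\<close>
    let ?h = "\<lambda>x z. complex_of_real (k x) * (D z / (z - of_real x))"
    have "integrable (lborel \<Otimes>\<^sub>M lborel) (\<lambda>(x, z). \<bar>k x\<bar> * norm (D z) / d)"
      using k intD by (intro lborel_pair.Fubini_integrable) (auto simp: abs_mult)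
    then have int2: "integrable (lborel \<Otimes>\<^sub>M lborel) (\<lambda>(x, z). ?h x z)"
    proof (rule Bochner_Integration.integrable_bound)
      have "norm (?h x z) \<le> \<bar>k x\<bar> * norm (D z) / d" for x z
      proof (cases "x \<in> S \<and> z \<in> L")
        case True
        then have "d \<le> norm (z - of_real x)" using d(2) by blast
        then have "norm (D z) / norm (z - of_real x) \<le> norm (D z) / d"
          using d(1) by (intro divide_left_mono mult_pos_pos) auto
        then have "\<bar>k x\<bar> * (norm (D z) / norm (z - of_real x)) \<le> \<bar>k x\<bar> * (norm (D z) / d)"
          by (intro mult_left_mono) auto
        then show ?thesis by (simp add: norm_mult norm_divide)
      qed (use supp[of x] D_out[of z] d(1) in auto)
      then show "AE y in lborel \<Otimes>\<^sub>M lborel. norm (case y of (x, z) \<Rightarrow> ?h x z)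
          \<le> norm (case y of (x, z) \<Rightarrow> \<bar>k x\<bar> * norm (D z) / d)"
        using d(1) by (intro AE_I2) (auto simp: case_prod_unfold abs_mult)
    qed measurable
    have inner: "(\<integral>z. ?h x z \<partial>lborel) = of_real area_constant * (of_real (k x) * f (of_real x))" for x
    proof (cases "x \<in> S")
      case True
      show ?thesis using Cauchy_formula_layer[OF t s(1,2) f(1) True] unfolding D_def
        by (simp only: integral_mult_right_zero) simp
    qed (use supp in simp)
    have outer: "(\<integral>x. ?h x z \<partial>lborel) = D z * cauchy_int k z" for z
    proof -
      have "?h x z = D z * (of_real (k x) / (z - of_real x))" for x by simp
      then show ?thesis unfolding cauchy_int_def by (simp only: integral_mult_right_zero)
    qed
    have "of_real area_constant * (\<integral>x. of_real (k x) * f (of_real x) \<partial>lborel) = (\<integral>x. (\<integral>z. ?h x z \<partial>lborel) \<partial>lborel)"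
      unfolding inner by (simp only: integral_mult_right_zero)
    also have "\<dots> = (\<integral>z. (\<integral>x. ?h x z \<partial>lborel) \<partial>lborel)"
      by (rule lborel_pair.Fubini_integral[OF int2, symmetric])
    also have "\<dots> = (\<integral>z. D z * cauchy_int k z \<partial>lborel)" unfolding outer by simp
    also have "norm \<dots> \<le> (\<integral>z. dlayer t s z * norm (E z) * (M * c * exp 1 * exp (- (real l * t))) \<partial>lborel)"
    proof (rule order_trans[OF Bochner_Integration.integral_norm_bound integral_mono'])
      have cE: "continuous_on UNIV (\<lambda>z. norm (of_real (dlayer t s z) * E z / 2))"
        by (intro continuous_on_norm continuous_dlayerE(2)[OF t s(1,2)])
      have "integrable lborel (\<lambda>z. norm (of_real (dlayer t s z) * E z / 2))"
      proof (rule integrable_compact_support[OF cE, of R])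
        fix z :: complex assume "norm z > R"
        then have "G z > t - s" using R[of z] s(1) by (cases "G z \<le> t") auto
        then show "norm (of_real (dlayer t s z) * E z / 2) = 0" using lay(2) by simp
      qed
      then have "integrable lborel (\<lambda>z. 2 * norm (of_real (dlayer t s z) * E z / 2))"
        by (rule integrable_mult_right)
      moreover have "2 * norm (of_real (dlayer t s z) * E z / 2) = dlayer t s z * norm (E z)" for z
        using dlayer_nonneg[OF s(1), of t z] by (simp add: norm_mult norm_divide)
      ultimately have "integrable lborel (\<lambda>z. dlayer t s z * norm (E z))" by (simp only:)
      then show "integrable lborel (\<lambda>z. dlayer t s z * norm (E z) * (M * c * exp 1 * exp (- (real l * t))))"
        by (rule integrable_mult_left)
      fix z
      show "norm (D z * cauchy_int k z) \<le> dlayer t s z * norm (E z) * (M * c * exp 1 * exp (- (real l * t)))"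
      proof (cases "dlayer t s z = 0")
        case False
        then have G: "t - 2 * s < G z" "G z < t - s" using dlayer_support[OF s(1)] by blast+
        then have zL: "z \<in> L" "G z < t" unfolding L_def using s by auto
        have "real l * (t - 2 * s) \<le> real l * G z" using G by (intro mult_left_mono) auto
        then have "- (real l * G z) \<le> 1 + - (real l * t)" using s(3) by (simp add: algebra_simps)
        then have e: "exp (- (real l * G z)) \<le> exp 1 * exp (- (real l * t))" unfolding mult_exp_exp by simp
        have "norm (D z * cauchy_int k z) = dlayer t s z * norm (E z) / 2 * norm (f z) * norm (cauchy_int k z)"
          unfolding D_def dlayerE_def using dlayer_nonneg[OF s(1), of t z] by (simp add: norm_mult norm_divide)
        also have "\<dots> \<le> dlayer t s z * norm (E z) / 1 * M * (c * exp (- (real l * G z)))"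
          using c(2)[OF od zL(1)] f(2)[OF zL(2)] dlayer_nonneg[OF s(1), of t z] M
          by (intro mult_mono divide_left_mono) auto
        also have "\<dots> \<le> dlayer t s z * norm (E z) / 1 * M * (c * (exp 1 * exp (- (real l * t))))"
          using e c(1) M dlayer_nonneg[OF s(1), of t z] by (intro mult_left_mono) auto
        finally show ?thesis by (simp add: mult_ac)
      qed (simp add: D_def dlayerE_def)
      show "0 \<le> dlayer t s z * norm (E z) * (M * c * exp 1 * exp (- (real l * t)))"
        using c(1) M dlayer_nonneg[OF s(1), of t z] by (intro mult_nonneg_nonneg) auto
    qed
    also have "\<dots> = (\<integral>z. dlayer t s z * norm (E z) \<partial>lborel) * (M * c * exp 1 * exp (- (real l * t)))"
      by (simp only: integral_mult_left_zero)
    also have "\<dots> \<le> (\<bar>V\<bar> + 1) * (M * c * exp 1 * exp (- (real l * t)))"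
      using V[OF s(1,2)] c(1) M by (intro mult_right_mono) auto
    finally have "area_constant * norm (\<integral>x. of_real (k x) * f (of_real x) \<partial>lborel)
        \<le> (\<bar>V\<bar> + 1) * (M * c * exp 1 * exp (- (real l * t)))"
      using area_constant_pos by (simp add: norm_mult)
    then show "norm (\<integral>x. of_real (k x) * f (of_real x) \<partial>lborel) \<le> C * M * exp (- (real l * t))"
      unfolding C_def using area_constant_pos by (simp add: field_simps)
  qed
qed

end

section \<open>Matrix polynomials and the resolvent\<close>

lemma mat_mult_vec: "mat c *v v = c *s (v :: complex^'n)"
  by (simp add: vec_eq_iff matrix_vector_mult_def mat_def if_distrib if_distribR cong: if_cong)

lemma mult_vec_smult: "A *v (c *s v) = c *s (A *v (v :: complex^'n))"
  by (simp add: vec_eq_iff matrix_vector_mult_def sum_distrib_left mult_ac)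

lemma mult_vec_sum: "A *v (\<Sum>i\<in>I. f i) = (\<Sum>i\<in>I. A *v (f i :: complex^'n))"
  by (induction I rule: infinite_finite_induct) (simp_all add: matrix_vector_right_distrib)

lemma smult_sum: "c *s (\<Sum>i\<in>I. f i) = (\<Sum>i\<in>I. c *s (f i :: complex^'n))"
  by (simp add: vec_eq_iff sum_distrib_left)

text \<open>\<open>poly_mat\<close> takes real coefficients, whereas annihilating polynomials and
  their linear factors are complex; what matters of them is the action on one vector.\<close>

definition pmv :: "complex poly \<Rightarrow> complex^'n^'n \<Rightarrow> complex^'n \<Rightarrow> complex^'n" where
  "pmv q A v = (\<Sum>i\<le>degree q. coeff q i *s (mat_pow A i *v v))"

lemma pmv_alt: "degree q \<le> n \<Longrightarrow> pmv q A v = (\<Sum>i\<le>n. coeff q i *s (mat_pow A i *v v))"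
  unfolding pmv_def by (rule sum.mono_neutral_left) (auto simp: coeff_eq_0 not_le)

lemma pmv_add: "pmv (p + q) A v = pmv p A v + pmv q A v"
  using pmv_alt[of "p + q" "max (degree p) (degree q)" A v] pmv_alt[of p "max (degree p) (degree q)" A v]
    pmv_alt[of q "max (degree p) (degree q)" A v] degree_add_le[of p "max (degree p) (degree q)" q]
  by (simp add: sum.distrib vector_sadd_rdistrib)

lemma pmv_smult: "pmv (smult c p) A v = c *s pmv p A v"
  using pmv_alt[of "smult c p" "degree p" A v] by (simp add: pmv_def smult_sum degree_smult_le)

lemma pmv_pCons0: "pmv (pCons 0 p) A v = A *v pmv p A v"
proof -
  have "pmv (pCons 0 p) A v = (\<Sum>i\<le>Suc (degree p). coeff (pCons 0 p) i *s (mat_pow A i *v v))"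
    by (rule pmv_alt) (rule degree_pCons_le)
  also have "\<dots> = (\<Sum>i\<le>degree p. coeff p i *s (A *v (mat_pow A i *v v)))"
    by (simp add: sum.atMost_Suc_shift matrix_vector_mul_assoc del: sum.atMost_Suc)
  finally show ?thesis by (simp add: pmv_def mult_vec_sum mult_vec_smult)
qed

lemma mat_pow_commute: "A *v (mat_pow A i *v v) = mat_pow A i *v (A *v v)"
proof (induction i)
  case (Suc i)
  have "A *v (mat_pow A (Suc i) *v v) = A *v (A *v (mat_pow A i *v v))"
    by (simp add: matrix_vector_mul_assoc)
  also have "\<dots> = mat_pow A (Suc i) *v (A *v v)"
    unfolding Suc by (simp add: matrix_vector_mul_assoc matrix_mul_assoc)
  finally show ?case .
qed simp

lemma pmv_commute: "A *v pmv p A v = pmv p A (A *v v)"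
  unfolding pmv_def by (simp add: mult_vec_sum mult_vec_smult mat_pow_commute)

lemma pmv_vec_add: "pmv p A (v + w) = pmv p A v + pmv p A w"
  unfolding pmv_def by (simp add: matrix_vector_right_distrib sum.distrib vector_add_ldistrib)

lemma pmv_vec_smult: "pmv p A (c *s v) = c *s pmv p A v"
  unfolding pmv_def by (simp add: mult_vec_smult smult_sum vector_smult_assoc mult.commute)

lemma shift_mult_vec: "(A - mat c) *v v = A *v v + (- c) *s (v :: complex^'n)"
  by (simp add: matrix_vector_mult_diff_rdistrib mat_mult_vec)

lemma pmv_shift: "pmv p A ((A - mat c) *v v) = (A - mat c) *v pmv p A v"
  by (simp only: shift_mult_vec pmv_vec_add pmv_vec_smult pmv_commute)

lemma pmv_linear_factor: "pmv ([:- c, 1:] * q) A v = pmv q A ((A - mat c) *v v)"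
proof -
  have "[:- c, 1:] * q = smult (- c) q + pCons 0 q" by simp
  then show ?thesis
    by (simp only: pmv_shift pmv_add pmv_smult pmv_pCons0) (simp only: shift_mult_vec add.commute)
qed

lemma poly_mat_vec: "poly_mat p A *v v = pmv (map_poly of_real p) A v"
proof -
  have "poly_mat p A *v v = (\<Sum>i\<le>degree p. (mat (complex_of_real (coeff p i)) ** mat_pow A i) *v v)"
    unfolding poly_mat_def
    by (induction rule: finite_induct[OF finite_atMost[of "degree p"]])
      (simp_all add: matrix_vector_mult_add_rdistrib)
  also have "\<dots> = pmv (map_poly of_real p) A v"
    unfolding pmv_def
    by (simp add: degree_map_poly coeff_map_poly mat_mult_vec flip: matrix_vector_mul_assoc)
  finally show ?thesis .
qed

lemma poly_mat_add_vec: "poly_mat (p + q) A *v v = poly_mat p A *v v + poly_mat q A *v v"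
proof -
  have "map_poly complex_of_real (p + q) = map_poly of_real p + map_poly of_real q"
    by (intro poly_eqI) (simp add: coeff_map_poly)
  then show ?thesis unfolding poly_mat_vec by (simp add: pmv_add)
qed

lemma poly_mat_smult_vec: "poly_mat (smult c p) A *v v = of_real c *s (poly_mat p A *v v)"
proof -
  have "map_poly complex_of_real (smult c p) = smult (of_real c) (map_poly of_real p)"
    by (intro poly_eqI) (simp add: coeff_map_poly)
  then show ?thesis unfolding poly_mat_vec by (simp add: pmv_smult)
qed

lemma poly_mat_X_vec: "poly_mat (pCons 0 p) A *v v = A *v (poly_mat p A *v v)"
  unfolding poly_mat_vec by (simp add: map_poly_pCons pmv_pCons0)

lemma poly_mat_shift_vec: "poly_mat p A *v ((A - mat c) *v v) = (A - mat c) *v (poly_mat p A *v v)"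
  unfolding poly_mat_vec by (rule pmv_shift)

text \<open>Among the Krylov vectors A^i v with i up to the real dimension, two coincide or there is
  a real linear relation. A coincidence is treated apart because dependence is a property of the set
  of vectors.\<close>

lemma annihilating_poly_exists:
  fixes A :: "complex^'n^'n"
  obtains q where "q \<noteq> 0" "pmv q A v = 0"
proof -
  define N where "N = DIM(complex^'n)"
  define e where "e i = mat_pow A i *v v" for i
  have monom: "pmv (monom c i) A v = c *s e i" for c i
  proof -
    have "pmv (monom c i) A v = (\<Sum>j\<le>i. coeff (monom c i) j *s e j)"
      unfolding e_def by (rule pmv_alt) (rule degree_monom_le)
    also have "\<dots> = (\<Sum>j\<le>i. if j = i then c *s e i else 0)" by (intro sum.cong) auto
    finally show ?thesis by simp
  qed
  show ?thesis
  proof (cases "inj_on e {..N}")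
    case False
    then obtain i j where ij: "e i = e j" "i \<noteq> j" unfolding inj_on_def by blast
    show ?thesis
    proof (rule that[of "monom 1 i + monom (- 1) j"])
      have "coeff (monom 1 i + monom (- 1) j) i = (1 :: complex)" using ij(2) by simp
      then show "monom 1 i + monom (- 1) j \<noteq> (0 :: complex poly)" by (metis coeff_0 zero_neq_one)
      show "pmv (monom 1 i + monom (- 1) j) A v = 0" using ij(1) by (simp add: pmv_add monom)
    qed
  next
    case True
    have fin: "finite (e ` {..N})" by simp
    have "card (e ` {..N}) > DIM(complex^'n)" using True unfolding N_def by (simp add: card_image)
    then have "dependent (e ` {..N})" by (intro dependent_biggerset) simp
    then obtain u where u: "\<exists>x\<in>e ` {..N}. u x \<noteq> 0" "(\<Sum>x\<in>e ` {..N}. u x *\<^sub>R x) = 0"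
      using real_vector.dependent_finite[OF fin] by blast
    define q where "q = (\<Sum>i\<le>N. monom (complex_of_real (u (e i))) i)"
    have "pmv q A v = (\<Sum>i\<le>N. of_real (u (e i)) *s e i)"
    proof -
      have "pmv (\<Sum>i\<in>I. monom (complex_of_real (u (e i))) i) A v = (\<Sum>i\<in>I. of_real (u (e i)) *s e i)"
        if "finite I" for I using that
        by (induction rule: finite_induct) (simp_all add: pmv_add monom, simp add: pmv_def)
      then show ?thesis unfolding q_def by simp
    qed
    also have "\<dots> = (\<Sum>i\<le>N. u (e i) *\<^sub>R e i)"
      by (intro sum.cong refl) (simp only: vec_eq_iff vector_smult_component vector_scaleR_component, simp add: scaleR_conv_of_real)
    also have "\<dots> = 0" using u(2) True by (simp add: sum.reindex)
    finally have "pmv q A v = 0" .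
    moreover have "q \<noteq> 0"
    proof -
      obtain i where i: "i \<le> N" "u (e i) \<noteq> 0" using u(1) by auto
      have "coeff q i = of_real (u (e i))" unfolding q_def using i(1) by (simp add: coeff_sum)
      then show ?thesis using i(2) by auto
    qed
    ultimately show ?thesis using that by blast
  qed
qed

lemma matrix_inv_cancel:
  fixes M :: "complex^'n^'n"
  assumes "invertible M"
  shows "matrix_inv M *v (M *v v) = v" "M *v (matrix_inv M *v v) = v"
proof -
  obtain N where "M ** N = mat 1 \<and> N ** M = mat 1" using assms unfolding invertible_def by blast
  then have "M ** matrix_inv M = mat 1 \<and> matrix_inv M ** M = mat 1"
    unfolding matrix_inv_def by (rule someI)
  then show "matrix_inv M *v (M *v v) = v" "M *v (matrix_inv M *v v) = v"
    by (simp_all add: matrix_vector_mul_assoc)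
qed

text \<open>Every vector is killed by finitely many factors \<open>A - c\<close> with \<open>c\<close> in the spectrum.\<close>
lemma spectrum_induct:
  fixes A :: "complex^'n^'n"
  assumes base: "P 0" and step: "\<And>c v. c \<in> mat_spectrum A \<Longrightarrow> P ((A - mat c) *v v) \<Longrightarrow> P v"
  shows "P v"
proof -
  \<comment> \<open>Induction on the degree of a polynomial annihilating v. A root in the spectrum
    is peeled off by the hypothesis on P; for any other root the factor is invertible and
    cancels.\<close>
  have "P v" if "q \<noteq> 0" "pmv q A v = 0" "degree q = d" for q d v
    using that
  proof (induction d arbitrary: q v rule: less_induct)
    case (less d)
    show ?case
    proof (cases "d = 0")
      case True
      then obtain a where a: "q = [:a:]" using less.prems(3) degree_eq_zeroE by metis
      then have "a *s v = 0" "a \<noteq> 0" using less.prems by (simp_all add: pmv_def)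
      then have "v = 0" by (simp add: vec_eq_iff)
      then show ?thesis using base by simp
    next
      case False
      then have "\<not> constant (poly q)" using less.prems(3) by (simp add: constant_degree)
      then obtain c where "poly q c = 0" using fundamental_theorem_of_algebra by blast
      then obtain q' where q': "q = [:- c, 1:] * q'" using poly_eq_0_iff_dvd by (metis dvdE)
      have q'0: "q' \<noteq> 0" using q' less.prems(1) by auto
      then have "degree q = Suc (degree q')" unfolding q' by (subst degree_mult_eq) auto
      then have deg: "degree q' < d" using less.prems(3) by simp
      have 0: "pmv q' A ((A - mat c) *v v) = 0" using less.prems(2) unfolding q' pmv_linear_factor .
      show ?thesis
      proof (cases "c \<in> mat_spectrum A")
        case True
        show ?thesis by (rule step[OF True]) (rule less.IH[OF deg q'0 0 refl])
      next
        case False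
        then have inv: "invertible (mat c - A)" unfolding mat_spectrum_def by simp
        have "(mat c - A) *v pmv q' A v = 0"
        proof -
          have "(mat c - A) *v pmv q' A v = - ((A - mat c) *v pmv q' A v)"
            by (simp add: matrix_vector_mult_diff_rdistrib)
          then show ?thesis using 0 by (simp add: pmv_shift)
        qed
        then have "pmv q' A v = 0"
          using matrix_inv_cancel(1)[OF inv, of "pmv q' A v"] by simp
        then show ?thesis by (rule less.IH[OF deg q'0 _ refl])
      qed
    qed
  qed
  then show ?thesis using annihilating_poly_exists[of A v] by metis
qed

section \<open>The resolvent\<close>

definition resolvent :: "complex^'n^'n \<Rightarrow> complex^'n \<Rightarrow> complex \<Rightarrow> complex^'n" where
  "resolvent A v u = matrix_inv (mat u - A) *v v"

lemma resolvent_zero: "resolvent A 0 u = 0"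
  unfolding resolvent_def by simp

text \<open>Apply the inverse of u - A to (u - c) v = (u - A) v + (A - c) v. In the spectral
  induction this passes from v to (A - c) v at the price of a pole at c.\<close>

lemma resolvent_shift:
  assumes "u \<notin> mat_spectrum A"
  shows "(u - c) *s resolvent A v u = v + resolvent A ((A - mat c) *v v) u"
proof -
  have inv: "invertible (mat u - A)" using assms unfolding mat_spectrum_def by simp
  have "(u - c) *s v = (mat u - A) *v v + (A - mat c) *v v"
    by (simp add: matrix_vector_mult_diff_rdistrib mat_mult_vec)
  then have "matrix_inv (mat u - A) *v ((u - c) *s v)
      = matrix_inv (mat u - A) *v ((mat u - A) *v v) + resolvent A ((A - mat c) *v v) u"
    unfolding resolvent_def by (simp only: matrix_vector_right_distrib)
  then show ?thesis unfolding matrix_inv_cancel(1)[OF inv] mult_vec_smult resolvent_def .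
qed

lemma open_resolvent_set: "open (- mat_spectrum (A :: complex^'n^'n))"
proof -
  have "mat_spectrum A = {c. det (mat c - A) = 0}"
    unfolding mat_spectrum_def by (simp add: invertible_det_nz)
  moreover have entry: "continuous_on UNIV (\<lambda>c. (mat c - A) $ i $ j)" for i j
    by (cases "i = j") (simp_all add: mat_def continuous_intros)
  have "continuous_on UNIV (\<lambda>c. det (mat c - A))"
    unfolding det_def
    by (intro continuous_on_sum continuous_on_mult continuous_on_const continuous_on_prod entry)
  then have "closed {c. det (mat c - A) = 0}" by (intro closed_Collect_eq continuous_on_const)
  ultimately show ?thesis by (metis open_Compl)
qed

text \<open>By the spectral induction the resolvent of v is that of (A - c) v plus a constant,
  divided by u - c, and c lies in the excluded spectrum.\<close>

lemma resolvent_holomorphic: "(\<lambda>u. resolvent A v u $ i) holomorphic_on (- mat_spectrum A)"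
proof (induction v rule: spectrum_induct[of _ A])
  case 1
  then show ?case by (simp add: resolvent_zero)
next
  case (2 c v)
  have "(\<lambda>u. (v $ i + resolvent A ((A - mat c) *v v) u $ i) / (u - c)) holomorphic_on (- mat_spectrum A)"
    using 2 by (intro holomorphic_intros) auto
  moreover have "(v $ i + resolvent A ((A - mat c) *v v) u $ i) / (u - c) = resolvent A v u $ i"
    if "u \<in> - mat_spectrum A" for u
  proof -
    have "u - c \<noteq> 0" using that 2(1) by auto
    moreover have "(u - c) * (resolvent A v u $ i) = v $ i + resolvent A ((A - mat c) *v v) u $ i"
      using resolvent_shift[of u A c v] that by (metis ComplD vector_add_component vector_smult_component)
    ultimately show ?thesis by (metis nonzero_mult_div_cancel_left)
  qed
  ultimately show ?case by (rule holomorphic_transform)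
qed

text \<open>\<open>contour_integral\<close> takes a default value where the integral does not exist,
  so linearity requires integrability on every loop to be carried along.\<close>

definition has_cint :: "(real \<Rightarrow> complex) list \<Rightarrow> (complex \<Rightarrow> complex) \<Rightarrow> complex \<Rightarrow> bool" where
  "has_cint gs f I \<longleftrightarrow> (\<forall>\<gamma>\<in>set gs. f contour_integrable_on \<gamma>) \<and> contour_int gs f = I"

lemma has_cint_add: "has_cint gs f I \<Longrightarrow> has_cint gs g J \<Longrightarrow> has_cint gs (\<lambda>u. f u + g u) (I + J)"
  unfolding has_cint_def contour_int_def
  by (auto simp: contour_integrable_add sum_list_addf[symmetric] contour_integral_add
      intro!: arg_cong[where f = sum_list] map_cong)

lemma has_cint_cmul: "has_cint gs f I \<Longrightarrow> has_cint gs (\<lambda>u. c * f u) (c * I)"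
  unfolding has_cint_def contour_int_def
  by (auto simp: contour_integrable_lmul sum_list_const_mult[symmetric] contour_integral_lmul
      intro!: arg_cong[where f = sum_list] map_cong)

lemma has_cint_cong:
  assumes "has_cint gs f I" "\<And>u. u \<in> contour_image gs \<Longrightarrow> f u = g u"
  shows "has_cint gs g I"
proof -
  have "f u = g u" if "\<gamma> \<in> set gs" "u \<in> path_image \<gamma>" for \<gamma> u
    using assms(2) that unfolding contour_image_def by blast
  then have "g contour_integrable_on \<gamma> \<and> contour_integral \<gamma> g = contour_integral \<gamma> f" if "\<gamma> \<in> set gs" for \<gamma>
    using assms(1) that contour_integrable_eq[of f \<gamma> g] contour_integral_eq[of \<gamma> g f]
    unfolding has_cint_def by metis
  then show ?thesis using assms(1) unfolding has_cint_def contour_int_def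
    by (auto intro!: arg_cong[where f = sum_list] map_cong)
qed

lemma has_cint_list:
  assumes "\<And>\<gamma>. \<gamma> \<in> set gs \<Longrightarrow> (f has_contour_integral I \<gamma>) \<gamma>"
  shows "has_cint gs f (\<Sum>\<gamma>\<leftarrow>gs. I \<gamma>)"
  unfolding has_cint_def contour_int_def
  using assms by (auto intro!: arg_cong[where f = sum_list] map_cong
      simp: contour_integral_unique contour_integrable_on_def)

lemma has_cint_zero:
  assumes "\<And>\<gamma>. \<gamma> \<in> set gs \<Longrightarrow> (f has_contour_integral 0) \<gamma>"
  shows "has_cint gs f 0"
  using has_cint_list[of gs f "\<lambda>_. 0", OF assms] by simp

section \<open>Contour integrals of the resolvent\<close>

locale contour_functional =
  fixes \<Gamma> :: "(real \<Rightarrow> complex) list" and X :: "complex set" and A :: "complex^'n^'n"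
  assumes paths: "\<And>\<gamma>. \<gamma> \<in> set \<Gamma> \<Longrightarrow> valid_path \<gamma> \<and> pathfinish \<gamma> = pathstart \<gamma>"
    and open_X: "open X" and sub_X: "contour_image \<Gamma> \<subseteq> X"
    and cauchy: "\<And>h \<gamma>. h holomorphic_on X \<Longrightarrow> \<gamma> \<in> set \<Gamma> \<Longrightarrow> (h has_contour_integral 0) \<gamma>"
    and encl: "\<And>c. c \<in> mat_spectrum A \<Longrightarrow> c \<notin> contour_image \<Gamma> \<and> contour_winding \<Gamma> c = 1"
    and spec_X: "mat_spectrum A \<subseteq> X"
begin

lemma has_cint_pole:
  assumes "c \<in> mat_spectrum A"
  shows "has_cint \<Gamma> (\<lambda>u. 1 / (u - c)) (2 * pi * \<i>)"
proof -
  have "has_cint \<Gamma> (\<lambda>u. 1 / (u - c)) (\<Sum>\<gamma>\<leftarrow>\<Gamma>. 2 * pi * \<i> * winding_number \<gamma> c)"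
    using encl[OF assms] paths unfolding contour_image_def
    by (intro has_cint_list has_contour_integral_winding_number) auto
  also have "(\<Sum>\<gamma>\<leftarrow>\<Gamma>. 2 * pi * \<i> * winding_number \<gamma> c) = 2 * pi * \<i>"
    using encl[OF assms] unfolding contour_winding_def by (simp add: sum_list_const_mult)
  finally show ?thesis .
qed

text \<open>Only the residue at infinity matters for a product of several poles: partial fractions
  lower the number of poles until they coincide, and then there is a primitive.\<close>
lemma has_cint_poles:
  assumes "set_mset C \<subseteq> mat_spectrum A" "size C \<ge> 2"
  shows "has_cint \<Gamma> (\<lambda>u. 1 / (\<Prod>c\<in>#C. u - c)) 0"
  using assms
proof (induction "size C" arbitrary: C rule: less_induct)
  case less
  then obtain c C' where C: "C = add_mset c C'" by (metis multiset_cases not_numeral_le_zero size_empty)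
  have c: "c \<in> mat_spectrum A" using less.prems C by simp
  show ?case
  proof (cases "\<exists>d\<in>#C'. d \<noteq> c")
    case True
    then obtain d where "d \<in># C'" and dc: "d \<noteq> c" by blast
    then obtain M where C': "C' = add_mset d M" by (metis multi_member_split)
    have d: "d \<in> mat_spectrum A" using less.prems C C' by simp
    define P where "P u = (\<Prod>c\<in>#M. u - c)" for u
    \<comment> \<open>With one pole fewer the two integrals agree: each is 2 pi i for empty M, and
      otherwise both vanish by induction. Partial fractions express the wanted integral through
      their difference.\<close>
    have "\<exists>I. has_cint \<Gamma> (\<lambda>u. 1 / ((u - c) * P u)) I \<and> has_cint \<Gamma> (\<lambda>u. 1 / ((u - d) * P u)) I"
    proof (cases "M = {#}")
      case True
      then show ?thesis using has_cint_pole[OF c] has_cint_pole[OF d] unfolding P_def by auto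
    next
      case False
      then have "size M \<ge> 1" by (simp add: Suc_le_eq nonempty_has_size)
      then have "has_cint \<Gamma> (\<lambda>u. 1 / (\<Prod>x\<in>#add_mset y M. u - x)) 0" if "y \<in> {c, d}" for y
        using less.prems c d that unfolding C C' by (intro less.hyps) (auto simp: C C')
      from this[of c] this[of d] show ?thesis unfolding P_def by auto
    qed
    then obtain I where I: "has_cint \<Gamma> (\<lambda>u. 1 / ((u - c) * P u)) I" "has_cint \<Gamma> (\<lambda>u. 1 / ((u - d) * P u)) I" by blast
    have "has_cint \<Gamma> (\<lambda>u. 1 / (c - d) * (1 / ((u - c) * P u)) + - (1 / (c - d)) * (1 / ((u - d) * P u)))
        (1 / (c - d) * I + - (1 / (c - d)) * I)"
      by (intro has_cint_add has_cint_cmul I)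
    then have "has_cint \<Gamma> (\<lambda>u. 1 / (c - d) * (1 / ((u - c) * P u)) + - (1 / (c - d)) * (1 / ((u - d) * P u))) 0"
      by simp
    then show ?thesis
    proof (rule has_cint_cong)
      fix u assume "u \<in> contour_image \<Gamma>"
      then have ne: "u - c \<noteq> 0" "u - d \<noteq> 0" "c - d \<noteq> 0" using encl[OF c] encl[OF d] dc by auto
      have "1 / (c - d) * (1 / (x * P u)) + - (1 / (c - d)) * (1 / (y * P u)) = 1 / (x * (y * P u))"
        if "x \<noteq> 0" "y \<noteq> 0" "y - x = c - d" for x y
      proof (cases "P u = 0")
        case False
        have "1 / (c - d) * (1 / (x * P u)) + - (1 / (c - d)) * (1 / (y * P u)) = (y - x) / ((c - d) * (x * y * P u))"
          using that False ne(3) by (simp add: divide_simps)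
        then show ?thesis using that ne(3) by (simp add: mult_ac)
      qed simp
      from this[OF ne(1,2)] show "1 / (c - d) * (1 / ((u - c) * P u)) + - (1 / (c - d)) * (1 / ((u - d) * P u))
          = 1 / (\<Prod>c\<in>#C. u - c)"
        unfolding C C' P_def by simp
    qed
  next
    case False
    then have "C' = replicate_mset (size C') c" by (metis set_mset_subset_singletonD subsetI singletonI singleton_iff)
    then obtain n where n: "C = replicate_mset (Suc (Suc n)) c"
      using less.prems(2) unfolding C by (metis Suc_le_D Suc_le_mono numeral_2_eq_2 replicate_mset_Suc size_add_mset)
    have "has_cint \<Gamma> (\<lambda>u. 1 / (u - c) ^ Suc (Suc n)) 0"
    proof (rule has_cint_zero)
      fix \<gamma> assume g: "\<gamma> \<in> set \<Gamma>"
      show "((\<lambda>u. 1 / (u - c) ^ Suc (Suc n)) has_contour_integral 0) \<gamma>"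
      proof (rule Cauchy_theorem_primitive[of "- {c}" "\<lambda>u. - 1 / (of_nat (Suc n) * (u - c) ^ Suc n)"])
        fix u assume "u \<in> - {c}"
        then have ne: "u - c \<noteq> 0" by simp
        show "((\<lambda>u. - 1 / (of_nat (Suc n) * (u - c) ^ Suc n)) has_field_derivative 1 / (u - c) ^ Suc (Suc n)) (at u within - {c})"
          by (rule derivative_eq_intros refl | use ne in \<open>simp add: divide_simps del: of_nat_Suc\<close>)+
      qed (use paths[OF g] encl[OF c] g in \<open>auto simp: contour_image_def\<close>)
    qed
    then show ?thesis unfolding n by simp
  qed
qed

text \<open>Peeling c off v creates a factor 1 / (u - c), so the induction must carry an arbitrary
  multiset C of poles; for C = {#} it says that the resolvent integrates to 2 pi i v.\<close>

lemma has_cint_resolvent_poles: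
  assumes "set_mset C \<subseteq> mat_spectrum A"
  shows "has_cint \<Gamma> (\<lambda>u. 1 / (\<Prod>c\<in>#C. u - c) * (resolvent A v u $ i)) (if C = {#} then 2 * pi * \<i> * v $ i else 0)"
  using assms
proof (induction v arbitrary: C rule: spectrum_induct[of _ A])
  case 1
  have "has_cint \<Gamma> (\<lambda>_. 0) 0" by (rule has_cint_zero) (rule has_contour_integral_0)
  then show ?case by (simp add: resolvent_zero)
next
  case (2 c v)
  let ?w = "(A - mat c) *v v" and ?P = "\<lambda>u. \<Prod>c\<in>#add_mset c C. u - c"
  have sub: "set_mset (add_mset c C) \<subseteq> mat_spectrum A" using 2 by simp
  have "has_cint \<Gamma> (\<lambda>u. 1 / ?P u * (resolvent A ?w u $ i)) 0"
    using 2(2)[OF sub] by simp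
  moreover have "has_cint \<Gamma> (\<lambda>u. v $ i * (1 / ?P u)) (if C = {#} then 2 * pi * \<i> * v $ i else 0)"
  proof (cases "C = {#}")
    case True
    then show ?thesis using has_cint_cmul[OF has_cint_pole[OF 2(1)], of "v $ i"] by (simp add: mult_ac)
  next
    case False
    then have "size (add_mset c C) \<ge> 2" by (simp add: Suc_le_eq nonempty_has_size)
    then show ?thesis using has_cint_cmul[OF has_cint_poles[OF sub], of "v $ i"] False by simp
  qed
  ultimately have "has_cint \<Gamma> (\<lambda>u. v $ i * (1 / ?P u) + 1 / ?P u * (resolvent A ?w u $ i))
      ((if C = {#} then 2 * pi * \<i> * v $ i else 0) + 0)"
    by (intro has_cint_add)
  then have "has_cint \<Gamma> (\<lambda>u. v $ i * (1 / ?P u) + 1 / ?P u * (resolvent A ?w u $ i))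
      (if C = {#} then 2 * pi * \<i> * v $ i else 0)" by simp
  then show ?case
  proof (rule has_cint_cong)
    fix u assume u: "u \<in> contour_image \<Gamma>"
    then have us: "u \<notin> mat_spectrum A" and ne: "u - c \<noteq> 0" using encl 2(1) by auto
    have "(u - c) * (resolvent A v u $ i) = v $ i + resolvent A ?w u $ i"
      using resolvent_shift[OF us, of c v] by (metis vector_add_component vector_smult_component)
    then have "resolvent A v u $ i = (v $ i + resolvent A ?w u $ i) / (u - c)"
      using ne by (metis nonzero_mult_div_cancel_left)
    then show "v $ i * (1 / ?P u) + 1 / ?P u * (resolvent A ?w u $ i) = 1 / (\<Prod>c\<in>#C. u - c) * (resolvent A v u $ i)"
      by (simp add: add_divide_distrib mult_ac)
  qed
qed

lemma has_cint_matfun_integrand: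
  assumes "f holomorphic_on X"
  shows "has_cint \<Gamma> (\<lambda>u. f u * (resolvent A v u $ i)) (2 * pi * \<i> * matfun_apply \<Gamma> f A v $ i)"
proof -
  have "(\<lambda>u. f u * (resolvent A v u $ i)) contour_integrable_on \<gamma>" if "\<gamma> \<in> set \<Gamma>" for \<gamma>
  proof (rule contour_integrable_holomorphic_simple)
    show "(\<lambda>u. f u * (resolvent A v u $ i)) holomorphic_on (X - mat_spectrum A)"
      by (intro holomorphic_on_mult holomorphic_on_subset[OF assms] holomorphic_on_subset[OF resolvent_holomorphic]) auto
    show "open (X - mat_spectrum A)"
      using open_X open_resolvent_set[of A] by (simp add: Diff_eq open_Int)
    show "path_image \<gamma> \<subseteq> X - mat_spectrum A"
      using sub_X encl that unfolding contour_image_def by blast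
  qed (use paths that in auto)
  then show ?thesis unfolding has_cint_def matfun_apply_def resolvent_def by simp
qed

lemma has_cint_unique: "has_cint \<Gamma> f I \<Longrightarrow> has_cint \<Gamma> f J \<Longrightarrow> I = J"
  unfolding has_cint_def by simp

lemma matfun_zero: "matfun_apply \<Gamma> f A 0 = 0"
proof -
  have "has_cint \<Gamma> (\<lambda>_. 0) 0" by (rule has_cint_zero) (simp add: has_contour_integral_0)
  then show ?thesis unfolding matfun_apply_def has_cint_def by (simp add: vec_eq_iff)
qed

text \<open>Write f = f(c) + (f - f(c)). The constant meets the integral of the resolvent, 2 pi i v;
  the rest times the resolvent of v is h times the sum of v and the resolvent of (A - c) v, and h
  alone integrates to zero by Cauchy's theorem.\<close>

lemma matfun_shift:
  assumes f: "f holomorphic_on X" and c: "c \<in> mat_spectrum A"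
  defines "h \<equiv> \<lambda>u. if u = c then deriv f c else (f u - f c) / (u - c)"
  shows "matfun_apply \<Gamma> f A v = f c *s v + matfun_apply \<Gamma> h A ((A - mat c) *v v)"
proof -
  have h: "h holomorphic_on X" unfolding h_def by (rule pole_lemma_open[OF f open_X])
  let ?w = "(A - mat c) *v v"
  have "matfun_apply \<Gamma> f A v $ i = f c * v $ i + matfun_apply \<Gamma> h A ?w $ i" for i
  proof -
    have "has_cint \<Gamma> (\<lambda>u. resolvent A v u $ i) (2 * pi * \<i> * v $ i)"
      using has_cint_resolvent_poles[of "{#}" v i] by simp
    moreover have "has_cint \<Gamma> h 0" by (rule has_cint_zero) (rule cauchy[OF h])
    ultimately have "has_cint \<Gamma> (\<lambda>u. f c * (resolvent A v u $ i) + v $ i * h u + h u * (resolvent A ?w u $ i))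
        (f c * (2 * pi * \<i> * v $ i) + v $ i * 0 + 2 * pi * \<i> * matfun_apply \<Gamma> h A ?w $ i)"
      by (intro has_cint_add has_cint_cmul has_cint_matfun_integrand[OF h])
    then have "has_cint \<Gamma> (\<lambda>u. f u * (resolvent A v u $ i))
        (f c * (2 * pi * \<i> * v $ i) + v $ i * 0 + 2 * pi * \<i> * matfun_apply \<Gamma> h A ?w $ i)"
    proof (rule has_cint_cong)
      fix u assume u: "u \<in> contour_image \<Gamma>"
      then have us: "u \<notin> mat_spectrum A" and uc: "u \<noteq> c" using encl c by auto
      have "(u - c) * (resolvent A v u $ i) = v $ i + resolvent A ?w u $ i"
        using resolvent_shift[OF us, of c v] by (metis vector_add_component vector_smult_component)
      then have "h u * ((u - c) * (resolvent A v u $ i)) = h u * (v $ i + resolvent A ?w u $ i)" by simp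
      moreover have "h u * (u - c) = f u - f c" using uc unfolding h_def by simp
      ultimately have "(f u - f c) * (resolvent A v u $ i) = h u * (v $ i + resolvent A ?w u $ i)"
        by (metis mult.assoc)
      then show "f c * (resolvent A v u $ i) + v $ i * h u + h u * (resolvent A ?w u $ i) = f u * (resolvent A v u $ i)"
        by (simp add: algebra_simps)
    qed
    from has_cint_unique[OF this has_cint_matfun_integrand[OF f]]
    have "2 * pi * \<i> * (f c * v $ i + matfun_apply \<Gamma> h A ?w $ i) = 2 * pi * \<i> * matfun_apply \<Gamma> f A v $ i"
      by (simp add: algebra_simps)
    then show ?thesis by simp
  qed
  then show ?thesis by (simp add: vec_eq_iff)
qed

end

section \<open>Orthonormal polynomials\<close>

lemma norm_smult_vec: "norm (c *s (v :: complex^'n)) = norm c * norm v"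
  by (simp add: norm_vec_def L2_set_def norm_mult power_mult_distrib sum_distrib_left[symmetric] real_sqrt_mult)

lemma linear_mult_vec: "linear ((*v) (A :: complex^'n^'n))"
proof (rule linearI)
  fix r :: real and x :: "complex^'n"
  have r: "r *\<^sub>R y = of_real r *s y" for y :: "complex^'n"
    by (simp only: vec_eq_iff vector_smult_component vector_scaleR_component) (simp add: scaleR_conv_of_real)
  show "A *v (r *\<^sub>R x) = r *\<^sub>R (A *v x)" unfolding r mult_vec_smult ..
qed (rule matrix_vector_right_distrib)

locale weighted_intervals = interval_green g a b S G
  for g :: nat and a b :: "nat \<Rightarrow> real" and S :: "real set" and G :: "complex \<Rightarrow> real" +
  fixes w :: "real \<Rightarrow> real"
  assumes w_integrable: "integrable lborel w" and w_nonneg: "\<And>x. w x \<ge> 0"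
    and w_supp: "\<And>x. x \<notin> S \<Longrightarrow> w x = 0" and w_mass: "(\<integral>x. w x \<partial>lborel) = 1"
begin

lemma w_measurable [measurable]: "w \<in> borel_measurable borel"
  using w_integrable by simp

lemma integrable_weight:
  fixes \<phi> :: "real \<Rightarrow> 'b::{banach, second_countable_topology}"
  assumes "continuous_on S \<phi>"
  shows "integrable lborel (\<lambda>x. w x *\<^sub>R \<phi> x)"
proof -
  have eq: "w x *\<^sub>R \<phi> x = w x *\<^sub>R (indicator S x *\<^sub>R \<phi> x)" for x
    using w_supp[of x] by (cases "x \<in> S") auto
  have "bounded (\<phi> ` S)" using compact_continuous_image[OF assms compact_S] compact_imp_bounded by blast
  then obtain B where B: "\<And>x. x \<in> S \<Longrightarrow> norm (\<phi> x) \<le> B" unfolding bounded_iff by blast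
  have [measurable]: "(\<lambda>x. indicator S x *\<^sub>R \<phi> x) \<in> borel_measurable borel"
    by (rule borel_measurable_continuous_on_indicator) (use assms closed_S in auto)
  show ?thesis
  proof (rule Bochner_Integration.integrable_bound)
    show "integrable lborel (\<lambda>x. w x * \<bar>B\<bar>)" using w_integrable by simp
    show "(\<lambda>x. w x *\<^sub>R \<phi> x) \<in> borel_measurable lborel" unfolding eq by measurable
    have "norm (w x *\<^sub>R \<phi> x) \<le> norm (w x * \<bar>B\<bar>)" for x
      using w_nonneg[of x] w_supp[of x] B[of x]
      by (cases "x \<in> S") (auto simp: abs_mult intro!: mult_left_mono)
    then show "AE x in lborel. norm (w x *\<^sub>R \<phi> x) \<le> norm (w x * \<bar>B\<bar>)" by simp
  qed
qed

lemma integrable_weight_poly: "integrable lborel (\<lambda>x. poly r x * w x)"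
  using integrable_weight[of "poly r"] by (simp add: continuous_on_poly mult.commute)

end

locale orthonormal_polys = weighted_intervals g a b S G w
  for g :: nat and a b :: "nat \<Rightarrow> real" and S :: "real set" and G :: "complex \<Rightarrow> real"
    and w :: "real \<Rightarrow> real" +
  fixes p :: "nat \<Rightarrow> real poly"
  assumes p_deg: "\<And>l. degree (p l) = l"
    and p_orth: "\<And>i j. (\<integral>x. poly (p i) x * poly (p j) x * w x \<partial>lborel) = (if i = j then 1 else 0)"
begin

definition ip :: "real poly \<Rightarrow> real poly \<Rightarrow> real" where
  "ip r s = (\<integral>x. poly (r * s) x * w x \<partial>lborel)"

lemma ip_add: "ip (r + r') s = ip r s + ip r' s"
  unfolding ip_def using integrable_weight_poly[of "r * s"] integrable_weight_poly[of "r' * s"]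
  by (simp add: distrib_right)

lemma ip_smult: "ip (smult c r) s = c * ip r s"
  unfolding ip_def by (simp add: mult.assoc)

lemma ip_commute: "ip r s = ip s r" unfolding ip_def by (simp add: mult.commute)

lemma ip_zero: "ip 0 s = 0" unfolding ip_def by simp

lemma ip_sum: "ip (\<Sum>j\<in>J. smult (c j) (q j)) s = (\<Sum>j\<in>J. c j * ip (q j) s)"
  by (induction J rule: infinite_finite_induct) (simp_all add: ip_zero ip_add ip_smult)

lemma ip_orth: "ip (p i) (p j) = (if i = j then 1 else 0)"
  unfolding ip_def using p_orth by simp

lemma ip_X: "ip (pCons 0 r) s = ip r (pCons 0 s)"
  unfolding ip_def by (simp add: mult_ac)

text \<open>p_n has exact degree n, so leading terms can be removed one after another;
  orthonormality then identifies the coefficients.\<close>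

lemma poly_expansion:
  assumes "degree r \<le> n"
  shows "r = (\<Sum>j\<le>n. smult (ip r (p j)) (p j))"
proof -
  have pn: "coeff (p n) n \<noteq> 0" for n
  proof (cases n)
    case 0
    \<comment> \<open>Degree 0 does not exclude the zero polynomial; the normalisation does.\<close>
    have "p 0 \<noteq> 0" using ip_orth[of 0 0] ip_zero[of "p 0"] by auto
    then show ?thesis using 0 p_deg[of 0] leading_coeff_neq_0[of "p 0"] by simp
  next
    case (Suc m)
    then have "p n \<noteq> 0" using p_deg[of n] by auto
    then show ?thesis using p_deg[of n] leading_coeff_neq_0[of "p n"] by simp
  qed
  have p_high: "coeff (p n) i = 0" if "i > n" for i n using that p_deg[of n] by (simp add: coeff_eq_0)
  have "\<exists>c. r = (\<Sum>j\<le>n. smult (c j) (p j))"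
    using assms
  proof (induction n arbitrary: r)
    case 0
    have "r = smult (coeff r 0 / coeff (p 0) 0) (p 0)"
    proof (rule poly_eqI)
      fix i show "coeff r i = coeff (smult (coeff r 0 / coeff (p 0) 0) (p 0)) i"
        using pn[of 0] p_high[of 0 i] 0 by (cases "i = 0") (auto simp: coeff_eq_0)
    qed
    then show ?case by (intro exI[of _ "\<lambda>_. coeff r 0 / coeff (p 0) 0"]) simp
  next
    case (Suc n)
    define c0 where "c0 = coeff r (Suc n) / coeff (p (Suc n)) (Suc n)"
    have "degree (r - smult c0 (p (Suc n))) \<le> n"
    proof (rule degree_le, intro allI impI)
      fix i assume i: "i > n"
      show "coeff (r - smult c0 (p (Suc n))) i = 0"
      proof (cases "i = Suc n")
        case True
        then show ?thesis using pn[of "Suc n"] unfolding c0_def by simp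
      next
        case False
        then have "i > Suc n" using i by simp
        then show ?thesis using p_high[of "Suc n" i] Suc.prems by (simp add: coeff_eq_0)
      qed
    qed
    from Suc.IH[OF this] obtain c where "r - smult c0 (p (Suc n)) = (\<Sum>j\<le>n. smult (c j) (p j))" by blast
    then have "r = (\<Sum>j\<le>Suc n. smult ((c(Suc n := c0)) j) (p j))" by (simp add: algebra_simps)
    then show ?case by blast
  qed
  then obtain c where c: "r = (\<Sum>j\<le>n. smult (c j) (p j))" by blast
  have "ip r (p i) = c i" if "i \<le> n" for i
  proof -
    have "ip r (p i) = (\<Sum>j\<le>n. c j * ip (p j) (p i))" by (subst c) (rule ip_sum)
    also have "\<dots> = c i" using that by (simp add: ip_orth if_distrib cong: if_cong)
    finally show ?thesis .
  qed
  then have "(\<Sum>j\<le>n. smult (ip r (p j)) (p j)) = (\<Sum>j\<le>n. smult (c j) (p j))" by (intro sum.cong) auto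
  then show ?thesis using c by simp
qed

lemma ip_low_degree:
  assumes "degree r < l" shows "ip r (p l) = 0"
proof -
  have "ip r (p l) = (\<Sum>j\<le>l - 1. ip r (p j) * ip (p j) (p l))"
    using poly_expansion[of r "l - 1"] ip_sum[of "\<lambda>j. ip r (p j)" p "{..l - 1}" "p l"] assms by simp
  also have "\<dots> = 0" using assms by (intro sum.neutral) (auto simp: ip_orth)
  finally show ?thesis .
qed

definition rec_b :: "nat \<Rightarrow> real" where "rec_b l = ip (pCons 0 (p l)) (p (Suc l))"
definition rec_a :: "nat \<Rightarrow> real" where "rec_a l = ip (pCons 0 (p l)) (p l)"

text \<open>Multiplication by x is symmetric for \<open>ip\<close>, so x p_l is orthogonal to p_j as
  soon as x p_j has degree below l; the same symmetry identifies the lower coefficient with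
  \<open>rec_b (l - 1)\<close>.\<close>

lemma three_term:
  "pCons 0 (p l) = smult (rec_b l) (p (Suc l)) + smult (rec_a l) (p l)
     + (if l = 0 then 0 else smult (rec_b (l - 1)) (p (l - 1)))"
proof -
  let ?d = "\<lambda>j. ip (pCons 0 (p l)) (p j)"
  have deg: "degree (pCons 0 (p j)) \<le> Suc j" for j using degree_pCons_le[of 0 "p j"] p_deg by simp
  have low: "?d j = 0" if "Suc j < l" for j
  proof -
    have "degree (pCons 0 (p j)) < l" using deg[of j] that by linarith
    then show ?thesis using ip_X[of "p l" "p j"] ip_commute ip_low_degree by metis
  qed
  have "pCons 0 (p l) = (\<Sum>j\<le>Suc l. smult (?d j) (p j))" by (rule poly_expansion[OF deg])
  also have "\<dots> = smult (rec_b l) (p (Suc l)) + smult (rec_a l) (p l) + (\<Sum>j<l. smult (?d j) (p j))"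
    by (simp add: rec_a_def rec_b_def lessThan_Suc_atMost[symmetric] add_ac)
  also have "(\<Sum>j<l. smult (?d j) (p j)) = (if l = 0 then 0 else smult (rec_b (l - 1)) (p (l - 1)))"
  proof (cases l)
    case (Suc m)
    have "(\<Sum>j<m. smult (?d j) (p j)) = 0" using low Suc by (intro sum.neutral) auto
    moreover have "?d m = rec_b m" unfolding rec_b_def Suc using ip_X ip_commute by metis
    ultimately show ?thesis using Suc by simp
  qed simp
  finally show ?thesis .
qed

text \<open>Pointwise 2 |a b| <= a^2 + b^2 takes the place of Cauchy-Schwarz: for r of norm one the
  bound is 1, and r = 1 yields the L1 bound for p_l w.\<close>

lemma weight_am_gm: "(\<integral>x. \<bar>poly (p i) x\<bar> * \<bar>poly r x\<bar> * w x \<partial>lborel) \<le> (1 + ip r r) / 2"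
proof -
  have i: "integrable lborel (\<lambda>x. poly (p i * p i) x * w x)" "integrable lborel (\<lambda>x. poly (r * r) x * w x)"
    by (rule integrable_weight_poly)+
  have le: "\<bar>poly (p i) x\<bar> * \<bar>poly r x\<bar> * w x \<le> (poly (p i * p i) x * w x + poly (r * r) x * w x) / 2" for x
  proof -
    have "0 \<le> (\<bar>poly (p i) x\<bar> - \<bar>poly r x\<bar>)\<^sup>2" by simp
    then have "\<bar>poly (p i) x\<bar> * \<bar>poly r x\<bar> \<le> ((poly (p i) x)\<^sup>2 + (poly r x)\<^sup>2) / 2"
      unfolding power2_diff by simp
    then have "\<bar>poly (p i) x\<bar> * \<bar>poly r x\<bar> * w x \<le> ((poly (p i) x)\<^sup>2 + (poly r x)\<^sup>2) / 2 * w x"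
      by (rule mult_right_mono[OF _ w_nonneg])
    then show ?thesis by (simp add: power2_eq_square algebra_simps)
  qed
  have "(\<integral>x. \<bar>poly (p i) x\<bar> * \<bar>poly r x\<bar> * w x \<partial>lborel)
      \<le> (\<integral>x. (poly (p i * p i) x * w x + poly (r * r) x * w x) / 2 \<partial>lborel)"
    by (rule integral_mono') (use i le w_nonneg in \<open>auto simp: order_trans[OF _ le]\<close>)
  also have "\<dots> = (ip (p i) (p i) + ip r r) / 2" using i by (simp add: ip_def)
  finally show ?thesis by (simp add: ip_orth)
qed

section \<open>Fourier coefficients and the Jacobi recurrence\<close>

definition density_of :: "nat \<Rightarrow> real \<Rightarrow> real" where "density_of l x = poly (p l) x * w x"

lemma orthogonal_density_of: "orthogonal_density l (density_of l)"
  unfolding orthogonal_density_def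
proof (intro conjI allI impI)
  show "integrable lborel (density_of l)" unfolding density_of_def[abs_def] by (rule integrable_weight_poly)
  show "x \<notin> S \<Longrightarrow> density_of l x = 0" for x unfolding density_of_def using w_supp by simp
  have "ip 1 1 = 1" unfolding ip_def using w_mass by simp
  then show "(\<integral>x. \<bar>density_of l x\<bar> \<partial>lborel) \<le> 1"
    using weight_am_gm[of l 1] w_nonneg unfolding density_of_def by (simp add: abs_mult)
  fix i assume "i < l"
  then have "ip (monom 1 i) (p l) = 0" by (intro ip_low_degree) (simp add: degree_monom_eq)
  then show "(\<integral>x. density_of l x * x ^ i \<partial>lborel) = 0"
    unfolding ip_def density_of_def by (simp add: poly_monom mult_ac)
qed

definition coef :: "(complex \<Rightarrow> complex) \<Rightarrow> nat \<Rightarrow> complex" where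
  "coef h l = (\<integral>x. of_real (density_of l x) * h (of_real x) \<partial>lborel)"

lemma coef_integrable:
  assumes "continuous_on S (\<lambda>x. h (of_real x))"
  shows "integrable lborel (\<lambda>x. of_real (density_of l x) * (h (of_real x) :: complex))"
proof -
  have "integrable lborel (\<lambda>x. w x *\<^sub>R (of_real (poly (p l) x) * h (of_real x)))"
    by (intro integrable_weight continuous_intros assms)
  then show ?thesis unfolding density_of_def by (simp add: scaleR_conv_of_real mult_ac)
qed

lemma coef_add:
  assumes "continuous_on S (\<lambda>x. h (of_real x))" "continuous_on S (\<lambda>x. h' (of_real x))"
  shows "coef (\<lambda>z. h z + h' z) l = coef h l + coef h' l"
  unfolding coef_def using coef_integrable[OF assms(1)] coef_integrable[OF assms(2)]
  by (simp add: distrib_left)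

lemma coef_cmul: "coef (\<lambda>z. c * h z) l = c * coef h l"
proof -
  have "coef (\<lambda>z. c * h z) l = (\<integral>x. c * (of_real (density_of l x) * h (of_real x)) \<partial>lborel)"
    unfolding coef_def by (simp add: mult_ac)
  then show ?thesis unfolding coef_def by (simp only: integral_mult_right_zero)
qed

lemma coef_cong: "(\<And>x. x \<in> S \<Longrightarrow> h (of_real x) = h' (of_real x)) \<Longrightarrow> coef h l = coef h' l"
  unfolding coef_def density_of_def
  by (rule Bochner_Integration.integral_cong[OF refl]) (use w_supp in fastforce)

lemma coef_one: "coef (\<lambda>_. 1) l = of_real (ip 1 (p l))"
  unfolding coef_def density_of_def ip_def by (simp only: mult_1_right integral_complex_of_real mult_1)

lemma coef_X:
  assumes "continuous_on S (\<lambda>x. h (of_real x))"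
  shows "coef (\<lambda>z. z * h z) l = of_real (rec_b l) * coef h (Suc l) + of_real (rec_a l) * coef h l
    + (if l = 0 then 0 else of_real (rec_b (l - 1)) * coef h (l - 1))"
proof -
  let ?t = "\<lambda>l x. complex_of_real (density_of l x) * h (of_real x)"
  have "poly (pCons 0 (p l)) x = rec_b l * poly (p (Suc l)) x + rec_a l * poly (p l) x
     + (if l = 0 then 0 else rec_b (l - 1) * poly (p (l - 1)) x)" for x
    by (subst three_term) simp
  then have "x * density_of l x = rec_b l * density_of (Suc l) x + rec_a l * density_of l x
     + (if l = 0 then 0 else rec_b (l - 1) * density_of (l - 1) x)" for x
    unfolding density_of_def by (simp add: mult.assoc[symmetric]) (simp add: algebra_simps)
  then have "complex_of_real (x * density_of l x) = of_real (rec_b l) * of_real (density_of (Suc l) x)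
     + of_real (rec_a l) * of_real (density_of l x)
     + (if l = 0 then 0 else of_real (rec_b (l - 1)) * of_real (density_of (l - 1) x))" for x
    by simp
  then have "of_real (density_of l x) * (of_real x * h (of_real x)) = of_real (rec_b l) * ?t (Suc l) x + of_real (rec_a l) * ?t l x
     + (if l = 0 then 0 else of_real (rec_b (l - 1))) * ?t (l - 1) x" for x
    by (simp add: mult.assoc[symmetric] mult.commute[of _ "complex_of_real x"])
      (simp add: algebra_simps split: if_splits)
  then have "coef (\<lambda>z. z * h z) l = (\<integral>x. of_real (rec_b l) * ?t (Suc l) x + of_real (rec_a l) * ?t l x
     + (if l = 0 then 0 else of_real (rec_b (l - 1))) * ?t (l - 1) x \<partial>lborel)"
    unfolding coef_def by simp
  also have "\<dots> = of_real (rec_b l) * coef h (Suc l) + of_real (rec_a l) * coef h l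
    + (if l = 0 then 0 else of_real (rec_b (l - 1))) * coef h (l - 1)"
  proof -
    have "integrable lborel (?t j)" for j by (rule coef_integrable[OF assms])
    then show ?thesis unfolding coef_def
      by (simp only: Bochner_Integration.integral_add integrable_mult_right Bochner_Integration.integrable_add
          integral_mult_right_zero)
  qed
  finally show ?thesis by (simp split: if_splits)
qed

text \<open>|x| is bounded on S, and the mean inequality applies to two unit vectors. Boundedness is
  what lets the Christoffel-Darboux terms vanish in the limit.\<close>

lemma rec_b_bounded: obtains R where "\<And>l. \<bar>rec_b l\<bar> \<le> R"
proof -
  obtain R where R: "R \<ge> 1" "\<And>x. x \<in> S \<Longrightarrow> \<bar>x\<bar> \<le> R" by (rule S_bound) blast
  have "\<bar>rec_b l\<bar> \<le> R" for l
  proof -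
    let ?F = "\<lambda>x. \<bar>poly (p l) x\<bar> * \<bar>poly (p (Suc l)) x\<bar> * w x"
    have "integrable lborel (\<lambda>x. w x *\<^sub>R (\<bar>poly (p l) x\<bar> * \<bar>poly (p (Suc l)) x\<bar>))"
      by (intro integrable_weight continuous_intros)
    then have i: "integrable lborel ?F" by (simp add: mult_ac)
    have "norm (rec_b l) \<le> (\<integral>x. R * ?F x \<partial>lborel)"
      unfolding rec_b_def ip_def
    proof (rule Bochner_Integration.integral_norm_bound_integral)
      show "integrable lborel (\<lambda>x. poly (pCons 0 (p l) * p (Suc l)) x * w x)" by (rule integrable_weight_poly)
      show "integrable lborel (\<lambda>x. R * ?F x)" using i by simp
      show "norm (poly (pCons 0 (p l) * p (Suc l)) x * w x) \<le> R * ?F x" for x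
      proof (cases "x \<in> S")
        case True
        have "\<bar>x\<bar> * ?F x \<le> R * ?F x" using R(2)[OF True] w_nonneg[of x] by (intro mult_right_mono) auto
        then show ?thesis using w_nonneg[of x] by (simp add: abs_mult mult_ac)
      qed (use w_supp in simp)
    qed
    also have "\<dots> = R * (\<integral>x. ?F x \<partial>lborel)" by simp
    also have "\<dots> \<le> R * 1" using weight_am_gm[of l "p (Suc l)"] R(1) by (intro mult_left_mono) (auto simp: ip_orth)
    finally show ?thesis by simp
  qed
  then show ?thesis using that by blast
qed

lemma matrix_three_term:
  "A *v (poly_mat (p l) A *v v) = of_real (rec_b l) *s (poly_mat (p (Suc l)) A *v v) + of_real (rec_a l) *s (poly_mat (p l) A *v v)
    + (if l = 0 then 0 else of_real (rec_b (l - 1)) *s (poly_mat (p (l - 1)) A *v v))"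
  unfolding poly_mat_X_vec[symmetric]
proof -
  have "poly_mat 0 A *v v = 0" unfolding poly_mat_vec pmv_def by simp
  then show "poly_mat (pCons 0 (p l)) A *v v = of_real (rec_b l) *s (poly_mat (p (Suc l)) A *v v) + of_real (rec_a l) *s (poly_mat (p l) A *v v)
    + (if l = 0 then 0 else of_real (rec_b (l - 1)) *s (poly_mat (p (l - 1)) A *v v))"
    by (subst three_term) (simp add: poly_mat_add_vec poly_mat_smult_vec)
qed

text \<open>Multiplication by \<open>z\<close> commutes with \<open>A\<close> on partial sums up to a Christoffel-Darboux boundary
  term.\<close>
lemma partial_sum_shift:
  fixes A :: "complex^'n^'n" and v :: "complex^'n"
  assumes "continuous_on S (\<lambda>x. h (of_real x))"
  defines "P \<equiv> \<lambda>l. poly_mat (p l) A *v v"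
  shows "(\<Sum>l<Suc k. coef (\<lambda>z. z * h z) l *s P l) = A *v (\<Sum>l<Suc k. coef h l *s P l)
     + of_real (rec_b k) *s (coef h (Suc k) *s P k - coef h k *s P (Suc k))"
proof (induction k)
  case 0
  show ?case using matrix_three_term[of A 0 v] coef_X[OF assms(1), of 0]
    by (simp add: P_def mult_vec_smult) (simp add: vec_eq_iff algebra_simps)
next
  case (Suc k)
  \<comment> \<open>Both recurrences at index k + 1: the coupling to k cancels the previous boundary
    term, the coupling to k + 2 makes the new one.\<close>
  have "coef (\<lambda>z. z * h z) (Suc k) *s P (Suc k) = A *v (coef h (Suc k) *s P (Suc k))
      + of_real (rec_b (Suc k)) *s (coef h (Suc (Suc k)) *s P (Suc k) - coef h (Suc k) *s P (Suc (Suc k)))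
      - of_real (rec_b k) *s (coef h (Suc k) *s P k - coef h k *s P (Suc k))"
    using matrix_three_term[of A "Suc k" v] coef_X[OF assms(1), of "Suc k"]
    by (simp add: P_def mult_vec_smult) (simp add: vec_eq_iff algebra_simps)
  then show ?case unfolding sum.lessThan_Suc[of _ "Suc k"] Suc.IH matrix_vector_right_distrib by simp
qed

end

section \<open>The expansion of f(A)v\<close>

text \<open>Off a disc of radius e around c the quotient is at most 2 M / e; on the disc compactness
  bounds it. Boundedness lets the coefficient estimate be applied again to h.\<close>

lemma bounded_difference_quotient:
  assumes f: "f holomorphic_on X" "\<And>z. z \<in> X \<Longrightarrow> norm (f z) \<le> M" and X: "open X" "c \<in> X"
  defines "h \<equiv> \<lambda>u. if u = c then deriv f c else (f u - f c) / (u - c)"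
  obtains M' where "\<And>z. z \<in> X \<Longrightarrow> norm (h z) \<le> M'"
proof -
  have "h holomorphic_on X" unfolding h_def by (rule pole_lemma_open[OF f(1) X(1)])
  then have ch: "continuous_on X h" by (rule holomorphic_on_imp_continuous_on)
  obtain e where e: "e > 0" "cball c e \<subseteq> X" using X open_contains_cball by blast
  have "bounded (h ` cball c e)"
    using compact_continuous_image[OF continuous_on_subset[OF ch e(2)] compact_cball] compact_imp_bounded by blast
  then obtain M1 where M1: "\<And>z. z \<in> cball c e \<Longrightarrow> norm (h z) \<le> M1" unfolding bounded_iff by blast
  show ?thesis
  proof (rule that[of "max M1 (2 * M / e)"])
    fix z assume z: "z \<in> X"
    show "norm (h z) \<le> max M1 (2 * M / e)"
    proof (cases "z \<in> cball c e")
      case False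
      then have n: "norm (z - c) \<ge> e" "z \<noteq> c" using e(1) by (auto simp: dist_norm norm_minus_commute)
      have "norm (f z - f c) \<le> 2 * M"
        using norm_triangle_ineq4[of "f z" "f c"] f(2)[OF z] f(2)[OF X(2)] by linarith
      then have "norm (f z - f c) / norm (z - c) \<le> 2 * M / e"
        using n(1) e(1) order_trans[OF norm_ge_zero f(2)[OF X(2)]] by (intro frac_le) auto
      then show ?thesis using n(2) unfolding h_def by (simp add: norm_divide)
    qed (use M1 in force)
  qed
qed

locale Green_matfun = orthonormal_polys g a b S G w p + contour_functional \<Gamma> "{z. G z < t}" A
  for g a b S G w p \<Gamma> and t :: real and A :: "complex^'n^'n" +
  assumes t: "t > 0"
begin

lemma S_sub: "x \<in> S \<Longrightarrow> G (of_real x) < t"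
  using zero[of "of_real x"] t by auto

lemma continuous_on_S:
  assumes "h holomorphic_on {z. G z < t}"
  shows "continuous_on S (\<lambda>x. h (of_real x))"
  by (rule continuous_on_compose2[OF holomorphic_on_imp_continuous_on[OF assms]])
    (use S_sub in \<open>auto intro!: continuous_intros\<close>)

lemma coef_bound:
  obtains C where "C > 0" "\<And>f M l. \<lbrakk>f holomorphic_on {z. G z < t}; \<And>z. G z < t \<Longrightarrow> norm (f z) \<le> M\<rbrakk>
      \<Longrightarrow> norm (coef f l) \<le> C * M * exp (- (real l * t))"
proof -
  obtain C where C: "C > 0" "\<And>f M k l. \<lbrakk>f holomorphic_on {z. G z < t}; \<And>z. G z < t \<Longrightarrow> norm (f z) \<le> M;
      orthogonal_density l k\<rbrakk>
      \<Longrightarrow> norm (\<integral>x. of_real (k x) * f (of_real x) \<partial>lborel) \<le> C * M * exp (- (real l * t))"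
    by (rule coefficient_bound[OF t]) blast
  show ?thesis
    by (rule that[OF C(1)]) (unfold coef_def, rule C(2)[OF _ _ orthogonal_density_of], blast+)
qed

definition summable_vec :: "complex^'n \<Rightarrow> bool" where
  "summable_vec v \<longleftrightarrow> summable (\<lambda>l. exp (- (real l * t)) * norm (poly_mat (p l) A *v v))"

text \<open>A - c commutes with every p_l(A) and is bounded, so summability passes along the
  spectral induction.\<close>

lemma summable_vec_shift:
  assumes "summable_vec v" shows "summable_vec ((A - mat c) *v v)"
proof -
  have "bounded_linear ((*v) (A - mat c))" using linear_mult_vec linear_conv_bounded_linear by blast
  then obtain B where B: "\<And>x. norm ((A - mat c) *v x) \<le> norm x * B" using bounded_linear.bounded by blast
  show ?thesis unfolding summable_vec_def
  proof (rule summable_comparison_test')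
    show "summable (\<lambda>l. B * (exp (- (real l * t)) * norm (poly_mat (p l) A *v v)))"
      using assms unfolding summable_vec_def by (rule summable_mult)
    fix l :: nat assume "l \<ge> 0"
    have "exp (- (real l * t)) * norm ((A - mat c) *v (poly_mat (p l) A *v v))
        \<le> exp (- (real l * t)) * (norm (poly_mat (p l) A *v v) * B)"
      using B by (intro mult_left_mono) auto
    then show "norm (exp (- (real l * t)) * norm (poly_mat (p l) A *v ((A - mat c) *v v)))
        \<le> B * (exp (- (real l * t)) * norm (poly_mat (p l) A *v v))"
      unfolding poly_mat_shift_vec by (simp add: mult_ac)
  qed
qed

text \<open>The coefficients decay like exp(-l t), so each product is bounded by terms of the
  sequence that is assumed summable, and these tend to zero.\<close>

lemma boundary_term_tendsto_zero:
  assumes h: "h holomorphic_on {z. G z < t}" "\<And>z. G z < t \<Longrightarrow> norm (h z) \<le> M" and v: "summable_vec v"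
  defines "P \<equiv> \<lambda>l. poly_mat (p l) A *v v"
  shows "(\<lambda>k. of_real (rec_b k) *s (coef h (Suc k) *s P k - coef h k *s P (Suc k))) \<longlonglongrightarrow> 0"
proof -
  obtain C where C: "C > 0" "\<And>f M l. \<lbrakk>f holomorphic_on {z. G z < t}; \<And>z. G z < t \<Longrightarrow> norm (f z) \<le> M\<rbrakk>
      \<Longrightarrow> norm (coef f l) \<le> C * M * exp (- (real l * t))"
    by (rule coef_bound) blast
  have c: "norm (coef h l) \<le> C * M * exp (- (real l * t))" for l by (rule C(2)[OF h])
  obtain R where R: "\<And>l. \<bar>rec_b l\<bar> \<le> R" by (rule rec_b_bounded) blast
  obtain x0 where "x0 \<in> S" using S_nonempty by blast
  then have M: "M \<ge> 0" using h(2)[OF S_sub] norm_ge_zero order_trans by blast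
  define e where "e l = exp (- (real l * t)) * norm (P l)" for l
  have e: "e \<longlonglongrightarrow> 0" using v summable_LIMSEQ_zero unfolding summable_vec_def e_def P_def by blast
  have R0: "R \<ge> 0" using R[of 0] by linarith
  have bound: "norm (of_real (rec_b k) *s (coef h (Suc k) *s P k - coef h k *s P (Suc k)))
      \<le> R * (C * M * (e k + exp t * e (Suc k)))" for k
  proof -
    have "exp (- (real (Suc k) * t)) \<le> exp (- (real k * t))" using t by (simp add: algebra_simps)
    then have "C * M * exp (- (real (Suc k) * t)) \<le> C * M * exp (- (real k * t))"
      using C(1) M by (intro mult_left_mono) auto
    then have "norm (coef h (Suc k)) \<le> C * M * exp (- (real k * t))"
      using c[of "Suc k"] by (rule order_trans[rotated])
    then have 1: "norm (coef h (Suc k) *s P k) \<le> C * M * exp (- (real k * t)) * norm (P k)"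
      unfolding norm_smult_vec by (rule mult_right_mono) simp
    have 2: "norm (coef h k *s P (Suc k)) \<le> C * M * exp (- (real k * t)) * norm (P (Suc k))"
      unfolding norm_smult_vec by (rule mult_right_mono[OF c]) simp
    \<comment> \<open>Index mismatch: the coefficient at k meets the vector at k + 1, which costs
      exp t.\<close>
    have "exp (- (real k * t)) = exp t * exp (- (real (Suc k) * t))"
      unfolding mult_exp_exp by (simp add: algebra_simps)
    then have "norm (coef h (Suc k) *s P k - coef h k *s P (Suc k)) \<le> C * M * (e k + exp t * e (Suc k))"
      using norm_triangle_le_diff[OF add_mono[OF 1 2]] unfolding e_def by (simp add: algebra_simps)
    then show ?thesis unfolding norm_smult_vec using R[of k] R0
      by (intro mult_mono) auto
  qed
  have "(\<lambda>k. R * (C * M * (e k + exp t * e (Suc k)))) \<longlonglongrightarrow> R * (C * M * (0 + exp t * 0))"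
    by (intro tendsto_intros e LIMSEQ_Suc)
  then show ?thesis by (intro Lim_null_comparison[OF always_eventually[OF allI[OF bound]]]) simp
qed

theorem matfun_expansion:
  assumes "f holomorphic_on {z. G z < t}" "\<And>z. G z < t \<Longrightarrow> norm (f z) \<le> M" "summable_vec v"
  shows "(\<lambda>l. coef f l *s (poly_mat (p l) A *v v)) sums matfun_apply \<Gamma> f A v"
  using assms
proof (induction v arbitrary: f M rule: spectrum_induct[of _ A])
  case (1 f M)
  then show ?case by (simp add: matfun_zero)
next
  case (2 c v f M)
  note f = 2(3,4)
  let ?w = "(A - mat c) *v v"
  define P where "P l = poly_mat (p l) A *v v" for l
  have cX: "c \<in> {z. G z < t}" using spec_X 2(1) by blast
  define h where "h u = (if u = c then deriv f c else (f u - f c) / (u - c))" for u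
  have h: "h holomorphic_on {z. G z < t}"
    unfolding h_def[abs_def] by (rule pole_lemma_open[OF f(1) open_X])
  obtain M' where M': "\<And>z. G z < t \<Longrightarrow> norm (h z) \<le> M'"
    using bounded_difference_quotient[of f "{z. G z < t}" M c] f open_X cX unfolding h_def by (metis mem_Collect_eq)
  have "(\<lambda>l. coef h l *s (poly_mat (p l) A *v ?w)) sums matfun_apply \<Gamma> h A ?w"
    by (rule 2(2)[OF h M' summable_vec_shift[OF 2(5)]])
  then have lim1: "(\<lambda>k. \<Sum>l<Suc k. coef h l *s ((A - mat c) *v P l)) \<longlonglongrightarrow> matfun_apply \<Gamma> h A ?w"
    unfolding sums_def poly_mat_shift_vec P_def by (rule LIMSEQ_Suc)
  have lim2: "(\<lambda>k. of_real (rec_b k) *s (coef h (Suc k) *s P k - coef h k *s P (Suc k))) \<longlonglongrightarrow> 0"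
    unfolding P_def by (rule boundary_term_tendsto_zero[OF h M' 2(5)])
  have ch: "continuous_on S (\<lambda>x. h (of_real x))" by (rule continuous_on_S[OF h])
  \<comment> \<open>Coefficients depend on the values on S alone, where f = f(c) + (z - c) h holds,
    at z = c as well.\<close>
  have cf: "coef f l = f c * coef (\<lambda>_. 1) l + (coef (\<lambda>z. z * h z) l + (- c) * coef h l)" for l
  proof -
    have "coef f l = coef (\<lambda>z. f c * 1 + (z * h z + (- c) * h z)) l"
      by (rule coef_cong) (auto simp: h_def field_simps)
    also have "\<dots> = coef (\<lambda>z. f c * 1) l + (coef (\<lambda>z. z * h z) l + coef (\<lambda>z. (- c) * h z) l)"
      by (subst coef_add, (intro continuous_intros ch)+, subst coef_add, (intro continuous_intros ch)+) (rule refl)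
    finally show ?thesis by (simp only: coef_cmul)
  qed
  \<comment> \<open>The constant 1 is a multiple of p_0, so every nonempty partial sum of its
    expansion already equals v.\<close>
  have one: "(\<Sum>l<Suc k. coef (\<lambda>_. 1) l *s P l) = v" for k
  proof -
    have "(\<Sum>l<Suc k. coef (\<lambda>_. 1) l *s P l) = (\<Sum>l<Suc k. if l = 0 then of_real (ip 1 (p 0)) *s P 0 else 0)"
      by (intro sum.cong refl) (simp add: coef_one ip_low_degree)
    also have "\<dots> = of_real (ip 1 (p 0)) *s P 0" by (simp add: sum.lessThan_Suc_shift del: sum.lessThan_Suc)
    also have "\<dots> = poly_mat (smult (ip 1 (p 0)) (p 0)) A *v v" unfolding P_def poly_mat_smult_vec ..
    also have "smult (ip 1 (p 0)) (p 0) = 1" using poly_expansion[of 1 0] by simp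
    also have "poly_mat 1 A *v v = v" unfolding poly_mat_vec pmv_def by simp
    finally show ?thesis .
  qed
  have "(\<Sum>l<Suc k. coef f l *s P l) = f c *s v
      + of_real (rec_b k) *s (coef h (Suc k) *s P k - coef h k *s P (Suc k))
      + (\<Sum>l<Suc k. coef h l *s ((A - mat c) *v P l))" for k
  proof -
    have "(\<Sum>l<Suc k. coef f l *s P l) = f c *s (\<Sum>l<Suc k. coef (\<lambda>_. 1) l *s P l)
        + (\<Sum>l<Suc k. coef (\<lambda>z. z * h z) l *s P l) + (- c) *s (\<Sum>l<Suc k. coef h l *s P l)"
      unfolding cf smult_sum
      by (simp only: vector_sadd_rdistrib sum.distrib vector_smult_assoc add.assoc)
    also have "(\<Sum>l<Suc k. coef (\<lambda>z. z * h z) l *s P l) = A *v (\<Sum>l<Suc k. coef h l *s P l)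
        + of_real (rec_b k) *s (coef h (Suc k) *s P k - coef h k *s P (Suc k))"
      unfolding P_def by (rule partial_sum_shift[OF ch])
    also have "f c *s (\<Sum>l<Suc k. coef (\<lambda>_. 1) l *s P l) = f c *s v" unfolding one ..
    also have "A *v (\<Sum>l<Suc k. coef h l *s P l) = (\<Sum>l<Suc k. coef h l *s ((A - mat c) *v P l)) - (- c) *s (\<Sum>l<Suc k. coef h l *s P l)"
    proof -
      have "(\<Sum>l<Suc k. coef h l *s ((A - mat c) *v P l)) = A *v (\<Sum>l<Suc k. coef h l *s P l) + (- c) *s (\<Sum>l<Suc k. coef h l *s P l)"
        unfolding mult_vec_smult[symmetric] mult_vec_sum[symmetric] by (rule shift_mult_vec)
      then show ?thesis by (simp only: add_diff_cancel_right')
    qed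
    finally show ?thesis by simp
  qed
  then have "(\<lambda>k. \<Sum>l<Suc k. coef f l *s P l) \<longlonglongrightarrow> f c *s v + 0 + matfun_apply \<Gamma> h A ?w"
    by (simp only:) (intro tendsto_add lim1 lim2 tendsto_const)
  moreover have "matfun_apply \<Gamma> f A v = f c *s v + matfun_apply \<Gamma> h A ?w"
    unfolding h_def[abs_def] by (rule matfun_shift[OF f(1) 2(1)])
  ultimately have "(\<lambda>k. \<Sum>l<Suc k. coef f l *s P l) \<longlonglongrightarrow> matfun_apply \<Gamma> f A v" by simp
  then show ?case unfolding sums_def P_def by (rule LIMSEQ_imp_Suc)
qed

end

section \<open>The error bound\<close>

lemma complex_norm_properties:
  fixes N :: "complex^'n \<Rightarrow> real"
  assumes "is_complex_norm N"
  shows "N x \<ge> 0" "N (x + y) \<le> N x + N y" "N (c *s x) = norm c * N x" "N 0 = 0"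
  using assms unfolding is_complex_norm_def is_norm_on_def by blast+

lemma complex_norm_sum:
  fixes N :: "complex^'n \<Rightarrow> real"
  assumes N: "is_complex_norm N"
  shows "N (\<Sum>i\<in>I. f i) \<le> (\<Sum>i\<in>I. N (f i))"
proof (induction I rule: infinite_finite_induct)
  case (insert i I)
  then show ?case using complex_norm_properties(2)[OF N, of "f i" "\<Sum>i\<in>I. f i"] by simp
qed (simp_all add: complex_norm_properties(4)[OF N])

text \<open>Expand in the standard basis. The comparison transfers both limits and summability from
  the Euclidean norm to N.\<close>

lemma complex_norm_le:
  fixes N :: "complex^'n \<Rightarrow> real"
  assumes N: "is_complex_norm N"
  obtains K where "\<And>x. N x \<le> K * norm x"
proof (rule that)
  fix x :: "complex^'n"
  have "x = (\<Sum>i\<in>UNIV. (x $ i) *s axis i 1)"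
    by (simp add: vec_eq_iff axis_def if_distrib cong: if_cong)
  then have "N x \<le> (\<Sum>i\<in>UNIV. N ((x $ i) *s axis i 1))" using complex_norm_sum[OF N] by metis
  also have "\<dots> \<le> (\<Sum>i\<in>UNIV. norm x * N (axis i 1))"
    unfolding complex_norm_properties(3)[OF N]
    by (intro sum_mono mult_right_mono Finite_Cartesian_Product.norm_nth_le complex_norm_properties(1)[OF N])
  finally show "N x \<le> (\<Sum>i\<in>UNIV. N (axis i 1)) * norm x" by (simp add: sum_distrib_left mult.commute)
qed

lemma complex_norm_tendsto:
  fixes N :: "complex^'n \<Rightarrow> real"
  assumes N: "is_complex_norm N" and x: "x \<longlonglongrightarrow> l"
  shows "(\<lambda>k. N (x k)) \<longlonglongrightarrow> N l"
proof -
  obtain K where K: "\<And>x. N x \<le> K * norm x" using complex_norm_le[OF N] by metis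
  have neg: "N (- y) = N y" for y using complex_norm_properties(3)[OF N, of "- 1" y] by simp
  have diff: "norm (N y - N l) \<le> K * norm (y - l)" for y
    using complex_norm_properties(2)[OF N, of "y - l" l] complex_norm_properties(2)[OF N, of "l - y" y]
      neg[of "y - l"] K[of "y - l"] by simp
  have "(\<lambda>k. K * norm (x k - l)) \<longlonglongrightarrow> K * norm (l - l)" by (intro tendsto_intros x)
  then have "(\<lambda>k. N (x k) - N l) \<longlonglongrightarrow> 0"
    by (intro Lim_null_comparison[OF always_eventually[OF allI[OF diff]]]) simp
  then show ?thesis by (rule LIM_zero_cancel)
qed

section \<open>Gauge and Lebesgue integrals, measurability of the weight\<close>

lemma integral_eq_lborel:
  fixes f :: "real \<Rightarrow> 'b::euclidean_space"
  assumes "integrable lborel f" "\<And>x. x \<notin> S \<Longrightarrow> f x = 0"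
  shows "integral S f = integral\<^sup>L lborel f"
proof -
  have "(f has_integral integral\<^sup>L lborel f) UNIV" by (rule has_integral_integral_lborel[OF assms(1)])
  moreover have "(\<lambda>x. if x \<in> S then f x else 0) = f" using assms(2) by (auto simp: fun_eq_iff)
  ultimately have "(f has_integral integral\<^sup>L lborel f) S" using has_integral_restrict_UNIV[of S f] by simp
  then show ?thesis by (rule integral_unique)
qed

text \<open>h is unconstrained off the interval, so it is handled together with the indicator; on
  the interval it is continuous as the real part of H.\<close>

lemma Jacobi_type_term_measurable:
  assumes ab: "a \<le> b" and H: "open U" "complex_of_real ` {a..b} \<subseteq> U" "H holomorphic_on U"
      "\<forall>x\<in>{a..b}. H (complex_of_real x) = complex_of_real (h x)"
    and \<alpha>\<beta>: "\<alpha> \<in> {-1, 1}" "\<beta> \<in> {-1, 1 :: int}"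
  shows "(\<lambda>x. indicator {a..b} x * h x * (sqrt (x - a)) powi \<alpha> * (sqrt (b - x)) powi \<beta>) \<in> borel_measurable borel"
proof -
  have "continuous_on {a..b} (\<lambda>x. Re (H (complex_of_real x)))"
    by (intro continuous_intros continuous_on_compose2[OF holomorphic_on_imp_continuous_on[OF H(3)]])
      (use H(2) in auto)
  then have "continuous_on {a..b} h" by (rule continuous_on_eq) (use H(4) in auto)
  then have "(\<lambda>x. indicator {a..b} x *\<^sub>R h x) \<in> borel_measurable borel"
    by (intro borel_measurable_continuous_on_indicator) auto
  then have [measurable]: "(\<lambda>x. indicator {a..b} x * h x) \<in> borel_measurable borel" by simp
  have "(\<lambda>x. (sqrt (x - a)) powi \<alpha>) \<in> borel_measurable borel"
    using \<alpha>\<beta>(1) by (auto simp: power_int_minus)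
  moreover have "(\<lambda>x. (sqrt (b - x)) powi \<beta>) \<in> borel_measurable borel"
    using \<alpha>\<beta>(2) by (auto simp: power_int_minus)
  ultimately show ?thesis by measurable
qed

lemma integrable_of_integral_one:
  fixes w :: "real \<Rightarrow> real"
  assumes [measurable]: "w \<in> borel_measurable borel" and w: "\<And>x. w x \<ge> 0" "\<And>x. x \<notin> S \<Longrightarrow> w x = 0"
    and int: "integral S w = 1"
  shows "integrable lborel w" "(\<integral>x. w x \<partial>lborel) = 1"
proof -
  \<comment> \<open>The gauge integral is 0 by default on nonintegrable functions, so the value 1
    forces integrability; nonnegativity then makes it absolute.\<close>
  have "w integrable_on S" using int not_integrable_integral by force
  then have "w absolutely_integrable_on S"
    by (rule nonnegative_absolutely_integrable_1) (use w in simp)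
  then have "integrable lebesgue (\<lambda>x. indicator S x *\<^sub>R w x)" unfolding set_integrable_def .
  also have "(\<lambda>x. indicator S x *\<^sub>R w x) = w" using w(2) by (auto simp: fun_eq_iff indicator_def)
  finally show *: "integrable lborel w" by (subst (asm) integrable_completion) auto
  show "(\<integral>x. w x \<partial>lborel) = 1" using integral_eq_lborel[OF * w(2)] int by simp
qed

section \<open>Quadrature coefficients and the tail of the expansion\<close>

context Green_matfun
begin

text \<open>In the notation of the paper, \<open>r\<close> is \<open>\<rho>\<^sub>m\<close>; its Fourier coefficients are the discrepancy between
  the exact coefficients of \<open>f\<close> and those obtained by quadrature from the Cauchy transforms.\<close>
lemma quadrature_coefficients:
  fixes f :: "complex \<Rightarrow> complex" and z \<omega> :: "nat \<Rightarrow> complex"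
  assumes f: "f holomorphic_on {z. G z < t}" and nodes: "\<And>j. j < m \<Longrightarrow> z j \<notin> complex_of_real ` S"
  defines "r \<equiv> \<lambda>\<zeta>. 2 * pi * \<i> * f \<zeta> - (\<Sum>j<m. f (z j) / (z j - \<zeta>) * \<omega> j)"
  shows "continuous_on S (\<lambda>x. r (of_real x))"
    and "(\<Sum>j<m. f (z j) * \<omega> j * cauchy_transform S (\<lambda>s. poly (p l) s * w s) (z j))
      = 1 / (2 * pi * \<i>) * coef r l - coef f l"
proof -
  have cj: "continuous_on S (\<lambda>x. 1 / (z j - of_real x))" if "j < m" for j
    using nodes[OF that] by (intro continuous_intros) auto
  have cf: "continuous_on S (\<lambda>x. f (of_real x))" by (rule continuous_on_S[OF f])
  have csum: "continuous_on S (\<lambda>x. \<Sum>j<m. (- f (z j) * \<omega> j) * (1 / (z j - of_real x)))"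
    by (intro continuous_on_sum continuous_on_mult continuous_on_const cj) auto
  have r: "r = (\<lambda>\<zeta>. 2 * pi * \<i> * f \<zeta> + (\<Sum>j<m. (- f (z j) * \<omega> j) * (1 / (z j - \<zeta>))))"
    unfolding r_def by (simp add: sum_negf)
  show "continuous_on S (\<lambda>x. r (of_real x))" unfolding r
    by (intro continuous_on_add continuous_on_mult continuous_on_const cf csum)
  have sum_coef: "coef (\<lambda>\<zeta>. \<Sum>j<n. (- f (z j) * \<omega> j) * (1 / (z j - \<zeta>))) l
      = (\<Sum>j<n. (- f (z j) * \<omega> j) * coef (\<lambda>\<zeta>. 1 / (z j - \<zeta>)) l)" if "n \<le> m" for n
    using that
  proof (induction n)
    case (Suc n)
    have "continuous_on S (\<lambda>x. \<Sum>j<n. (- f (z j) * \<omega> j) * (1 / (z j - of_real x)))"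
      "continuous_on S (\<lambda>x. (- f (z n) * \<omega> n) * (1 / (z n - of_real x)))"
      using Suc.prems by (intro continuous_on_sum continuous_on_mult continuous_on_const cj; simp)+
    from coef_add[OF this] Suc show ?case by (simp only: sum.lessThan_Suc coef_cmul Suc_leD)
  qed (simp add: coef_def)
  have "coef r l = 2 * pi * \<i> * coef f l + (\<Sum>j<m. (- f (z j) * \<omega> j) * coef (\<lambda>\<zeta>. 1 / (z j - \<zeta>)) l)"
    unfolding r by (subst coef_add) (intro continuous_on_mult continuous_on_const cf, rule csum, simp only: coef_cmul sum_coef order_refl)
  then have 1: "1 / (2 * pi * \<i>) * coef r l - coef f l
      = (\<Sum>j<m. 1 / (2 * pi * \<i>) * ((- f (z j) * \<omega> j) * coef (\<lambda>\<zeta>. 1 / (z j - \<zeta>)) l))"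
    by (simp add: sum_distrib_left distrib_left add_divide_distrib)
  have 2: "cauchy_transform S (\<lambda>s. poly (p l) s * w s) (z j) = 1 / (2 * pi * \<i>) * (- coef (\<lambda>\<zeta>. 1 / (z j - \<zeta>)) l)"
    if "j < m" for j
  proof -
    have eq: "complex_of_real (poly (p l) s * w s) / (of_real s - z j)
        = - (of_real (density_of l s) * (1 / (z j - of_real s)))" for s
      unfolding density_of_def by (metis minus_diff_eq minus_divide_right mult.right_neutral times_divide_eq_right)
    have i: "integrable lborel (\<lambda>s. - (complex_of_real (density_of l s) * (1 / (z j - of_real s))))"
      using coef_integrable[of "\<lambda>\<zeta>. 1 / (z j - \<zeta>)" l] cj[OF that] by (intro Bochner_Integration.integrable_minus) simp
    have "integral S (\<lambda>s. - (complex_of_real (density_of l s) * (1 / (z j - of_real s))))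
        = (\<integral>s. - (complex_of_real (density_of l s) * (1 / (z j - of_real s))) \<partial>lborel)"
      by (rule integral_eq_lborel[OF i]) (use w_supp in \<open>simp add: density_of_def\<close>)
    then show ?thesis unfolding cauchy_transform_def eq coef_def by (simp only: Bochner_Integration.integral_minus)
  qed
  show "(\<Sum>j<m. f (z j) * \<omega> j * cauchy_transform S (\<lambda>s. poly (p l) s * w s) (z j))
      = 1 / (2 * pi * \<i>) * coef r l - coef f l"
    unfolding 1 by (rule sum.cong[OF refl]) (simp add: 2)
qed

text \<open>\<open>density_of l\<close> has L1 mass at most 1. Compactness of S bounds the values of
  r, so that the real supremum is a genuine upper bound.\<close>

lemma coef_norm_le_sup:
  assumes "continuous_on S (\<lambda>x. r (of_real x))"
  shows "norm (coef r l) \<le> (SUP x\<in>S. norm (r (of_real x)))"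
proof -
  let ?s = "SUP x\<in>S. norm (r (complex_of_real x))"
  have "compact ((\<lambda>x. norm (r (complex_of_real x))) ` S)"
    by (intro compact_continuous_image continuous_on_norm assms compact_S)
  then have bdd: "bdd_above ((\<lambda>x. norm (r (complex_of_real x))) ` S)"
    by (intro bounded_imp_bdd_above compact_imp_bounded)
  have le: "norm (r (of_real x)) \<le> ?s" if "x \<in> S" for x by (rule cSUP_upper[OF that bdd])
  obtain x0 where "x0 \<in> S" using S_nonempty by blast
  then have s0: "?s \<ge> 0" using le norm_ge_zero order_trans by blast
  have od: "integrable lborel (density_of l)" "(\<integral>x. \<bar>density_of l x\<bar> \<partial>lborel) \<le> 1"
    using orthogonal_density_of[of l] unfolding orthogonal_density_def by blast+
  have "norm (coef r l) \<le> (\<integral>x. \<bar>density_of l x\<bar> * ?s \<partial>lborel)"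
    unfolding coef_def
  proof (rule Bochner_Integration.integral_norm_bound_integral[OF coef_integrable[OF assms]])
    show "integrable lborel (\<lambda>x. \<bar>density_of l x\<bar> * ?s)" using od(1) by simp
    show "norm (of_real (density_of l x) * r (of_real x)) \<le> \<bar>density_of l x\<bar> * ?s" for x
    proof (cases "x \<in> S")
      case True
      then show ?thesis using le[of x] by (simp add: norm_mult mult_left_mono)
    qed (simp add: density_of_def w_supp)
  qed
  also have "\<dots> = (\<integral>x. \<bar>density_of l x\<bar> \<partial>lborel) * ?s" by simp
  also have "\<dots> \<le> 1 * ?s" using od(2) s0 by (rule mult_right_mono)
  finally show ?thesis by simp
qed

text \<open>C comes from the scalar coefficients and is fixed before N and k, so one constant serves
  all norms; the comparison of N with the Euclidean norm secures the convergence without entering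
  C.\<close>

lemma matfun_tail_bound:
  assumes v: "summable_vec v"
  obtains C where "C > 0" "\<And>f M N k. \<lbrakk>f holomorphic_on {z. G z < t}; \<And>z. G z < t \<Longrightarrow> norm (f z) \<le> M;
      is_complex_norm N\<rbrakk> \<Longrightarrow> N (matfun_apply \<Gamma> f A v - (\<Sum>l<k. coef f l *s (poly_mat (p l) A *v v)))
        \<le> C * M * (\<Sum>i. exp (- (real (i + k) * t)) * N (poly_mat (p (i + k)) A *v v))"
proof -
  obtain C where C: "C > 0" "\<And>f M l. \<lbrakk>f holomorphic_on {z. G z < t}; \<And>z. G z < t \<Longrightarrow> norm (f z) \<le> M\<rbrakk>
      \<Longrightarrow> norm (coef f l) \<le> C * M * exp (- (real l * t))"
    by (rule coef_bound) blast
  show ?thesis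
  proof (rule that[OF C(1)])
    fix f M and N :: "complex^'n \<Rightarrow> real" and k
    assume f: "f holomorphic_on {z. G z < t}" "\<And>z. G z < t \<Longrightarrow> norm (f z) \<le> M" and N: "is_complex_norm N"
    define P where "P l = poly_mat (p l) A *v v" for l
    define e where "e l = exp (- (real l * t)) * N (P l)" for l
    have e0: "e l \<ge> 0" for l unfolding e_def using complex_norm_properties(1)[OF N] by simp
    have sume: "summable (\<lambda>i. e (i + k))"
    proof -
      obtain K where K: "\<And>x. N x \<le> K * norm x" using complex_norm_le[OF N] by metis
      have "summable (\<lambda>l. K * (exp (- (real l * t)) * norm (P l)))"
        using v unfolding summable_vec_def P_def by (rule summable_mult)
      then have "summable e"
      proof (rule summable_comparison_test')
        fix l :: nat
        have "exp (- (real l * t)) * N (P l) \<le> exp (- (real l * t)) * (K * norm (P l))"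
          by (rule mult_left_mono[OF K]) simp
        then show "norm (e l) \<le> K * (exp (- (real l * t)) * norm (P l))"
          using e0[of l] unfolding e_def by (simp add: mult_ac)
      qed
      then show ?thesis by (rule summable_ignore_initial_segment)
    qed
    obtain x0 where "x0 \<in> S" using S_nonempty by blast
    then have M: "M \<ge> 0" using f(2)[OF S_sub] norm_ge_zero order_trans by blast
    have "(\<lambda>l. coef f l *s P l) sums matfun_apply \<Gamma> f A v"
      unfolding P_def by (rule matfun_expansion[OF f v])
    then have "(\<lambda>i. coef f (i + k) *s P (i + k)) sums (matfun_apply \<Gamma> f A v - (\<Sum>l<k. coef f l *s P l))"
      by (rule sums_split_initial_segment)
    then have lim: "(\<lambda>n. \<Sum>i<n. coef f (i + k) *s P (i + k)) \<longlonglongrightarrow> matfun_apply \<Gamma> f A v - (\<Sum>l<k. coef f l *s P l)"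
      unfolding sums_def .
    have "N (\<Sum>i<n. coef f (i + k) *s P (i + k)) \<le> C * M * (\<Sum>i. e (i + k))" for n
    proof -
      have "N (\<Sum>i<n. coef f (i + k) *s P (i + k)) \<le> (\<Sum>i<n. norm (coef f (i + k)) * N (P (i + k)))"
        using complex_norm_sum[OF N, of "\<lambda>i. coef f (i + k) *s P (i + k)" "{..<n}"]
        unfolding complex_norm_properties(3)[OF N] .
      also have "\<dots> \<le> (\<Sum>i<n. C * M * exp (- (real (i + k) * t)) * N (P (i + k)))"
        by (intro sum_mono mult_right_mono C(2)[OF f] complex_norm_properties(1)[OF N])
      also have "\<dots> = C * M * (\<Sum>i<n. e (i + k))" unfolding e_def by (simp add: sum_distrib_left mult.assoc)
      also have "\<dots> \<le> C * M * (\<Sum>i. e (i + k))"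
        using C(1) M e0 by (intro mult_left_mono sum_le_suminf[OF sume]) auto
      finally show ?thesis .
    qed
    then have "N (matfun_apply \<Gamma> f A v - (\<Sum>l<k. coef f l *s P l)) \<le> C * M * (\<Sum>i. e (i + k))"
      by (intro LIMSEQ_le_const2[OF complex_norm_tendsto[OF N lim]]) blast
    then show "N (matfun_apply \<Gamma> f A v - (\<Sum>l<k. coef f l *s (poly_mat (p l) A *v v)))
        \<le> C * M * (\<Sum>i. exp (- (real (i + k) * t)) * N (poly_mat (p (i + k)) A *v v))"
      unfolding e_def P_def .
  qed
qed

end

theorem theorem4p4:
  fixes g :: nat and a b :: "nat \<Rightarrow> real" and h :: "nat \<Rightarrow> real \<Rightarrow> real"
    and \<alpha> \<beta> :: "nat \<Rightarrow> int" and w :: "real \<Rightarrow> real" and p :: "nat \<Rightarrow> real poly"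
    and G :: "complex \<Rightarrow> real" and rho M :: real and f :: "complex \<Rightarrow> complex"
    and A :: "complex^'n^'n" and v :: "complex^'n"
    and \<Gamma> :: "(real \<Rightarrow> complex) list"
    and m :: nat and z \<omega> :: "nat \<Rightarrow> complex"
    and S :: "real set"
  assumes S_def: "S = (\<Union>j\<le>g. {a j..b j})"
    and ab: "\<And>j. j \<le> g \<Longrightarrow> a j < b j"
    and disj: "\<And>i j. i \<le> g \<Longrightarrow> j \<le> g \<Longrightarrow> i \<noteq> j \<Longrightarrow> {a i..b i} \<inter> {a j..b j} = {}"
    and alpha_beta: "\<And>j. j \<le> g \<Longrightarrow> \<alpha> j \<in> {-1, 1} \<and> \<beta> j \<in> {-1, 1}"
    and h_pos: "\<And>j x. j \<le> g \<Longrightarrow> x \<in> {a j..b j} \<Longrightarrow> h j x > 0"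
    and h_analytic: "\<And>j. j \<le> g \<Longrightarrow> \<exists>U H. open U \<and> complex_of_real ` {a j..b j} \<subseteq> U \<and>
          H holomorphic_on U \<and> (\<forall>x\<in>{a j..b j}. H (complex_of_real x) = complex_of_real (h j x))"
    and w_def: "\<And>x. w x = (\<Sum>j\<le>g. indicator {a j..b j} x * h j x *
          (sqrt (x - a j)) powi (\<alpha> j) * (sqrt (b j - x)) powi (\<beta> j))"
    and w_int: "integral S w = 1"
    and p_deg: "\<And>l. degree (p l) = l"
    and p_lead: "\<And>l. lead_coeff (p l) > 0"
    and p_orth: "\<And>i j. integral S (\<lambda>x. poly (p i) x * poly (p j) x * w x) = (if i = j then 1 else 0)"
    and green: "is_green_function (complex_of_real ` S) G"
    and rho_gt: "rho > 1"
    and f_hol: "f holomorphic_on {u. exp (G u) < rho}"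
    and f_bound: "\<And>u. exp (G u) < rho \<Longrightarrow> norm (f u) \<le> M"
    and \<Gamma>_paths: "\<And>\<gamma>. \<gamma> \<in> set \<Gamma> \<Longrightarrow> valid_path \<gamma> \<and> pathfinish \<gamma> = pathstart \<gamma>"
    and \<Gamma>_in: "contour_image \<Gamma> \<subseteq> {u. exp (G u) < rho}"
    and \<Gamma>_ccw: "\<And>u. u \<notin> contour_image \<Gamma> \<Longrightarrow> contour_winding \<Gamma> u \<in> {0, 1}"
    and \<Gamma>_encl: "\<And>u. u \<in> complex_of_real ` S \<union> mat_spectrum A \<Longrightarrow>
          u \<notin> contour_image \<Gamma> \<and> contour_winding \<Gamma> u = 1"
    and nodes: "\<And>j. j < m \<Longrightarrow> z j \<in> contour_image \<Gamma> - complex_of_real ` S"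
    and summ: "summable (\<lambda>l. rho powi (- int l) * norm (poly_mat (p l) A *v v))"
  shows "\<exists>\<epsilon> :: nat \<Rightarrow> complex.
           (\<forall>l. norm (\<epsilon> l) \<le> (SUP x\<in>S. norm (
               contour_int \<Gamma> (\<lambda>u. f u / (u - complex_of_real x))
               - (\<Sum>j<m. f (z j) / (z j - complex_of_real x) * \<omega> j)))) \<and>
           (\<exists>C>0. \<forall>N. is_complex_norm N \<longrightarrow> (\<forall>k.
              N (matfun_apply \<Gamma> f A v
                 - (- (\<Sum>l<k. (\<Sum>j<m. f (z j) * \<omega> j *
                         cauchy_transform S (\<lambda>s. poly (p l) s * w s) (z j))
                       *s (poly_mat (p l) A *v v)))
                 + (\<Sum>l<k. \<epsilon> l *s (poly_mat (p l) A *v v)))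
              \<le> C * M * (\<Sum>i. rho powi (- int (i + k)) * N (poly_mat (p (i + k)) A *v v))))"
proof -
  \<comment> \<open>Turns {exp G < rho} into {G < t} and rho^(-l) into exp(-l t).\<close>
  define t where "t = ln rho"
  have t: "t > 0" unfolding t_def using rho_gt by simp
  have rho: "rho = exp t" unfolding t_def using rho_gt by simp
  have X: "{u. exp (G u) < rho} = {z. G z < t}" unfolding rho by simp
  have powi: "rho powi (- int l) = exp (- (real l * t))" for l
    unfolding rho by (simp add: power_int_minus exp_minus flip: exp_of_nat_mult)
  interpret I: interval_green g a b S G
    by unfold_locales (use S_def ab disj green in blast)+
  have w0: "w x \<ge> 0" for x
    unfolding w_def
  proof (rule sum_nonneg)
    fix j assume "j \<in> {..g}"
    then show "0 \<le> indicator {a j..b j} x * h j x * (sqrt (x - a j)) powi (\<alpha> j) * (sqrt (b j - x)) powi (\<beta> j)"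
      using h_pos[of j x] by (cases "x \<in> {a j..b j}") (auto intro!: mult_nonneg_nonneg zero_le_power_int)
  qed
  have wS: "w x = 0" if "x \<notin> S" for x
    unfolding w_def using that S_def by (intro sum.neutral) (auto simp: indicator_def)
  have meas: "w \<in> borel_measurable borel"
    unfolding w_def[abs_def]
  proof (rule borel_measurable_sum)
    fix j assume "j \<in> {..g}"
    then have j: "j \<le> g" by simp
    obtain U H where "open U" "complex_of_real ` {a j..b j} \<subseteq> U" "H holomorphic_on U"
      "\<forall>x\<in>{a j..b j}. H (complex_of_real x) = complex_of_real (h j x)" using h_analytic[OF j] by blast
    then show "(\<lambda>x. indicator {a j..b j} x * h j x * (sqrt (x - a j)) powi (\<alpha> j) * (sqrt (b j - x)) powi (\<beta> j))
        \<in> borel_measurable borel"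
      by (rule Jacobi_type_term_measurable[rotated]) (use ab[OF j] alpha_beta[OF j] in auto)
  qed
  note w1 = integrable_of_integral_one[OF meas w0 wS w_int]
  interpret W: weighted_intervals g a b S G w
    by unfold_locales (use w0 wS w1 in auto)
  have orth: "(\<integral>x. poly (p i) x * poly (p j) x * w x \<partial>lborel) = (if i = j then 1 else 0)" for i j
  proof -
    have "integrable lborel (\<lambda>x. poly (p i) x * poly (p j) x * w x)"
      using W.integrable_weight_poly[of "p i * p j"] by simp
    from integral_eq_lborel[OF this, of S] show ?thesis using p_orth[of i j] wS by simp
  qed
  have in_t: "path_image \<gamma> \<subseteq> {z. G z < t}" if "\<gamma> \<in> set \<Gamma>" for \<gamma>
    using \<Gamma>_in that unfolding X contour_image_def by blast
  \<comment> \<open>Loops inside the sublevel set do not wind around points with G >= t, while every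
    eigenvalue has total winding number 1.\<close>
  have spec: "G c < t" if c: "c \<in> mat_spectrum A" for c
  proof (rule ccontr)
    assume "\<not> G c < t"
    then have "winding_number \<gamma> c = 0" if "\<gamma> \<in> set \<Gamma>" for \<gamma>
      using I.winding_number_sublevel[OF t _ _ in_t[OF that]] \<Gamma>_paths[OF that] by simp
    then have "contour_winding \<Gamma> c = 0" unfolding contour_winding_def
      by (simp cong: map_cong)
    then show False using \<Gamma>_encl[of c] c by simp
  qed
  interpret Green_matfun g a b S G w p \<Gamma> t A
  proof unfold_locales
    show "contour_image \<Gamma> \<subseteq> {z. G z < t}" using \<Gamma>_in unfolding X .
    show "(h has_contour_integral 0) \<gamma>" if "h holomorphic_on {z. G z < t}" "\<gamma> \<in> set \<Gamma>" for h \<gamma>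
      using I.Cauchy_theorem_sublevel[OF t _ _ in_t[OF that(2)] that(1)] \<Gamma>_paths[OF that(2)] by blast
    show "open {z. G z < t}" by (rule I.open_sublevel)
  qed (use p_deg orth \<Gamma>_paths \<Gamma>_encl spec t in auto)
  have f: "f holomorphic_on {z. G z < t}" "\<And>z. G z < t \<Longrightarrow> norm (f z) \<le> M"
    using f_hol f_bound unfolding X rho by auto
  have v: "summable_vec v" using summ unfolding summable_vec_def powi .
  obtain C where C: "C > 0" "\<And>f M N k. \<lbrakk>f holomorphic_on {z. G z < t}; \<And>z. G z < t \<Longrightarrow> norm (f z) \<le> M;
      is_complex_norm N\<rbrakk> \<Longrightarrow> N (matfun_apply \<Gamma> f A v - (\<Sum>l<k. coef f l *s (poly_mat (p l) A *v v)))
        \<le> C * M * (\<Sum>i. exp (- (real (i + k) * t)) * N (poly_mat (p (i + k)) A *v v))"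
    by (rule matfun_tail_bound[OF v]) blast
  \<comment> \<open>On S this agrees with the quadrature residual, by Cauchy's formula with total
    winding number 1; since no node lies on S it is continuous there.\<close>
  define r where "r \<zeta> = 2 * pi * \<i> * f \<zeta> - (\<Sum>j<m. f (z j) / (z j - \<zeta>) * \<omega> j)" for \<zeta>
  have nodes': "z j \<notin> complex_of_real ` S" if "j < m" for j using nodes[OF that] by blast
  have r_cont: "continuous_on S (\<lambda>x. r (of_real x))"
    unfolding r_def by (rule quadrature_coefficients(1)[OF f(1) nodes'])
  have quad: "(\<Sum>j<m. f (z j) * \<omega> j * cauchy_transform S (\<lambda>s. poly (p l) s * w s) (z j))
      = 1 / (2 * pi * \<i>) * coef r l - coef f l" for l
    unfolding r_def[abs_def] by (rule quadrature_coefficients(2)[OF f(1) nodes'])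
  have r_eq: "contour_int \<Gamma> (\<lambda>u. f u / (u - complex_of_real x))
      - (\<Sum>j<m. f (z j) / (z j - complex_of_real x) * \<omega> j) = r (of_real x)" if x: "x \<in> S" for x
  proof -
    have enc: "of_real x \<notin> contour_image \<Gamma>" "contour_winding \<Gamma> (of_real x) = 1"
      using \<Gamma>_encl[of "of_real x"] x by auto
    have "has_cint \<Gamma> (\<lambda>u. f u / (u - of_real x)) (\<Sum>\<gamma>\<leftarrow>\<Gamma>. 2 * pi * \<i> * winding_number \<gamma> (of_real x) * f (of_real x))"
    proof (rule has_cint_list)
      fix \<gamma> assume g: "\<gamma> \<in> set \<Gamma>"
      show "((\<lambda>u. f u / (u - of_real x)) has_contour_integral (2 * pi * \<i> * winding_number \<gamma> (of_real x) * f (of_real x))) \<gamma>"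
        by (rule I.Cauchy_formula_sublevel[OF t _ _ in_t[OF g] f(1) S_sub[OF x]])
          (use \<Gamma>_paths[OF g] enc(1) g in \<open>auto simp: contour_image_def\<close>)
    qed
    also have "(\<Sum>\<gamma>\<leftarrow>\<Gamma>. 2 * pi * \<i> * winding_number \<gamma> (of_real x) * f (of_real x)) = 2 * pi * \<i> * f (of_real x)"
      using enc(2) unfolding contour_winding_def by (simp add: sum_list_const_mult sum_list_mult_const)
    finally show ?thesis unfolding has_cint_def r_def by simp
  qed
  \<comment> \<open>The quadrature coefficient is the one of r over 2 pi i minus the exact one of f;
    \<epsilon> cancels the first part. The bound gives away the factor 1 / (2 pi).\<close>
  define \<epsilon> where "\<epsilon> l = 1 / (2 * pi * \<i>) * - coef r l" for l
  show ?thesis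
  proof (intro exI[of _ \<epsilon>] conjI allI exI[of _ C] impI)
    fix l
    have "norm (\<epsilon> l) = norm (coef r l) / (2 * pi)" unfolding \<epsilon>_def by (simp add: norm_mult norm_divide)
    also have "\<dots> \<le> norm (coef r l) / 1" using pi_ge_two by (intro divide_left_mono) auto
    also have "\<dots> \<le> (SUP x\<in>S. norm (r (of_real x)))" using coef_norm_le_sup[OF r_cont] by simp
    also have "\<dots> = (SUP x\<in>S. norm (contour_int \<Gamma> (\<lambda>u. f u / (u - complex_of_real x))
               - (\<Sum>j<m. f (z j) / (z j - complex_of_real x) * \<omega> j)))"
      by (rule SUP_cong[OF refl]) (simp only: r_eq)
    finally show "norm (\<epsilon> l) \<le> (SUP x\<in>S. norm (contour_int \<Gamma> (\<lambda>u. f u / (u - complex_of_real x))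
               - (\<Sum>j<m. f (z j) / (z j - complex_of_real x) * \<omega> j)))" .
  next
    fix N :: "complex^'n \<Rightarrow> real" and k assume N: "is_complex_norm N"
    let ?P = "\<lambda>l. poly_mat (p l) A *v v"
    have "matfun_apply \<Gamma> f A v
        - (- (\<Sum>l<k. (\<Sum>j<m. f (z j) * \<omega> j * cauchy_transform S (\<lambda>s. poly (p l) s * w s) (z j)) *s ?P l))
        + (\<Sum>l<k. \<epsilon> l *s ?P l) = matfun_apply \<Gamma> f A v
        + (\<Sum>l<k. (1 / (2 * pi * \<i>) * coef r l - coef f l) *s ?P l + \<epsilon> l *s ?P l)"
      unfolding quad by (simp add: sum.distrib)
    also have "(\<Sum>l<k. (1 / (2 * pi * \<i>) * coef r l - coef f l) *s ?P l + \<epsilon> l *s ?P l) = (\<Sum>l<k. - (coef f l *s ?P l))"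
      by (rule sum.cong[OF refl]) (simp add: \<epsilon>_def flip: vector_sadd_rdistrib)
    also have "matfun_apply \<Gamma> f A v + \<dots> = matfun_apply \<Gamma> f A v - (\<Sum>l<k. coef f l *s ?P l)"
      by (simp add: sum_negf)
    finally have eq: "matfun_apply \<Gamma> f A v
        - (- (\<Sum>l<k. (\<Sum>j<m. f (z j) * \<omega> j * cauchy_transform S (\<lambda>s. poly (p l) s * w s) (z j)) *s ?P l))
        + (\<Sum>l<k. \<epsilon> l *s ?P l) = matfun_apply \<Gamma> f A v - (\<Sum>l<k. coef f l *s ?P l)" .
    show "N (matfun_apply \<Gamma> f A v
                 - (- (\<Sum>l<k. (\<Sum>j<m. f (z j) * \<omega> j *
                         cauchy_transform S (\<lambda>s. poly (p l) s * w s) (z j))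
                       *s (poly_mat (p l) A *v v)))
                 + (\<Sum>l<k. \<epsilon> l *s (poly_mat (p l) A *v v)))
              \<le> C * M * (\<Sum>i. rho powi (- int (i + k)) * N (poly_mat (p (i + k)) A *v v))"
      unfolding eq powi by (rule C(2)[OF f N])
  qed (rule C(1))
qed

end
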